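(* (The generalized small object argument) Let $C$ be a category containing all small colimits and let $I$ be an instrumented class of maps in $C$. Then there is a functorial factorization $(\gamma,\delta)$ on $C$ such that, for every morphism $f$ of $C$, $f=\delta(f)\circ\gamma(f)$, the map $\gamma(f)$ is in $I$-cell and the map $\delta(f)$ is in $I$-inj.
   Context: For a category $C$, $\mathrm{Map}\,C$ is the category of maps of $C$ with commutative squares as morphisms. $\mathrm{Pow}\,C$ is the category whose objects are all subsets of $\mathrm{obj}(C)$; a morphism $A\to B$ is a function $F\colon A\to\mathrm{mor}(C)$ with $\mathrm{dom}\,F(a)=a$ and $\mathrm{codom}\,F(a)\in B$ for all $a\in A$; composition is $(F_2\circ F_1)(a)=F_2(\mathrm{codom}\,F_1(a))\circ F_1(a)$, and the identity sends $a$ to $\mathrm{id}_a$. Let $O$ be a class of objects of $C$. A set of arrows $\psi_i\colon o_i\to c$ has the factorization property with respect to $O$ if every $\psi\colon o\to c$ with $o\in O$ factors as $o\to o_i\xrightarrow{\psi_i}c$ for some $i$. $O$ is locally small if for every object $c$ there is a set of arrows $o_i\to c$, $o_i\in O$, with the factorization property with respect to $O$. A factorization setup for $(C,O)$, $O$ locally small, is a functor $F\colon C\to\mathrm{Pow}(\mathrm{Map}\,C)$ such that for every object $c$ and morphism $f\colon c\to c'$: (1) $F(c)$ is a set of maps of the form $o\to c$, $o\in O$; (2) $F(c)$ has the factorization property with respect to $O$; (3) $F(f)$ assigns to each element $o\to c$ of $F(c)$ a commutative square whose vertical maps are $o\to c$ and some element $o'\to c'$ of $F(c')$, and whose bottom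 map is $f\colon c\to c'$. For a class $I$ of maps, $I$-inj is the class of maps with the right lifting property with respect to every map in $I$, and $I$-cell (relative $I$-cell complexes) is the class of transfinite compositions of pushouts of elements of $I$. An object $A$ is $\kappa$-small relative to a class $\mathcal D$ of maps if for all $\kappa$-filtered ordinals $\lambda$ and all $\lambda$-sequences $X_0\to X_1\to\cdots\to X_\beta\to\cdots$ (colimit-preserving functors from $\lambda$) with all maps $X_\beta\to X_{\beta+1}$ in $\mathcal D$, the natural map $\operatorname{colim}_{\beta<\lambda}C(A,X_\beta)\to C(A,\operatorname{colim}_{\beta<\lambda}X_\beta)$ is an isomorphism. A locally small class $I$ of maps of $C$ (locally small as a class of objects of $\mathrm{Map}\,C$) is instrumented if (1) there is a cardinal $\kappa$ such that every domain of a map in $I$ is $\kappa$-small relative to $I$-cell, and (2) there is a factorization setup for the pair $(\mathrm{Map}\,C,I)$. A functorial factorization $(\gamma,\delta)$ is a factorization $f=\delta(f)\gamma(f)$ that is functorial with respect to commutative squares, i.e. morphisms of $\mathrm{Map}\,C$. *)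

theory Defs
  imports Main "HOL-Library.FuncSet"
begin

unbundle cardinal_syntax

section \<open>Size\<close>

text \<open>
  The set/class distinction is taken relative to a Grothendieck universe, given by an uncountable
  strongly inaccessible cardinal \<open>U\<close>: a set (of any type) is small, i.e. a ``set'' as opposed to a
  ``class'', if its cardinality is below \<open>U\<close>. Classes are arbitrary sets in the sense of HOL.
  (HOL proves no type to carry such a \<open>U\<close>, so \<open>U\<close> is a parameter.)
\<close>

definition universe :: "'u rel \<Rightarrow> bool" where
  "universe U \<longleftrightarrow> Card_order U \<and> natLeq <o U \<and> regularCard U \<and>
     (\<forall>A::'u set. |A| <o U \<longrightarrow> |Pow A| <o U)"

definition small :: "'u rel \<Rightarrow> 'a set \<Rightarrow> bool" where
  "small U A \<longleftrightarrow> |A| <o U"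

section \<open>Categories and functors\<close>

record ('o, 'm) category =
  Obj :: "'o set"
  Arr :: "'m set"
  Dom :: "'m \<Rightarrow> 'o"
  Cod :: "'m \<Rightarrow> 'o"
  Ident :: "'o \<Rightarrow> 'm"
  Comp :: "'m \<Rightarrow> 'm \<Rightarrow> 'm"

text \<open>\<open>Comp C g f\<close> is the composite of \<open>f\<close> followed by \<open>g\<close>.\<close>

definition category :: "('o, 'm) category \<Rightarrow> bool" where
  "category C \<longleftrightarrow>
     (\<forall>f\<in>Arr C. Dom C f \<in> Obj C \<and> Cod C f \<in> Obj C) \<and>
     (\<forall>a\<in>Obj C. Ident C a \<in> Arr C \<and> Dom C (Ident C a) = a \<and> Cod C (Ident C a) = a) \<and>
     (\<forall>f\<in>Arr C. \<forall>g\<in>Arr C. Cod C f = Dom C g \<longrightarrow>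
        Comp C g f \<in> Arr C \<and> Dom C (Comp C g f) = Dom C f \<and> Cod C (Comp C g f) = Cod C g) \<and>
     (\<forall>f\<in>Arr C. Comp C f (Ident C (Dom C f)) = f \<and> Comp C (Ident C (Cod C f)) f = f) \<and>
     (\<forall>f\<in>Arr C. \<forall>g\<in>Arr C. \<forall>h\<in>Arr C. Cod C f = Dom C g \<and> Cod C g = Dom C h \<longrightarrow>
        Comp C h (Comp C g f) = Comp C (Comp C h g) f)"

definition Hom :: "('o, 'm) category \<Rightarrow> 'o \<Rightarrow> 'o \<Rightarrow> 'm set" where
  "Hom C a b = {f \<in> Arr C. Dom C f = a \<and> Cod C f = b}"

record ('o, 'm, 'p, 'n) funct =
  fob :: "'o \<Rightarrow> 'p"
  far :: "'m \<Rightarrow> 'n"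

definition is_functor ::
  "('o, 'm) category \<Rightarrow> ('p, 'n) category \<Rightarrow> ('o, 'm, 'p, 'n) funct \<Rightarrow> bool" where
  "is_functor C D F \<longleftrightarrow>
     (\<forall>a\<in>Obj C. fob F a \<in> Obj D) \<and>
     (\<forall>f\<in>Arr C. far F f \<in> Hom D (fob F (Dom C f)) (fob F (Cod C f))) \<and>
     (\<forall>a\<in>Obj C. far F (Ident C a) = Ident D (fob F a)) \<and>
     (\<forall>f\<in>Arr C. \<forall>g\<in>Arr C. Cod C f = Dom C g \<longrightarrow>
        far F (Comp C g f) = Comp D (far F g) (far F f))"

section \<open>The category of maps\<close>

text \<open>
  A square from the map \<open>sq_dom\<close> to the map \<open>sq_cod\<close> (its vertical sides) with horizontal sides
  \<open>sq_top\<close>, between the domains, and \<open>sq_bot\<close>, between the codomains.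
\<close>

datatype 'm square = Square (sq_dom: 'm) (sq_cod: 'm) (sq_top: 'm) (sq_bot: 'm)

definition comm_square :: "('o, 'm) category \<Rightarrow> 'm square \<Rightarrow> bool" where
  "comm_square C s \<longleftrightarrow>
     sq_dom s \<in> Arr C \<and> sq_cod s \<in> Arr C \<and>
     sq_top s \<in> Hom C (Dom C (sq_dom s)) (Dom C (sq_cod s)) \<and>
     sq_bot s \<in> Hom C (Cod C (sq_dom s)) (Cod C (sq_cod s)) \<and>
     Comp C (sq_cod s) (sq_top s) = Comp C (sq_bot s) (sq_dom s)"

definition map_cat :: "('o, 'm) category \<Rightarrow> ('m, 'm square) category" where
  "map_cat C = \<lparr>
     Obj = Arr C,
     Arr = {s. comm_square C s},
     Dom = sq_dom,
     Cod = sq_cod,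
     Ident = (\<lambda>f. Square f f (Ident C (Dom C f)) (Ident C (Cod C f))),
     Comp = (\<lambda>t s. Square (sq_dom s) (sq_cod t)
                     (Comp C (sq_top t) (sq_top s)) (Comp C (sq_bot t) (sq_bot s)))\<rparr>"

section \<open>The category Pow\<close>

text \<open>
  A morphism \<open>A \<rightarrow> B\<close> is encoded as \<open>(A, B, F)\<close>, where \<open>F\<close> is extensional: it is \<open>undefined\<close>
  outside \<open>A\<close>.
\<close>

definition pow_cat :: "'u rel \<Rightarrow> ('o, 'm) category \<Rightarrow>
    ('o set, 'o set \<times> 'o set \<times> ('o \<Rightarrow> 'm)) category" where
  "pow_cat U C = \<lparr>
     Obj = {A. A \<subseteq> Obj C \<and> small U A},
     Arr = {(A, B, F). A \<subseteq> Obj C \<and> small U A \<and> B \<subseteq> Obj C \<and> small U B \<and> F \<in> extensional A \<and>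
              (\<forall>a\<in>A. F a \<in> Arr C \<and> Dom C (F a) = a \<and> Cod C (F a) \<in> B)},
     Dom = (\<lambda>(A, B, F). A),
     Cod = (\<lambda>(A, B, F). B),
     Ident = (\<lambda>A. (A, A, restrict (Ident C) A)),
     Comp = (\<lambda>(B', D, F2) (A, B, F1).
               (A, D, \<lambda>a\<in>A. Comp C (F2 (Cod C (F1 a))) (F1 a)))\<rparr>"

section \<open>Colimits\<close>

definition is_cocone :: "('j, 'k) category \<Rightarrow> ('o, 'm) category \<Rightarrow> ('j, 'k, 'o, 'm) funct \<Rightarrow>
    'o \<Rightarrow> ('j \<Rightarrow> 'm) \<Rightarrow> bool" where
  "is_cocone J C D c \<iota> \<longleftrightarrow>
     c \<in> Obj C \<and> (\<forall>j\<in>Obj J. \<iota> j \<in> Hom C (fob D j) c) \<and>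
     (\<forall>k\<in>Arr J. Comp C (\<iota> (Cod J k)) (far D k) = \<iota> (Dom J k))"

definition is_colimit :: "('j, 'k) category \<Rightarrow> ('o, 'm) category \<Rightarrow> ('j, 'k, 'o, 'm) funct \<Rightarrow>
    'o \<Rightarrow> ('j \<Rightarrow> 'm) \<Rightarrow> bool" where
  "is_colimit J C D c \<iota> \<longleftrightarrow>
     is_cocone J C D c \<iota> \<and>
     (\<forall>d \<tau>. is_cocone J C D d \<tau> \<longrightarrow>
        (\<exists>!h. h \<in> Hom C c d \<and> (\<forall>j\<in>Obj J. Comp C h (\<iota> j) = \<tau> j)))"

text \<open>Every small category is isomorphic to one whose objects and arrows are elements of \<open>'u\<close>.\<close>

definition has_small_colimits :: "'u rel \<Rightarrow> ('o, 'm) category \<Rightarrow> bool" where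
  "has_small_colimits U C \<longleftrightarrow>
     (\<forall>(J :: ('u, 'u) category) D.
        category J \<and> small U (Obj J) \<and> small U (Arr J) \<and> is_functor J C D \<longrightarrow>
        (\<exists>c \<iota>. is_colimit J C D c \<iota>))"

text \<open>\<open>f\<close> is the pushout of \<open>i\<close> along \<open>u\<close>, with opposite side \<open>v\<close>.\<close>

definition is_pushout :: "('o, 'm) category \<Rightarrow> 'm \<Rightarrow> 'm \<Rightarrow> 'm \<Rightarrow> 'm \<Rightarrow> bool" where
  "is_pushout C i u f v \<longleftrightarrow>
     comm_square C (Square i f u v) \<and>
     (\<forall>x\<in>Arr C. \<forall>y\<in>Arr C.
        Dom C x = Cod C u \<and> Dom C y = Cod C i \<and> Cod C x = Cod C y \<and> Comp C x u = Comp C y i \<longrightarrow>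
        (\<exists>!h. h \<in> Hom C (Cod C f) (Cod C x) \<and> Comp C h f = x \<and> Comp C h v = y))"

definition pushouts :: "('o, 'm) category \<Rightarrow> 'm set \<Rightarrow> 'm set" where
  "pushouts C I = {f. \<exists>i\<in>I. \<exists>u v. is_pushout C i u f v}"

text \<open>
  The colimit of a diagram of sets: objects \<open>j\<close> go to \<open>S j\<close> and arrows \<open>k\<close> to the function \<open>T k\<close>.
\<close>

definition set_colim_rel :: "('j, 'k) category \<Rightarrow> ('j \<Rightarrow> 'a set) \<Rightarrow> ('k \<Rightarrow> 'a \<Rightarrow> 'a) \<Rightarrow>
    ('j \<times> 'a) rel" where
  "set_colim_rel J S T =
     {((Dom J k, x), (Cod J k, T k x)) | k x. k \<in> Arr J \<and> x \<in> S (Dom J k)}"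

definition set_colim :: "('j, 'k) category \<Rightarrow> ('j \<Rightarrow> 'a set) \<Rightarrow> ('k \<Rightarrow> 'a \<Rightarrow> 'a) \<Rightarrow>
    ('j \<times> 'a) set set" where
  "set_colim J S T =
     Sigma (Obj J) S // (set_colim_rel J S T \<union> (set_colim_rel J S T)\<inverse>)\<^sup>*"

text \<open>
  \<open>hom_colim J C A X\<close> is the colimit of the sets \<open>C(A, X j)\<close>; for a cocone \<open>\<iota>\<close> on \<open>X\<close> with vertex
  \<open>c\<close>, \<open>hom_colim_map C \<iota>\<close> is the natural map from it to \<open>C(A, c)\<close>.
\<close>

definition hom_colim :: "('j, 'k) category \<Rightarrow> ('o, 'm) category \<Rightarrow> 'o \<Rightarrow>
    ('j, 'k, 'o, 'm) funct \<Rightarrow> ('j \<times> 'm) set set" where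
  "hom_colim J C A X = set_colim J (\<lambda>j. Hom C A (fob X j)) (\<lambda>k g. Comp C (far X k) g)"

definition hom_colim_map :: "('o, 'm) category \<Rightarrow> ('j \<Rightarrow> 'm) \<Rightarrow> ('j \<times> 'm) set \<Rightarrow> 'm" where
  "hom_colim_map C \<iota> Q = the_elem ((\<lambda>(j, g). Comp C (\<iota> j) g) ` Q)"

section \<open>Transfinite sequences\<close>

text \<open>
  A (small) ordinal is represented by a well-order \<open>r\<close> on a small subset of \<open>'u\<close>; \<open>\<beta>\<close> ranges over
  \<open>Field r\<close>, and the ordinal \<open>\<gamma> \<in> Field r\<close> is the restriction of \<open>r\<close> to \<open>underS r \<gamma>\<close>.
\<close>

definition small_ordinal :: "'u rel \<Rightarrow> 'u rel \<Rightarrow> bool" where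
  "small_ordinal U r \<longleftrightarrow> Well_order r \<and> small U (Field r)"

definition limit_ordinal :: "'u rel \<Rightarrow> bool" where
  "limit_ordinal r \<longleftrightarrow> Field r \<noteq> {} \<and> (\<forall>\<beta>\<in>Field r. aboveS r \<beta> \<noteq> {})"

definition filtered_ordinal :: "'u rel \<Rightarrow> 'u rel \<Rightarrow> bool" where
  "filtered_ordinal \<kappa> r \<longleftrightarrow>
     limit_ordinal r \<and> (\<forall>A. A \<subseteq> Field r \<and> |A| \<le>o \<kappa> \<longrightarrow> Above r A \<noteq> {})"

definition ordinal_cat :: "'u rel \<Rightarrow> ('u, 'u \<times> 'u) category" where
  "ordinal_cat r = \<lparr>Obj = Field r, Arr = r, Dom = fst, Cod = snd, Ident = (\<lambda>a. (a, a)),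
     Comp = (\<lambda>g f. (fst f, snd g))\<rparr>"

text \<open>
  Preservation of colimits means continuity at limit ordinals: \<open>X \<gamma>\<close> is the colimit of the
  \<open>X \<beta>\<close>, \<open>\<beta> < \<gamma>\<close>. (Preservation of, say, the empty colimit is not meant: it would force
  \<open>X 0\<close> to be initial.)
\<close>

definition transfinite_sequence ::
  "('o, 'm) category \<Rightarrow> 'u rel \<Rightarrow> ('u, 'u \<times> 'u, 'o, 'm) funct \<Rightarrow> bool" where
  "transfinite_sequence C r X \<longleftrightarrow>
     is_functor (ordinal_cat r) C X \<and>
     (\<forall>\<gamma>\<in>Field r. limit_ordinal (Restr r (underS r \<gamma>)) \<longrightarrow>
        is_colimit (ordinal_cat (Restr r (underS r \<gamma>))) C X (fob X \<gamma>) (\<lambda>\<beta>. far X (\<beta>, \<gamma>)))"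

text \<open>The maps \<open>X \<beta> \<rightarrow> X (\<beta> + 1)\<close>, for \<open>\<beta> + 1\<close> still in the ordinal, lie in \<open>D\<close>.\<close>

definition steps_in :: "'m set \<Rightarrow> 'u rel \<Rightarrow> ('u, 'u \<times> 'u, 'o, 'm) funct \<Rightarrow> bool" where
  "steps_in D r X \<longleftrightarrow>
     (\<forall>\<beta>\<in>Field r. aboveS r \<beta> \<noteq> {} \<longrightarrow> far X (\<beta>, wo_rel.suc r {\<beta>}) \<in> D)"

definition transfinite_compositions :: "'u rel \<Rightarrow> ('o, 'm) category \<Rightarrow> 'm set \<Rightarrow> 'm set" where
  "transfinite_compositions U C D =
     {f. \<exists>(r :: 'u rel) X c \<iota>. small_ordinal U r \<and> Field r \<noteq> {} \<and>
           transfinite_sequence C r X \<and> steps_in D r X \<and>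
           is_colimit (ordinal_cat r) C X c \<iota> \<and> f = \<iota> (wo_rel.minim r (Field r))}"

definition cell :: "'u rel \<Rightarrow> ('o, 'm) category \<Rightarrow> 'm set \<Rightarrow> 'm set" where
  "cell U C I = transfinite_compositions U C (pushouts C I)"

definition small_relative :: "'u rel \<Rightarrow> ('o, 'm) category \<Rightarrow> 'u rel \<Rightarrow> 'm set \<Rightarrow> 'o \<Rightarrow> bool" where
  "small_relative U C \<kappa> D A \<longleftrightarrow>
     (\<forall>(r :: 'u rel) X c \<iota>.
        small_ordinal U r \<and> filtered_ordinal \<kappa> r \<and> transfinite_sequence C r X \<and> steps_in D r X \<and>
        is_colimit (ordinal_cat r) C X c \<iota> \<longrightarrow>
        bij_betw (hom_colim_map C \<iota>) (hom_colim (ordinal_cat r) C A X) (Hom C A c))"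

section \<open>Lifting properties and factorizations\<close>

definition lifting_property :: "('o, 'm) category \<Rightarrow> 'm \<Rightarrow> 'm \<Rightarrow> bool" where
  "lifting_property C i p \<longleftrightarrow>
     (\<forall>u v. comm_square C (Square i p u v) \<longrightarrow>
        (\<exists>h \<in> Hom C (Cod C i) (Dom C p). Comp C h i = u \<and> Comp C p h = v))"

definition inj_maps :: "('o, 'm) category \<Rightarrow> 'm set \<Rightarrow> 'm set" where
  "inj_maps C I = {p \<in> Arr C. \<forall>i\<in>I. lifting_property C i p}"

text \<open>
  The first three equations say that the domains of \<open>f\<close> and \<open>\<gamma> f\<close>, the codomains of \<open>f\<close> and
  \<open>\<delta> f\<close>, and the middle objects \<open>Cod (\<gamma> f) = Dom (\<delta> f)\<close> agree as functors of \<open>f\<close>.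
\<close>

definition functorial_factorization :: "('o, 'm) category \<Rightarrow>
    ('m, 'm square, 'm, 'm square) funct \<Rightarrow> ('m, 'm square, 'm, 'm square) funct \<Rightarrow> bool" where
  "functorial_factorization C \<gamma> \<delta> \<longleftrightarrow>
     is_functor (map_cat C) (map_cat C) \<gamma> \<and> is_functor (map_cat C) (map_cat C) \<delta> \<and>
     (\<forall>s \<in> Arr (map_cat C). sq_top (far \<gamma> s) = sq_top s \<and> sq_bot (far \<gamma> s) = sq_top (far \<delta> s) \<and>
        sq_bot (far \<delta> s) = sq_bot s) \<and>
     (\<forall>f \<in> Arr C. Cod C (fob \<gamma> f) = Dom C (fob \<delta> f) \<and> Comp C (fob \<delta> f) (fob \<gamma> f) = f)"

section \<open>Instrumented classes of maps\<close>

definition factorization_property :: "('o, 'm) category \<Rightarrow> 'o set \<Rightarrow> 'o \<Rightarrow> 'm set \<Rightarrow> bool" where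
  "factorization_property C Q c S \<longleftrightarrow>
     (\<forall>\<psi>\<in>Arr C. Dom C \<psi> \<in> Q \<and> Cod C \<psi> = c \<longrightarrow>
        (\<exists>s\<in>S. \<exists>g \<in> Hom C (Dom C \<psi>) (Dom C s). \<psi> = Comp C s g))"

definition locally_small :: "'u rel \<Rightarrow> ('o, 'm) category \<Rightarrow> 'o set \<Rightarrow> bool" where
  "locally_small U C Q \<longleftrightarrow>
     Q \<subseteq> Obj C \<and>
     (\<forall>c\<in>Obj C. \<exists>S. small U S \<and> S \<subseteq> {s \<in> Arr C. Dom C s \<in> Q \<and> Cod C s = c} \<and>
        factorization_property C Q c S)"

definition factorization_setup :: "'u rel \<Rightarrow> ('o, 'm) category \<Rightarrow> 'o set \<Rightarrow>
    ('o, 'm, 'm set, 'm set \<times> 'm set \<times> ('m \<Rightarrow> 'm square)) funct \<Rightarrow> bool" where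
  "factorization_setup U C Q F \<longleftrightarrow>
     is_functor C (pow_cat U (map_cat C)) F \<and>
     (\<forall>c\<in>Obj C. fob F c \<subseteq> {s \<in> Arr C. Dom C s \<in> Q \<and> Cod C s = c} \<and>
        factorization_property C Q c (fob F c)) \<and>
     (\<forall>f\<in>Arr C. case far F f of (A, B, G) \<Rightarrow>
        \<forall>s \<in> fob F (Dom C f). sq_dom (G s) = s \<and> sq_cod (G s) \<in> fob F (Cod C f) \<and> sq_bot (G s) = f)"

definition instrumented :: "'u rel \<Rightarrow> ('o, 'm) category \<Rightarrow> 'm set \<Rightarrow> bool" where
  "instrumented U C I \<longleftrightarrow>
     locally_small U (map_cat C) I \<and>
     (\<exists>\<kappa> :: 'u rel. Card_order \<kappa> \<and> \<kappa> <o U \<and>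
        (\<forall>i\<in>I. small_relative U C \<kappa> (cell U C I) (Dom C i))) \<and>
     (\<exists>F. factorization_setup U (map_cat C) I F)"

section \<open>The constructions above yield categories\<close>

lemma category_ordinal_cat: "Well_order r \<Longrightarrow> category (ordinal_cat r)"
  by (auto simp: category_def ordinal_cat_def order_on_defs refl_on_def Field_def
      dest: transD)

lemma category_map_cat:
  assumes "category C"
  shows "category (map_cat C)"
proof -
  have comp: "comm_square C (Square (sq_dom s) (sq_cod t)
      (Comp C (sq_top t) (sq_top s)) (Comp C (sq_bot t) (sq_bot s)))"
    if "comm_square C s" "comm_square C t" "sq_cod s = sq_dom t" for s t
    using assms that unfolding comm_square_def category_def Hom_def
    by simp metis
  show ?thesis
    unfolding category_def [of "map_cat C"]
  proof (intro conjI ballI impI)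
    fix s assume "s \<in> Arr (map_cat C)"
    then show "Comp (map_cat C) s (Ident (map_cat C) (Dom (map_cat C) s)) = s"
      "Comp (map_cat C) (Ident (map_cat C) (Cod (map_cat C) s)) s = s"
      using assms by (cases s; auto simp: map_cat_def comm_square_def category_def Hom_def; metis)+
  qed (use comp assms in \<open>auto simp: map_cat_def comm_square_def category_def Hom_def\<close>)
qed

lemma category_pow_cat:
  assumes "category C"
  shows "category (pow_cat U C)"
  using assms unfolding category_def pow_cat_def
  by (fastforce simp: restrict_def extensional_def fun_eq_iff)

end

theory Submission
  imports Defs
begin

text \<open>
  To turn a map \<open>p: E \<rightarrow> Y\<close> into one with the right lifting property, attach to \<open>E\<close> the codomain
  of a map \<open>i\<close> of \<open>I\<close> for every square from \<open>i\<close> to \<open>p\<close>; in the new object \<open>E'\<close> every lifting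
  problem posed by \<open>E\<close> is solved, but new ones arise, so this is repeated transfinitely. There may be a
  proper class of squares from \<open>I\<close> to \<open>p\<close>. A factorization setup \<open>F\<close> replaces them by a small set
  \<open>F p\<close> through which all others factor, and does so functorially in \<open>p\<close>. So one step is an
  endofunctor \<open>T\<close> of \<open>Map C\<close> that leaves codomains alone, with a natural map
  \<open>j p: dom p \<rightarrow> dom (T p)\<close> over the codomain (\<open>one_step_factorization\<close>).

  The step is iterated along a \<open>\<kappa>\<close>-filtered ordinal, not for one map \<open>f\<close> at a time but on
  the endofunctors of \<open>Map C\<close> over the codomain, which form a category \<open>right_part_cat\<close>. There the
  recursion (\<open>transfinite_iteration\<close>) has to make choices only at limit stages, where colimits are
  computed pointwise (\<open>right_part_colimit\<close>), and its outcome is functorial in \<open>f\<close> by construction.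
  Let \<open>\<delta>\<close> be the colimit of the iteration and \<open>\<gamma> f\<close> the map from stage \<open>0\<close>, which is \<open>dom f\<close>, to
  \<open>dom (\<delta> f)\<close>. The domain of a map \<open>i\<close> of \<open>I\<close> is \<open>\<kappa>\<close>-small, so a square from \<open>i\<close> to
  \<open>\<delta> f\<close> comes from some stage \<open>b\<close>, and it has a lift at stage \<open>b + 1\<close>. Hence \<open>\<delta> f\<close> is in
  \<open>I\<close>-inj.

  That \<open>\<gamma> f\<close> lies in \<open>I\<close>-cell is the laborious half, because a cell complex has to attach one map
  of \<open>I\<close> at each step. First, a map \<open>j p\<close> that attaches a small family at once is in \<open>I\<close>-cell
  (\<open>attachment_in_cell\<close>): well-order the family. Second, \<open>I\<close>-cell is closed under transfinite
  composition (\<open>cell_transfinite_composition\<close>): concatenate the sequences along a lexicographic sum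
  of ordinals. Both constructions produce sequences in which some steps are isomorphisms, and an
  isomorphism need not be a pushout of a map of \<open>I\<close>. So both rest on \<open>cell_absorbs_isos\<close>, which
  deletes from a sequence the stages that are reached by isomorphisms only. Colimits over the
  various index sets are compared by \<open>colimit_along_final\<close>.
\<close>

section \<open>Categories and ordered diagrams\<close>

locale cat =
  fixes C :: "('o, 'm) category"
  assumes category: "category C"
begin

abbreviation comp (infixr "\<cdot>" 70) where "g \<cdot> f \<equiv> Comp C g f"

lemma HomI: "f \<in> Arr C \<Longrightarrow> f \<in> Hom C (Dom C f) (Cod C f)"
  by (simp add: Hom_def)

lemma HomD:
  assumes "f \<in> Hom C a b"
  shows "f \<in> Arr C" "Dom C f = a" "Cod C f = b" "a \<in> Obj C" "b \<in> Obj C"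
  using assms category by (auto simp: Hom_def category_def)

lemma comp_in_Hom [intro]: "f \<in> Hom C a b \<Longrightarrow> g \<in> Hom C b c \<Longrightarrow> g \<cdot> f \<in> Hom C a c"
  using category by (auto simp: Hom_def category_def)

lemma Ident_in_Hom [intro]: "a \<in> Obj C \<Longrightarrow> Ident C a \<in> Hom C a a"
  using category by (auto simp: Hom_def category_def)

lemma comp_assoc:
  "f \<in> Hom C a b \<Longrightarrow> g \<in> Hom C b c \<Longrightarrow> h \<in> Hom C c d \<Longrightarrow> (h \<cdot> g) \<cdot> f = h \<cdot> g \<cdot> f"
  using category by (auto simp: Hom_def category_def)

lemma comp_Ident: "f \<in> Hom C a b \<Longrightarrow> f \<cdot> Ident C a = f"
  and Ident_comp: "f \<in> Hom C a b \<Longrightarrow> Ident C b \<cdot> f = f"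
  using category by (auto simp: Hom_def category_def)

lemma arr_simps:
  assumes "f \<in> Arr C" "g \<in> Arr C" "Cod C f = Dom C g"
  shows "g \<cdot> f \<in> Arr C" "Dom C (g \<cdot> f) = Dom C f" "Cod C (g \<cdot> f) = Cod C g"
    and "h \<in> Arr C \<Longrightarrow> Cod C g = Dom C h \<Longrightarrow> (h \<cdot> g) \<cdot> f = h \<cdot> g \<cdot> f"
  using assms category by (auto simp: category_def)

lemma Ident_simps:
  "f \<in> Arr C \<Longrightarrow> Dom C f = a \<Longrightarrow> f \<cdot> Ident C a = f"
  "f \<in> Arr C \<Longrightarrow> Cod C f = a \<Longrightarrow> Ident C a \<cdot> f = f"
  "a \<in> Obj C \<Longrightarrow> Ident C a \<in> Arr C"
  "a \<in> Obj C \<Longrightarrow> Dom C (Ident C a) = a" "a \<in> Obj C \<Longrightarrow> Cod C (Ident C a) = a"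
  using category by (auto simp: category_def)

text \<open>The form of \<open>h \<cdot> g = k\<close> that applies inside a composite associated to the right.\<close>
lemma comp_reduce:
  "h \<cdot> g = k \<Longrightarrow> f \<in> Hom C a b \<Longrightarrow> g \<in> Hom C b c \<Longrightarrow> h \<in> Hom C c d \<Longrightarrow> h \<cdot> g \<cdot> f = k \<cdot> f"
  using comp_assoc by metis

definition isos :: "'m set" where
  "isos = {f \<in> Arr C. \<exists>g \<in> Hom C (Cod C f) (Dom C f).
     g \<cdot> f = Ident C (Dom C f) \<and> f \<cdot> g = Ident C (Cod C f)}"

lemma isosI:
  assumes "f \<in> Hom C a b" "g \<in> Hom C b a" "g \<cdot> f = Ident C a" "f \<cdot> g = Ident C b"
  shows "f \<in> isos"
  using assms by (auto simp: isos_def dest: HomD)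

lemma isosE:
  assumes "f \<in> isos" "f \<in> Hom C a b"
  obtains g where "g \<in> Hom C b a" "g \<cdot> f = Ident C a" "f \<cdot> g = Ident C b"
  using assms by (auto simp: isos_def dest: HomD)

lemma Ident_isos: "a \<in> Obj C \<Longrightarrow> Ident C a \<in> isos"
  by (rule isosI[of _ a a "Ident C a"]) (auto intro: comp_Ident)

lemma isos_comp:
  assumes f: "f \<in> isos" "f \<in> Hom C a b" and g: "g \<in> isos" "g \<in> Hom C b c"
  shows "g \<cdot> f \<in> isos"
proof -
  obtain f' where f': "f' \<in> Hom C b a" "f' \<cdot> f = Ident C a" "f \<cdot> f' = Ident C b"
    using f by (rule isosE)
  obtain g' where g': "g' \<in> Hom C c b" "g' \<cdot> g = Ident C b" "g \<cdot> g' = Ident C c"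
    using g by (rule isosE)
  show ?thesis
  proof (rule isosI)
    show "g \<cdot> f \<in> Hom C a c" "f' \<cdot> g' \<in> Hom C c a" using f g f' g' by auto
    have "g' \<cdot> g \<cdot> f = f" "f \<cdot> f' \<cdot> g' = g'"
      using comp_reduce[OF g'(2) f(2) g(2) g'(1)] comp_reduce[OF f'(3) g'(1) f'(1) f(2)]
        Ident_comp[OF f(2)] Ident_comp[OF g'(1)] by simp_all
    then show "(f' \<cdot> g') \<cdot> (g \<cdot> f) = Ident C a" "(g \<cdot> f) \<cdot> (f' \<cdot> g') = Ident C c"
      using f f' g g' by (simp_all add: Hom_def arr_simps)
  qed
qed

text \<open>
  A preorder of any type, not only one on \<open>'u\<close>, serves as the shape of a diagram: a lexicographic
  sum, say, lives on a type of pairs.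
\<close>
abbreviation diagram :: "'j rel \<Rightarrow> ('j, 'j \<times> 'j, 'o, 'm) funct \<Rightarrow> bool" where
  "diagram R X \<equiv> is_functor (ordinal_cat R) C X"

abbreviation cocone :: "'j rel \<Rightarrow> ('j, 'j \<times> 'j, 'o, 'm) funct \<Rightarrow> 'o \<Rightarrow> ('j \<Rightarrow> 'm) \<Rightarrow> bool" where
  "cocone R X c \<iota> \<equiv> is_cocone (ordinal_cat R) C X c \<iota>"

abbreviation colim :: "'j rel \<Rightarrow> ('j, 'j \<times> 'j, 'o, 'm) funct \<Rightarrow> 'o \<Rightarrow> ('j \<Rightarrow> 'm) \<Rightarrow> bool" where
  "colim R X c \<iota> \<equiv> is_colimit (ordinal_cat R) C X c \<iota>"

lemma is_functor_ordinal_cat: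
  "diagram R X \<longleftrightarrow>
    (\<forall>a\<in>Field R. fob X a \<in> Obj C) \<and>
    (\<forall>a b. (a, b) \<in> R \<longrightarrow> far X (a, b) \<in> Hom C (fob X a) (fob X b)) \<and>
    (\<forall>a\<in>Field R. far X (a, a) = Ident C (fob X a)) \<and>
    (\<forall>a b c. (a, b) \<in> R \<longrightarrow> (b, c) \<in> R \<longrightarrow> far X (a, c) = far X (b, c) \<cdot> far X (a, b))"
  unfolding is_functor_def ordinal_cat_def by fastforce

lemma is_cocone_ordinal_cat:
  "cocone R X c \<iota> \<longleftrightarrow>
    c \<in> Obj C \<and> (\<forall>a\<in>Field R. \<iota> a \<in> Hom C (fob X a) c) \<and>
    (\<forall>a b. (a, b) \<in> R \<longrightarrow> \<iota> b \<cdot> far X (a, b) = \<iota> a)"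
  unfolding is_cocone_def ordinal_cat_def by fastforce

lemma is_colimit_ordinal_cat:
  "colim R X c \<iota> \<longleftrightarrow>
    cocone R X c \<iota> \<and>
    (\<forall>d \<tau>. cocone R X d \<tau> \<longrightarrow>
        (\<exists>!h. h \<in> Hom C c d \<and> (\<forall>a\<in>Field R. h \<cdot> \<iota> a = \<tau> a)))"
  unfolding is_colimit_def by (simp add: ordinal_cat_def)

lemma functorD:
  assumes "diagram R X"
  shows functor_Obj: "a \<in> Field R \<Longrightarrow> fob X a \<in> Obj C"
    and functor_Hom: "(a, b) \<in> R \<Longrightarrow> far X (a, b) \<in> Hom C (fob X a) (fob X b)"
    and functor_Ident: "a \<in> Field R \<Longrightarrow> far X (a, a) = Ident C (fob X a)"
    and functor_comp: "(a, b) \<in> R \<Longrightarrow> (b, c) \<in> R \<Longrightarrow> far X (b, c) \<cdot> far X (a, b) = far X (a, c)"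
  using assms unfolding is_functor_ordinal_cat by metis+

lemma coconeD:
  assumes "cocone R X c \<iota>"
  shows cocone_Obj: "c \<in> Obj C"
    and cocone_Hom: "a \<in> Field R \<Longrightarrow> \<iota> a \<in> Hom C (fob X a) c"
    and cocone_comp: "(a, b) \<in> R \<Longrightarrow> \<iota> b \<cdot> far X (a, b) = \<iota> a"
  using assms unfolding is_cocone_ordinal_cat by metis+

lemma colimitD:
  assumes "colim R X c \<iota>"
  shows colimit_cocone: "cocone R X c \<iota>"
    and colimit_ex1: "cocone R X d \<tau> \<Longrightarrow>
      \<exists>!h. h \<in> Hom C c d \<and> (\<forall>a\<in>Field R. h \<cdot> \<iota> a = \<tau> a)"
  using assms unfolding is_colimit_ordinal_cat by blast+

lemma cocone_post:
  assumes "cocone R X c \<iota>" "diagram R X" "h \<in> Hom C c d"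
  shows "cocone R X d (\<lambda>a. h \<cdot> \<iota> a)"
  unfolding is_cocone_ordinal_cat
proof (intro conjI ballI allI impI)
  show "d \<in> Obj C" using assms(3) by (rule HomD)
next
  fix a assume "a \<in> Field R"
  then show "h \<cdot> \<iota> a \<in> Hom C (fob X a) d" using assms(3) cocone_Hom[OF assms(1)] by blast
next
  fix a b assume ab: "(a, b) \<in> R"
  then have "b \<in> Field R" by (auto simp: Field_def)
  then show "(h \<cdot> \<iota> b) \<cdot> far X (a, b) = h \<cdot> \<iota> a"
    using ab comp_assoc[OF functor_Hom[OF assms(2) ab] cocone_Hom[OF assms(1)] assms(3)]
      cocone_comp[OF assms(1) ab] by simp
qed

lemma colimit_ext:
  assumes co: "colim R X c \<iota>" and X: "diagram R X"
    and h: "h \<in> Hom C c d" "h' \<in> Hom C c d"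
    and eq: "\<And>a. a \<in> Field R \<Longrightarrow> h \<cdot> \<iota> a = h' \<cdot> \<iota> a"
  shows "h = h'"
  using colimit_ex1[OF co cocone_post[OF colimit_cocone[OF co] X h(1)]] h eq by metis

lemma colimit_cong:
  assumes "colim R X c \<iota>"
    and "\<And>a. a \<in> Field R \<Longrightarrow> fob X a = fob Y a" "\<And>a b. (a, b) \<in> R \<Longrightarrow> far X (a, b) = far Y (a, b)"
    and "\<And>a. a \<in> Field R \<Longrightarrow> \<iota> a = \<kappa> a"
  shows "colim R Y c \<kappa>"
proof -
  have fld: "a \<in> Field R" "b \<in> Field R" if "(a, b) \<in> R" for a b
    using that by (auto simp: Field_def)
  have "cocone R X d \<tau> = cocone R Y d \<tau>" for d \<tau>
    using assms(2,3) unfolding is_cocone_ordinal_cat by auto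
  moreover have "cocone R X c \<iota> = cocone R X c \<kappa>"
    using assms(4) fld unfolding is_cocone_ordinal_cat by auto
  ultimately show ?thesis
    using assms(1,4) unfolding is_colimit_ordinal_cat by auto
qed

text \<open>
  Restriction along \<open>h: R \<rightarrow> R'\<close> preserves and reflects colimits if every \<open>X' t\<close> maps naturally to
  some \<open>X (j t)\<close> in a way that becomes trivial further up. A cocone \<open>\<tau>\<close> on \<open>R\<close> then has exactly
  one extension to \<open>R'\<close>, namely \<open>\<tau> (j t) \<cdot> e t\<close>. There are two cases of interest: \<open>h\<close> is cofinal,
  where \<open>e t\<close> is a map of the diagram \<open>X'\<close>; and \<open>t\<close> is above \<open>h (j t)\<close> with \<open>X' (h (j t)) \<rightarrow> X' t\<close>
  invertible, where \<open>e t\<close> is the inverse.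
\<close>
lemma colimit_along_final:
  assumes X: "diagram R X" and X': "diagram R' X'"
    and h: "\<And>a. a \<in> Field R \<Longrightarrow> h a \<in> Field R'" "\<And>a b. (a, b) \<in> R \<Longrightarrow> (h a, h b) \<in> R'"
    and ob: "\<And>a. a \<in> Field R \<Longrightarrow> fob X a = fob X' (h a)"
    and ar: "\<And>a b. (a, b) \<in> R \<Longrightarrow> far X (a, b) = far X' (h a, h b)"
    and j: "\<And>t. t \<in> Field R' \<Longrightarrow> j t \<in> Field R"
    and e: "\<And>t. t \<in> Field R' \<Longrightarrow> e t \<in> Hom C (fob X' t) (fob X (j t))"
    and split: "\<And>t. t \<in> Field R' \<Longrightarrow>
      \<exists>w. (h (j t), w) \<in> R' \<and> (t, w) \<in> R' \<and> far X' (h (j t), w) \<cdot> e t = far X' (t, w)"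
    and nat: "\<And>t t'. (t, t') \<in> R' \<Longrightarrow>
      \<exists>k. (j t, k) \<in> R \<and> (j t', k) \<in> R \<and>
        far X (j t, k) \<cdot> e t = far X (j t', k) \<cdot> e t' \<cdot> far X' (t, t')"
    and ret: "\<And>a. a \<in> Field R \<Longrightarrow>
      \<exists>k. (j (h a), k) \<in> R \<and> (a, k) \<in> R \<and> far X (j (h a), k) \<cdot> e (h a) = far X (a, k)"
    and co: "cocone R' X' c \<iota>"
  shows "colim R X c (\<lambda>a. \<iota> (h a)) \<longleftrightarrow>
    colim R' X' c \<iota>"
proof -
  have fld: "a \<in> Field R" "b \<in> Field R" if "(a, b) \<in> R" for a b
    using that by (auto simp: Field_def)
  have fld': "a \<in> Field R'" "b \<in> Field R'" if "(a, b) \<in> R'" for a b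
    using that by (auto simp: Field_def)
  have restr: "cocone R X d (\<lambda>a. \<tau> (h a))"
    if "cocone R' X' d \<tau>" for d \<tau>
    using that h ob ar unfolding is_cocone_ordinal_cat by auto
  have det: "\<tau> (h (j t)) \<cdot> e t = \<tau> t"
    if \<tau>: "cocone R' X' d \<tau>" and t: "t \<in> Field R'" for d \<tau> t
  proof -
    obtain w where w: "(h (j t), w) \<in> R'" "(t, w) \<in> R'"
        "far X' (h (j t), w) \<cdot> e t = far X' (t, w)"
      using split[OF t] by blast
    have "\<tau> (h (j t)) \<cdot> e t = (\<tau> w \<cdot> far X' (h (j t), w)) \<cdot> e t"
      using cocone_comp[OF \<tau> w(1)] by simp
    also have "\<dots> = \<tau> w \<cdot> far X' (h (j t), w) \<cdot> e t"
      by (rule comp_assoc[OF _ functor_Hom[OF X' w(1)] cocone_Hom[OF \<tau> fld'(2)[OF w(1)]]])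
        (use e[OF t] ob[OF j[OF t]] in simp)
    also have "\<dots> = \<tau> t" using w(3) cocone_comp[OF \<tau> w(2)] by simp
    finally show ?thesis .
  qed
  have ext: "cocone R' X' d (\<lambda>t. \<tau> (j t) \<cdot> e t)"
      and ext_h: "\<And>a. a \<in> Field R \<Longrightarrow> \<tau> (j (h a)) \<cdot> e (h a) = \<tau> a"
    if \<tau>: "cocone R X d \<tau>" for d \<tau>
  proof -
    have factor: "\<tau> k \<cdot> far X (j t, k) \<cdot> e t = \<tau> (j t) \<cdot> e t"
      if "(j t, k) \<in> R" "t \<in> Field R'" for t k
      using comp_assoc[OF e[OF that(2)] functor_Hom[OF X that(1)] cocone_Hom[OF \<tau> fld(2)[OF that(1)]]]
        cocone_comp[OF \<tau> that(1)] by simp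
    show "cocone R' X' d (\<lambda>t. \<tau> (j t) \<cdot> e t)"
      unfolding is_cocone_ordinal_cat
    proof (intro conjI ballI allI impI)
      show "d \<in> Obj C" by (rule cocone_Obj[OF \<tau>])
    next
      fix t assume "t \<in> Field R'"
      then show "\<tau> (j t) \<cdot> e t \<in> Hom C (fob X' t) d"
        using cocone_Hom[OF \<tau> j] e by blast
    next
      fix t t' assume t: "(t, t') \<in> R'"
      obtain k where k: "(j t, k) \<in> R" "(j t', k) \<in> R"
          "far X (j t, k) \<cdot> e t = far X (j t', k) \<cdot> e t' \<cdot> far X' (t, t')"
        using nat[OF t] by blast
      note m = functor_Hom[OF X' t] e[OF fld'(2)[OF t]] functor_Hom[OF X k(2)]
        cocone_Hom[OF \<tau> fld(2)[OF k(1)]] cocone_Hom[OF \<tau> fld(1)[OF k(2)]]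
      have "(\<tau> (j t') \<cdot> e t') \<cdot> far X' (t, t') = (\<tau> k \<cdot> far X (j t', k) \<cdot> e t') \<cdot> far X' (t, t')"
        using factor[OF k(2) fld'(2)[OF t]] by simp
      also have "\<dots> = \<tau> k \<cdot> far X (j t', k) \<cdot> e t' \<cdot> far X' (t, t')"
        using m by (simp add: Hom_def arr_simps)
      also have "\<dots> = \<tau> (j t) \<cdot> e t"
        using k(3) factor[OF k(1) fld'(1)[OF t]] by simp
      finally show "(\<tau> (j t') \<cdot> e t') \<cdot> far X' (t, t') = \<tau> (j t) \<cdot> e t" .
    qed
    fix a assume a: "a \<in> Field R"
    obtain k where k: "(j (h a), k) \<in> R" "(a, k) \<in> R" "far X (j (h a), k) \<cdot> e (h a) = far X (a, k)"
      using ret[OF a] by blast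
    show "\<tau> (j (h a)) \<cdot> e (h a) = \<tau> a"
      using factor[OF k(1) h(1)[OF a]] k(3) cocone_comp[OF \<tau> k(2)] by simp
  qed
  have mediate: "m \<cdot> \<iota> t = (m \<cdot> \<iota> (h (j t))) \<cdot> e t" if "m \<in> Hom C c d" "t \<in> Field R'" for m d t
    using det[OF co that(2)] comp_assoc[OF _ cocone_Hom[OF co h(1)[OF j[OF that(2)]]] that(1)]
      e[OF that(2)] ob[OF j[OF that(2)]] by simp
  show ?thesis
  proof
    assume L: "colim R X c (\<lambda>a. \<iota> (h a))"
    show "colim R' X' c \<iota>"
      unfolding is_colimit_ordinal_cat
    proof (intro conjI allI impI co)
      fix d \<tau> assume \<tau>: "cocone R' X' d \<tau>"
      have "(\<forall>a\<in>Field R. m \<cdot> \<iota> (h a) = \<tau> (h a)) \<longleftrightarrow> (\<forall>t\<in>Field R'. m \<cdot> \<iota> t = \<tau> t)"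
        if "m \<in> Hom C c d" for m
        using mediate[OF that] det[OF \<tau>] h(1) j by metis
      then show "\<exists>!m. m \<in> Hom C c d \<and> (\<forall>t\<in>Field R'. m \<cdot> \<iota> t = \<tau> t)"
        using colimit_ex1[OF L restr[OF \<tau>]] by (metis (no_types, lifting))
    qed
  next
    assume L: "colim R' X' c \<iota>"
    show "colim R X c (\<lambda>a. \<iota> (h a))"
      unfolding is_colimit_ordinal_cat
    proof (intro conjI allI impI restr co)
      fix d \<tau> assume \<tau>: "cocone R X d \<tau>"
      have "(\<forall>a\<in>Field R. m \<cdot> \<iota> (h a) = \<tau> a) \<longleftrightarrow> (\<forall>t\<in>Field R'. m \<cdot> \<iota> t = \<tau> (j t) \<cdot> e t)"
        if "m \<in> Hom C c d" for m
        using mediate[OF that] ext_h[OF \<tau>] h(1) j by metis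
      then show "\<exists>!m. m \<in> Hom C c d \<and> (\<forall>a\<in>Field R. m \<cdot> \<iota> (h a) = \<tau> a)"
        using colimit_ex1[OF L ext[OF \<tau>]] by (metis (no_types, lifting))
    qed
  qed
qed

end

section \<open>Smallness and small colimits\<close>

lemma universe_infinite: "universe U \<Longrightarrow> \<not> finite (Field U)"
  unfolding universe_def
  by (meson card_of_Field_ordIso finite_iff_ordLess_natLeq not_ordLess_ordIso ordIso_ordLess_trans
      ordLess_transitive)

lemma small_image_le: "small U A \<Longrightarrow> |B| \<le>o |A| \<Longrightarrow> small U B"
  unfolding small_def by (rule ordLeq_ordLess_trans)

lemma small_subset: "small U A \<Longrightarrow> B \<subseteq> A \<Longrightarrow> small U B"
  by (rule small_image_le) (auto intro: card_of_mono1)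

lemma small_image: "small U A \<Longrightarrow> small U (f ` A)"
  by (rule small_image_le) (auto intro: card_of_image)

lemma small_Sigma:
  assumes "universe U" "small U A" "\<And>a. a \<in> A \<Longrightarrow> small U (B a)"
  shows "small U (Sigma A B)"
  using assms regularCard_stable[of U] universe_infinite[of U] stable_elim[of U A B]
  unfolding universe_def small_def by blast

lemma small_Plus: "universe U \<Longrightarrow> small U A \<Longrightarrow> small U B \<Longrightarrow> small U (A <+> B)"
  unfolding small_def
  by (meson card_of_Plus_ordLess_infinite_Field universe_def universe_infinite)

lemma small_countable:
  assumes "universe U"
  shows "small U (UNIV :: nat set)"
  using assms card_of_nat unfolding universe_def small_def by (meson ordIso_ordLess_trans)

lemma small_finite:
  assumes "universe U" "finite A"
  shows "small U A"
  using assms unfolding universe_def small_def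
  by (meson finite_iff_ordLess_natLeq ordLess_transitive)

lemma small_insert:
  assumes U: "universe U" and A: "small U A"
  shows "small U (insert a A)"
proof -
  have "insert a A = (\<lambda>x. case x of Inl y \<Rightarrow> y | Inr _ \<Rightarrow> a) ` (A <+> {()})"
    by (force simp: image_iff Plus_def)
  then show ?thesis
    using small_image[OF small_Plus[OF U A small_finite[OF U]], of "{()}"] by (metis finite.intros)
qed

lemma small_embed:
  fixes U :: "'u rel"
  assumes "universe U" "small U A"
  obtains e :: "'a \<Rightarrow> 'u" where "inj_on e A"
proof -
  have "|A| \<le>o |Field U|"
    using assms unfolding universe_def small_def
    by (meson card_of_Field_ordIso ordIso_symmetric ordLess_imp_ordLeq ordLeq_ordIso_trans)
  then show thesis using that by (metis card_of_ordLeq)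
qed

text \<open>
  Cocompleteness speaks of index categories on \<open>'u\<close> only; a small index category of any other type
  is transported there along injections.
\<close>
lemma small_category_colimit:
  fixes U :: "'b rel" and J :: "('a, 'c) category"
  assumes U: "universe U" and sc: "has_small_colimits U C"
    and J: "category J" "small U (Obj J)" "small U (Arr J)" and X: "is_functor J C X"
  shows "\<exists>c \<iota>. is_colimit J C X c \<iota>"
proof -
  obtain e :: "'a \<Rightarrow> 'b" where e: "inj_on e (Obj J)" by (rule small_embed[OF U J(2)])
  obtain p :: "'c \<Rightarrow> 'b" where p: "inj_on p (Arr J)" by (rule small_embed[OF U J(3)])
  define e' p' where "e' = inv_into (Obj J) e" and "p' = inv_into (Arr J) p"
  have e' [simp]: "e' (e a) = a" if "a \<in> Obj J" for a
    using that e by (simp add: e'_def)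
  have p' [simp]: "p' (p f) = f" if "f \<in> Arr J" for f
    using that p by (simp add: p'_def)
  define J' where "J' = \<lparr>Obj = e ` Obj J, Arr = p ` Arr J, Dom = (\<lambda>k. e (Dom J (p' k))),
    Cod = (\<lambda>k. e (Cod J (p' k))), Ident = (\<lambda>a. p (Ident J (e' a))),
    Comp = (\<lambda>g f. p (Comp J (p' g) (p' f)))\<rparr>"
  define X' where "X' = \<lparr>fob = (\<lambda>a. fob X (e' a)), far = (\<lambda>f. far X (p' f))\<rparr>"
  have dc: "Dom J f \<in> Obj J" "Cod J f \<in> Obj J" if "f \<in> Arr J" for f
    using that J(1) by (auto simp: category_def)
  have ee: "e a = e b \<longleftrightarrow> a = b" if "a \<in> Obj J" "b \<in> Obj J" for a b
    using that e by (auto simp: inj_on_def)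
  have "category J'"
    using J(1) by (simp add: category_def J'_def ee dc)
  moreover have "is_functor J' C X'"
    using X J(1) by (simp add: is_functor_def J'_def X'_def dc ee category_def)
  moreover have "small U (Obj J')" "small U (Arr J')"
    using J by (simp_all add: J'_def small_image)
  ultimately obtain c \<iota> where c: "is_colimit J' C X' c \<iota>"
    using sc unfolding has_small_colimits_def by blast
  have co: "is_cocone J' C X' d \<tau> = is_cocone J C X d (\<lambda>a. \<tau> (e a))" for d \<tau>
    by (simp add: is_cocone_def J'_def X'_def dc)
  have co': "is_cocone J C X d \<tau> = is_cocone J' C X' d (\<lambda>a. \<tau> (e' a))" for d \<tau>
    by (simp add: is_cocone_def J'_def X'_def dc)
  have "is_colimit J C X c (\<lambda>a. \<iota> (e a))"
    unfolding is_colimit_def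
  proof (intro conjI allI impI)
    show "is_cocone J C X c (\<lambda>a. \<iota> (e a))" using c co by (simp add: is_colimit_def)
    fix d \<tau> assume "is_cocone J C X d \<tau>"
    then have "\<exists>!h. h \<in> Hom C c d \<and> (\<forall>a\<in>Obj J'. Comp C h (\<iota> a) = \<tau> (e' a))"
      using c co' by (simp add: is_colimit_def)
    then show "\<exists>!h. h \<in> Hom C c d \<and> (\<forall>a\<in>Obj J. Comp C h (\<iota> (e a)) = \<tau> a)"
      by (simp add: J'_def)
  qed
  then show ?thesis by blast
qed

locale small_cocomplete = cat C for C :: "('o, 'm) category" +
  fixes U :: "'u rel"
  assumes universe: "universe U" and colimits: "has_small_colimits U C"
begin

lemma small_preorder_colimit:
  assumes R: "Preorder R" "small U (Field R)" and X: "diagram R X"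
  obtains c \<iota> where "colim R X c \<iota>"
proof -
  have "category (ordinal_cat R)"
    using R by (auto simp: category_def ordinal_cat_def order_on_defs refl_on_def Field_def dest: transD)
  moreover have "R \<subseteq> Field R \<times> Field R" by (auto simp: Field_def)
  then have "small U R"
    by (rule small_subset[OF small_Sigma[OF universe R(2) R(2)]])
  ultimately have "\<exists>c \<iota>. colim R X c \<iota>"
    using R(2) X by (intro small_category_colimit[OF universe colimits]) (simp_all add: ordinal_cat_def)
  then show thesis using that by blast
qed

end

context cat
begin

section \<open>Attaching a family of maps\<close>

text \<open>
  \<open>j\<close> attaches the codomains of all \<open>i s\<close> along \<open>u s\<close> at once: it is the pushout of the coproduct of
  the \<open>i s\<close>, stated by its universal property so that no coproducts have to be chosen.
\<close>

definition attachment :: "'s set \<Rightarrow> ('s \<Rightarrow> 'm) \<Rightarrow> ('s \<Rightarrow> 'm) \<Rightarrow> 'm \<Rightarrow> ('s \<Rightarrow> 'm) \<Rightarrow> bool" where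
  "attachment A i u j v \<longleftrightarrow> j \<in> Arr C \<and>
    (\<forall>s\<in>A. i s \<in> Arr C \<and> u s \<in> Hom C (Dom C (i s)) (Dom C j) \<and>
       v s \<in> Hom C (Cod C (i s)) (Cod C j) \<and> j \<cdot> u s = v s \<cdot> i s) \<and>
    (\<forall>x\<in>Arr C. Dom C x = Dom C j \<longrightarrow>
      (\<forall>y. (\<forall>s\<in>A. y s \<in> Hom C (Cod C (i s)) (Cod C x) \<and> x \<cdot> u s = y s \<cdot> i s) \<longrightarrow>
        (\<exists>!h. h \<in> Hom C (Cod C j) (Cod C x) \<and> h \<cdot> j = x \<and> (\<forall>s\<in>A. h \<cdot> v s = y s))))"

lemma attachmentD:
  assumes "attachment A i u j v"
  shows attachment_Arr: "j \<in> Arr C"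
    and "s \<in> A \<Longrightarrow> i s \<in> Arr C"
    and "s \<in> A \<Longrightarrow> u s \<in> Hom C (Dom C (i s)) (Dom C j)"
    and "s \<in> A \<Longrightarrow> v s \<in> Hom C (Cod C (i s)) (Cod C j)"
    and "s \<in> A \<Longrightarrow> j \<cdot> u s = v s \<cdot> i s"
  using assms unfolding attachment_def by blast+

lemma attachment_ex1:
  assumes "attachment A i u j v" "x \<in> Hom C (Dom C j) T"
    and "\<And>s. s \<in> A \<Longrightarrow> y s \<in> Hom C (Cod C (i s)) T" "\<And>s. s \<in> A \<Longrightarrow> x \<cdot> u s = y s \<cdot> i s"
  shows "\<exists>!h. h \<in> Hom C (Cod C j) T \<and> h \<cdot> j = x \<and> (\<forall>s\<in>A. h \<cdot> v s = y s)"
proof -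
  have "x \<in> Arr C" "Dom C x = Dom C j" "Cod C x = T" using assms(2) by (auto dest: HomD)
  then show ?thesis using assms unfolding attachment_def by blast
qed

lemma attachment_ext:
  assumes at: "attachment A i u j v" and h: "h \<in> Hom C (Cod C j) T" "h' \<in> Hom C (Cod C j) T"
    and eq: "h \<cdot> j = h' \<cdot> j" "\<And>s. s \<in> A \<Longrightarrow> h \<cdot> v s = h' \<cdot> v s"
  shows "h = h'"
proof -
  note j = HomI[OF attachment_Arr[OF at]]
  have "\<exists>!k. k \<in> Hom C (Cod C j) T \<and> k \<cdot> j = h \<cdot> j \<and> (\<forall>s\<in>A. k \<cdot> v s = h \<cdot> v s)"
  proof (rule attachment_ex1[OF at])
    show "h \<cdot> j \<in> Hom C (Dom C j) T" using h j by blast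
    fix s assume s: "s \<in> A"
    show "h \<cdot> v s \<in> Hom C (Cod C (i s)) T" using h attachmentD(4)[OF at s] by blast
    show "(h \<cdot> j) \<cdot> u s = (h \<cdot> v s) \<cdot> i s"
      using attachmentD(2-5)[OF at s] h(1) j by (simp add: Hom_def arr_simps)
  qed
  then show ?thesis using h eq by metis
qed

end

context small_cocomplete
begin

text \<open>
  An attachment is the colimit of one star-shaped preorder: \<open>None\<close> is the centre, carrying \<open>E\<close>, and
  for each \<open>s\<close> the span \<open>E \<leftarrow> dom (i s) \<rightarrow> cod (i s)\<close> has its other two objects at \<open>Inl s\<close> and
  \<open>Inr s\<close>.
\<close>
lemma attachment_exists:
  fixes A :: "'s set"
  assumes A: "small U A" and E: "E \<in> Obj C"
    and i: "\<And>s. s \<in> A \<Longrightarrow> i s \<in> Arr C" and u: "\<And>s. s \<in> A \<Longrightarrow> u s \<in> Hom C (Dom C (i s)) E"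
  obtains j v where "attachment A i u j v" "Dom C j = E"
proof -
  define P :: "('s + 's) option set" where "P = insert None (Some ` (A <+> A))"
  define R where "R = Id_on P \<union> (\<lambda>s. (Some (Inl s), None)) ` A \<union>
    (\<lambda>s. (Some (Inl s), Some (Inr s))) ` A"
  define X :: "(('s + 's) option, ('s + 's) option \<times> ('s + 's) option, 'o, 'm) funct" where "X = \<lparr>
    fob = (\<lambda>a. case a of None \<Rightarrow> E | Some (Inl s) \<Rightarrow> Dom C (i s) | Some (Inr s) \<Rightarrow> Cod C (i s)),
    far = (\<lambda>(a, b). case (a, b) of
       (Some (Inl s), None) \<Rightarrow> u s | (Some (Inl s), Some (Inr _)) \<Rightarrow> i s
     | (None, _) \<Rightarrow> Ident C E
     | (Some (Inl s), _) \<Rightarrow> Ident C (Dom C (i s)) | (Some (Inr s), _) \<Rightarrow> Ident C (Cod C (i s)))\<rparr>"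
  have i': "Dom C (i s) \<in> Obj C" "Cod C (i s) \<in> Obj C" "i s \<in> Hom C (Dom C (i s)) (Cod C (i s))"
    if "s \<in> A" for s
    using HomD[OF HomI[OF i[OF that]]] HomI[OF i[OF that]] by auto
  have fld: "Field R = P"
    by (auto simp: R_def P_def Field_def)
  have ballP: "(\<forall>a\<in>P. Q a) \<longleftrightarrow> Q None \<and> (\<forall>s\<in>A. Q (Some (Inl s)) \<and> Q (Some (Inr s)))" for Q
    unfolding P_def by auto
  have allR: "(\<forall>a b. (a, b) \<in> R \<longrightarrow> Q a b) \<longleftrightarrow> (\<forall>a\<in>P. Q a a) \<and>
      (\<forall>s\<in>A. Q (Some (Inl s)) None \<and> Q (Some (Inl s)) (Some (Inr s)))" for Q
    unfolding R_def by auto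
  have "Preorder R"
    unfolding preorder_on_def fld by (auto simp: refl_on_def R_def P_def intro!: transI)
  moreover have "small U (Field R)"
    unfolding fld P_def using universe A by (intro small_insert small_image small_Plus)
  moreover have "diagram R X"
    unfolding is_functor_ordinal_cat fld
  proof (intro conjI ballI allI impI)
    fix a assume "a \<in> P"
    then show "fob X a \<in> Obj C" "far X (a, a) = Ident C (fob X a)"
      using E i' by (auto simp: X_def P_def)
  next
    fix a b assume "(a, b) \<in> R"
    then show "far X (a, b) \<in> Hom C (fob X a) (fob X b)"
      using E i' u by (auto simp: X_def R_def P_def Ident_in_Hom)
  next
    fix a b c assume "(a, b) \<in> R" "(b, c) \<in> R"
    then show "far X (a, c) = far X (b, c) \<cdot> far X (a, b)"
      using E i' u by (auto simp: X_def R_def P_def Hom_def Ident_simps)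
  qed
  ultimately obtain c \<iota> where c: "colim R X c \<iota>"
    by (rule small_preorder_colimit)
  have cocone: "cocone R X d \<tau> \<longleftrightarrow> d \<in> Obj C \<and> \<tau> None \<in> Hom C E d \<and>
    (\<forall>s\<in>A. \<tau> (Some (Inl s)) \<in> Hom C (Dom C (i s)) d \<and> \<tau> (Some (Inr s)) \<in> Hom C (Cod C (i s)) d \<and>
      \<tau> None \<cdot> u s = \<tau> (Some (Inl s)) \<and> \<tau> (Some (Inr s)) \<cdot> i s = \<tau> (Some (Inl s)))" for d \<tau>
    unfolding is_cocone_ordinal_cat fld ballP allR by (auto simp: X_def Hom_def Ident_simps)
  have \<iota>: "cocone R X c \<iota>" by (rule colimit_cocone[OF c])
  have cd: "Dom C (\<iota> None) = E" "Cod C (\<iota> None) = c"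
    using \<iota> unfolding cocone by (auto dest: HomD)
  have "attachment A i u (\<iota> None) (\<lambda>s. \<iota> (Some (Inr s)))"
    unfolding attachment_def cd
  proof (intro conjI ballI allI impI)
    show "\<iota> None \<in> Arr C" using \<iota> unfolding cocone by (auto dest: HomD)
  next
    fix s assume "s \<in> A"
    then show "i s \<in> Arr C" "u s \<in> Hom C (Dom C (i s)) E" "\<iota> (Some (Inr s)) \<in> Hom C (Cod C (i s)) c"
      "\<iota> None \<cdot> u s = \<iota> (Some (Inr s)) \<cdot> i s"
      using i u \<iota> unfolding cocone by auto
  next
    fix x y
    assume x: "x \<in> Arr C" "Dom C x = E"
      and y: "\<forall>s\<in>A. y s \<in> Hom C (Cod C (i s)) (Cod C x) \<and> x \<cdot> u s = y s \<cdot> i s"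
    define \<tau> where "\<tau> a = (case a of None \<Rightarrow> x | Some (Inl s) \<Rightarrow> x \<cdot> u s | Some (Inr s) \<Rightarrow> y s)" for a
    have x': "x \<in> Hom C E (Cod C x)" using x by (simp add: Hom_def)
    have "cocone R X (Cod C x) \<tau>"
      unfolding cocone using x' y i'(3) HomD(5)[OF x'] by (auto simp: \<tau>_def)
    then have ex: "\<exists>!h. h \<in> Hom C c (Cod C x) \<and> (\<forall>a\<in>P. h \<cdot> \<iota> a = \<tau> a)"
      using colimit_ex1[OF c] unfolding fld by blast
    have "(\<forall>a\<in>P. h \<cdot> \<iota> a = \<tau> a) \<longleftrightarrow> h \<cdot> \<iota> None = x \<and> (\<forall>s\<in>A. h \<cdot> \<iota> (Some (Inr s)) = y s)"
      if h: "h \<in> Hom C c (Cod C x)" for h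
    proof -
      have "h \<cdot> \<iota> (Some (Inl s)) = (h \<cdot> \<iota> None) \<cdot> u s" if "s \<in> A" for s
        using that \<iota> u[OF that] comp_assoc[OF _ _ h] unfolding cocone by metis
      then show ?thesis unfolding ballP by (auto simp: \<tau>_def)
    qed
    then have eq: "h \<in> Hom C c (Cod C x) \<and> (\<forall>a\<in>P. h \<cdot> \<iota> a = \<tau> a) \<longleftrightarrow>
        h \<in> Hom C c (Cod C x) \<and> h \<cdot> \<iota> None = x \<and> (\<forall>s\<in>A. h \<cdot> \<iota> (Some (Inr s)) = y s)" for h
      by auto
    show "\<exists>!h. h \<in> Hom C c (Cod C x) \<and> h \<cdot> \<iota> None = x \<and> (\<forall>s\<in>A. h \<cdot> \<iota> (Some (Inr s)) = y s)"
      using ex unfolding eq .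
  qed
  then show thesis using that cd by blast
qed

end

section \<open>Successors and limits in well-orders\<close>

lemma Field_left: "(a, b) \<in> r \<Longrightarrow> a \<in> Field r" and Field_right: "(a, b) \<in> r \<Longrightarrow> b \<in> Field r"
  by (auto simp: Field_def)

lemma
  assumes "Well_order r"
  shows wo_refl: "a \<in> Field r \<Longrightarrow> (a, a) \<in> r"
    and wo_trans: "(a, b) \<in> r \<Longrightarrow> (b, c) \<in> r \<Longrightarrow> (a, c) \<in> r"
    and wo_antisym: "(a, b) \<in> r \<Longrightarrow> (b, a) \<in> r \<Longrightarrow> a = b"
    and wo_total: "a \<in> Field r \<Longrightarrow> b \<in> Field r \<Longrightarrow> (a, b) \<in> r \<or> (b, a) \<in> r"
  using assms unfolding order_on_defs refl_on_def antisym_def total_on_def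
  by (auto elim: transE) metis

lemma wo_least:
  assumes "Well_order r" "Q \<subseteq> Field r" "Q \<noteq> {}"
  obtains m where "m \<in> Q" "\<And>q. q \<in> Q \<Longrightarrow> (m, q) \<in> r"
proof -
  interpret wo_rel r by unfold_locales (rule assms(1))
  show thesis using that minim_in minim_least assms by blast
qed

lemma wo_minim:
  assumes "Well_order r" "Field r \<noteq> {}"
  shows "wo_rel.minim r (Field r) \<in> Field r"
    and "a \<in> Field r \<Longrightarrow> (wo_rel.minim r (Field r), a) \<in> r"
proof -
  interpret wo_rel r by unfold_locales (rule assms(1))
  show "minim (Field r) \<in> Field r" "a \<in> Field r \<Longrightarrow> (minim (Field r), a) \<in> r"
    using minim_in minim_least assms by blast+
qed

lemma Field_Restr:
  assumes "Refl r" "T \<subseteq> Field r"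
  shows "Field (Restr r T) = T"
  using assms by (auto simp: Field_def refl_on_def)

text \<open>
  Relational forms of successor and limit element, which unlike \<^const>\<open>wo_rel.suc\<close> and
  \<^const>\<open>limit_ordinal\<close> of a restriction can be checked directly in a lexicographic sum.
\<close>
definition succ_in :: "'a rel \<Rightarrow> 'a \<Rightarrow> 'a \<Rightarrow> bool" where
  "succ_in r a b \<longleftrightarrow> (a, b) \<in> r \<and> a \<noteq> b \<and> (\<forall>c. (a, c) \<in> r \<longrightarrow> c = a \<or> (b, c) \<in> r)"

definition limit_in :: "'a rel \<Rightarrow> 'a \<Rightarrow> bool" where
  "limit_in r g \<longleftrightarrow> g \<in> Field r \<and> underS r g \<noteq> {} \<and>
    (\<forall>a\<in>underS r g. \<exists>b\<in>underS r g. (a, b) \<in> r \<and> a \<noteq> b)"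

lemma succ_ex:
  assumes r: "Well_order r" and ab: "(a, b) \<in> r" "a \<noteq> b"
  obtains s where "succ_in r a s" "(s, b) \<in> r"
proof -
  have "{c. (a, c) \<in> r \<and> a \<noteq> c} \<subseteq> Field r" "{c. (a, c) \<in> r \<and> a \<noteq> c} \<noteq> {}"
    using ab by (auto simp: Field_def)
  from wo_least[OF r this] obtain s where "s \<in> {c. (a, c) \<in> r \<and> a \<noteq> c}"
    "\<And>q. q \<in> {c. (a, c) \<in> r \<and> a \<noteq> c} \<Longrightarrow> (s, q) \<in> r" by blast
  then show thesis using that[of s] ab by (auto simp: succ_in_def)
qed

lemma succ_in_suc:
  assumes r: "Well_order r" and a: "a \<in> Field r"
  shows "aboveS r a \<noteq> {} \<longleftrightarrow> (\<exists>b. succ_in r a b)"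
    and "succ_in r a b \<Longrightarrow> wo_rel.suc r {a} = b"
proof -
  show "aboveS r a \<noteq> {} \<longleftrightarrow> (\<exists>b. succ_in r a b)"
  proof
    assume "aboveS r a \<noteq> {}"
    then obtain b where "(a, b) \<in> r" "a \<noteq> b" by (auto simp: aboveS_def)
    then show "\<exists>b. succ_in r a b" using succ_ex[OF r] by metis
  qed (auto simp: aboveS_def succ_in_def)
  assume s: "succ_in r a b"
  have wr: "wo_rel r" using r by (simp add: wo_rel_def)
  have "b = wo_rel.suc r {a}"
    using s a by (intro wo_rel.equals_suc_AboveS[OF wr]) (auto simp: succ_in_def AboveS_def Field_def)
  then show "wo_rel.suc r {a} = b" by simp
qed

lemma succ_between:
  assumes r: "Well_order r" and s: "succ_in r a b" and c: "(c, b) \<in> r" "c \<noteq> b"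
  shows "(c, a) \<in> r"
proof -
  have "(a, c) \<notin> r \<or> c = a"
    using s c wo_antisym[OF r c(1)] by (auto simp: succ_in_def)
  then show ?thesis
    using s c wo_total[OF r Field_left[OF c(1)], of a] wo_refl[OF r Field_left[OF c(1)]]
    by (auto simp: succ_in_def dest: Field_left)
qed

lemma wo_cases:
  assumes r: "Well_order r" and g: "g \<in> Field r"
  obtains (least) "\<And>a. a \<in> Field r \<Longrightarrow> (g, a) \<in> r" | (succ) a where "succ_in r a g" | (limit) "limit_in r g"
proof (cases "limit_in r g")
  case False
  then consider "underS r g = {}" |
      a where "a \<in> underS r g" "\<And>b. b \<in> underS r g \<Longrightarrow> (a, b) \<in> r \<Longrightarrow> a = b"
    using g by (auto simp: limit_in_def)
  then show thesis
  proof cases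
    case 1
    show thesis
    proof (rule least)
      fix a assume "a \<in> Field r"
      then show "(g, a) \<in> r" using 1 wo_total[OF r g, of a] by (auto simp: underS_def)
    qed
  next
    case 2
    then have ag: "(a, g) \<in> r" "a \<noteq> g" by (auto simp: underS_def)
    obtain s where s: "succ_in r a s" "(s, g) \<in> r" by (rule succ_ex[OF r ag])
    then have "s = g" using 2(2)[of s] by (auto simp: succ_in_def underS_def)
    then show thesis using s succ by blast
  qed
qed (use limit in blast)

lemma limit_in_not_succ:
  assumes r: "Well_order r" and g: "limit_in r g"
  shows "\<not> succ_in r a g"
proof
  assume s: "succ_in r a g"
  then have "a \<in> underS r g" by (auto simp: succ_in_def underS_def)
  then obtain b where "b \<in> underS r g" "(a, b) \<in> r" "a \<noteq> b" using g by (auto simp: limit_in_def)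
  then show False using s wo_antisym[OF r] by (auto simp: succ_in_def underS_def)
qed

lemma limit_ordinal_Restr_underS:
  assumes r: "Well_order r" and g: "g \<in> Field r"
  shows "limit_ordinal (Restr r (underS r g)) \<longleftrightarrow> limit_in r g"
proof -
  have "Refl r" using r by (simp add: order_on_defs)
  then have "Field (Restr r (underS r g)) = underS r g"
    by (rule Field_Restr) (auto simp: underS_def Field_def)
  then show ?thesis
    using g unfolding limit_ordinal_def limit_in_def aboveS_def by auto
qed

lemma transfinite_sequence_iff:
  assumes "Well_order r"
  shows "transfinite_sequence C r X \<longleftrightarrow> is_functor (ordinal_cat r) C X \<and>
    (\<forall>g. limit_in r g \<longrightarrow>
      is_colimit (ordinal_cat (Restr r (underS r g))) C X (fob X g) (\<lambda>b. far X (b, g)))"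
proof -
  have "(\<forall>g\<in>Field r. limit_ordinal (Restr r (underS r g)) \<longrightarrow> P g) \<longleftrightarrow> (\<forall>g. limit_in r g \<longrightarrow> P g)" for P
    using limit_ordinal_Restr_underS[OF assms] by (auto simp: limit_in_def)
  then show ?thesis unfolding transfinite_sequence_def by simp
qed

lemma steps_in_iff:
  assumes "Well_order r"
  shows "steps_in D r X \<longleftrightarrow> (\<forall>a b. succ_in r a b \<longrightarrow> far X (a, b) \<in> D)"
proof -
  have "a \<in> Field r" if "succ_in r a b" for a b
    using that by (auto simp: succ_in_def Field_def)
  then show ?thesis
    using succ_in_suc[OF assms] unfolding steps_in_def by (metis (no_types, opaque_lifting))
qed

lemma well_order_copy:
  fixes U :: "'u rel"
  assumes U: "universe U" and W: "Well_order W" "small U (Field W)"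
  obtains p :: "'u rel" and g where "small_ordinal U p" "bij_betw g (Field p) (Field W)"
    "\<And>a b. a \<in> Field p \<Longrightarrow> b \<in> Field p \<Longrightarrow> (a, b) \<in> p \<longleftrightarrow> (g a, g b) \<in> W"
proof -
  obtain e :: "_ \<Rightarrow> 'u" where e: "inj_on e (Field W)" by (rule small_embed[OF U W(2)])
  define p where "p = dir_image W e"
  have F: "Field p = e ` Field W" unfolding p_def by (rule dir_image_Field)
  have p: "Well_order p" unfolding p_def by (rule Well_order_dir_image[OF W(1) e])
  have mem: "(e a, e b) \<in> p \<longleftrightarrow> (a, b) \<in> W" if "a \<in> Field W" "b \<in> Field W" for a b
  proof
    assume "(e a, e b) \<in> p"
    then obtain a' b' where ab: "(a', b') \<in> W" "e a = e a'" "e b = e b'"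
      by (auto simp: p_def dir_image_def)
    then have "a = a'" "b = b'"
      using that inj_onD[OF e] by (blast dest: Field_left Field_right)+
    then show "(a, b) \<in> W" using ab by simp
  qed (auto simp: p_def dir_image_def)
  show thesis
  proof (rule that)
    show "small_ordinal U p" using p W(2) by (simp add: small_ordinal_def F small_image)
    show "bij_betw (inv_into (Field W) e) (Field p) (Field W)"
      unfolding F by (rule bij_betw_inv_into[OF inj_on_imp_bij_betw[OF e]])
    show "(a, b) \<in> p \<longleftrightarrow> (inv_into (Field W) e a, inv_into (Field W) e b) \<in> W"
      if "a \<in> Field p" "b \<in> Field p" for a b
      using that mem e unfolding F by auto
  qed
qed

context cat
begin

section \<open>Isomorphisms in transfinite sequences\<close>

lemma colimit_greatest_iso:
  assumes co: "colim R X c \<iota>" and X: "diagram R X"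
    and m: "m \<in> Field R" "\<And>a. a \<in> Field R \<Longrightarrow> (a, m) \<in> R"
  shows "\<iota> m \<in> isos"
proof -
  note \<iota> = colimit_cocone[OF co]
  have "cocone R X (fob X m) (\<lambda>a. far X (a, m))"
    unfolding is_cocone_ordinal_cat
    using functorD[OF X] m Field_right[of _ _ R] by simp
  from colimit_ex1[OF co this] obtain h where
    h: "h \<in> Hom C c (fob X m)" "\<And>a. a \<in> Field R \<Longrightarrow> h \<cdot> \<iota> a = far X (a, m)" by blast
  show ?thesis
  proof (rule isosI)
    show \<iota>m: "\<iota> m \<in> Hom C (fob X m) c" using cocone_Hom[OF \<iota> m(1)] .
    show "h \<in> Hom C c (fob X m)" by (rule h)
    show "h \<cdot> \<iota> m = Ident C (fob X m)" using h(2)[OF m(1)] functor_Ident[OF X m(1)] by simp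
    show "\<iota> m \<cdot> h = Ident C c"
    proof (rule colimit_ext[OF co X])
      show "\<iota> m \<cdot> h \<in> Hom C c c" using \<iota>m h by blast
      show "Ident C c \<in> Hom C c c" using cocone_Obj[OF \<iota>] by blast
      fix a assume a: "a \<in> Field R"
      have "(\<iota> m \<cdot> h) \<cdot> \<iota> a = \<iota> m \<cdot> far X (a, m)"
        using comp_assoc[OF cocone_Hom[OF \<iota> a] h(1) \<iota>m] h(2)[OF a] by simp
      then show "(\<iota> m \<cdot> h) \<cdot> \<iota> a = Ident C c \<cdot> \<iota> a"
        using cocone_comp[OF \<iota> m(2)[OF a]] Ident_comp[OF cocone_Hom[OF \<iota> a]] by simp
    qed
  qed
qed

text \<open>
  This lets an invertible step be merged with the pushout that follows it.
\<close>
lemma pushout_comp_iso: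
  assumes f: "f \<in> pushouts C I" and w: "w \<in> isos" "w \<in> Hom C a (Dom C f)"
  shows "f \<cdot> w \<in> pushouts C I"
proof -
  obtain i u v where i: "i \<in> I" and p: "is_pushout C i u f v"
    using f by (auto simp: pushouts_def)
  obtain w' where w': "w' \<in> Hom C (Dom C f) a" "w' \<cdot> w = Ident C a" "w \<cdot> w' = Ident C (Dom C f)"
    by (rule isosE[OF w])
  have sq: "i \<in> Arr C" "f \<in> Arr C" "u \<in> Hom C (Dom C i) (Dom C f)" "v \<in> Hom C (Cod C i) (Cod C f)"
      "f \<cdot> u = v \<cdot> i"
    using p by (auto simp: is_pushout_def comm_square_def)
  have f': "f \<in> Hom C (Dom C f) (Cod C f)" using sq by (simp add: Hom_def)
  have ww: "w \<cdot> w' \<cdot> u = u"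
    using comp_reduce[OF w'(3) sq(3) w'(1) w(2)] Ident_comp[OF sq(3)] by simp
  have "is_pushout C i (w' \<cdot> u) (f \<cdot> w) v"
    unfolding is_pushout_def
  proof (intro conjI ballI impI)
    show "comm_square C (Square i (f \<cdot> w) (w' \<cdot> u) v)"
      using sq w w' f' ww by (simp add: comm_square_def Hom_def arr_simps)
    fix x y assume x: "x \<in> Arr C" and y: "y \<in> Arr C"
      and xy: "Dom C x = Cod C (w' \<cdot> u) \<and> Dom C y = Cod C i \<and> Cod C x = Cod C y \<and> x \<cdot> w' \<cdot> u = y \<cdot> i"
    have x': "x \<in> Hom C a (Cod C x)"
      using x xy sq w' by (simp add: Hom_def arr_simps)
    have "\<exists>!h. h \<in> Hom C (Cod C f) (Cod C (x \<cdot> w')) \<and> h \<cdot> f = x \<cdot> w' \<and> h \<cdot> v = y"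
      using p x y xy x' w' sq unfolding is_pushout_def
      by (simp add: Hom_def arr_simps)
    moreover have "h \<cdot> f = x \<cdot> w' \<longleftrightarrow> h \<cdot> f \<cdot> w = x" if "h \<in> Hom C (Cod C f) (Cod C x)" for h
    proof
      assume "h \<cdot> f = x \<cdot> w'"
      then have "h \<cdot> f \<cdot> w = (x \<cdot> w') \<cdot> w" using comp_assoc[OF w(2) f' that] by simp
      also have "\<dots> = x" using comp_assoc[OF w(2) w'(1) x'] w'(2) comp_Ident[OF x'] by simp
      finally show "h \<cdot> f \<cdot> w = x" .
    next
      assume "h \<cdot> f \<cdot> w = x"
      then have "x \<cdot> w' = h \<cdot> f \<cdot> w \<cdot> w'"
        using that f' w w' by (auto simp add: Hom_def arr_simps)
      then show "h \<cdot> f = x \<cdot> w'" using w'(3) comp_Ident[OF f'] by simp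
    qed
    then have "h \<in> Hom C (Cod C f) (Cod C x) \<and> h \<cdot> f = x \<cdot> w' \<and> h \<cdot> v = y \<longleftrightarrow>
        h \<in> Hom C (Cod C f) (Cod C x) \<and> h \<cdot> f \<cdot> w = x \<and> h \<cdot> v = y" for h by blast
    moreover have "Cod C (x \<cdot> w') = Cod C x" "Cod C (f \<cdot> w) = Cod C f"
      using x' w' w f' by (simp_all add: Hom_def arr_simps)
    ultimately show "\<exists>!h. h \<in> Hom C (Cod C (f \<cdot> w)) (Cod C x) \<and> h \<cdot> f \<cdot> w = x \<and> h \<cdot> v = y"
      by simp
  qed
  then show ?thesis using i by (auto simp: pushouts_def)
qed

lemma functor_subset:
  assumes X: "diagram W X" and R: "R \<subseteq> W"
  shows "diagram R X"
proof -
  have "a \<in> Field W" if "a \<in> Field R" for a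
    using that mono_Field[OF R] by (rule rev_subsetD)
  moreover have "(a, b) \<in> W" if "(a, b) \<in> R" for a b
    using that R by (rule rev_subsetD)
  ultimately show ?thesis using functorD[OF X] by (simp add: is_functor_ordinal_cat)
qed

text \<open>
  \<open>iso_run W X a b\<close> asks that the individual steps from \<open>a\<close> to \<open>b\<close> be isomorphisms. Merely asking that
  \<open>X a \<rightarrow> X b\<close> be one would not do: the intermediate maps could still fail to be invertible.
\<close>
definition iso_run :: "'w rel \<Rightarrow> ('w, 'w \<times> 'w, 'o, 'm) funct \<Rightarrow> 'w \<Rightarrow> 'w \<Rightarrow> bool" where
  "iso_run W X a b \<longleftrightarrow> (a, b) \<in> W \<and>
    (\<forall>d e. succ_in W d e \<longrightarrow> (a, d) \<in> W \<longrightarrow> (e, b) \<in> W \<longrightarrow> far X (d, e) \<in> isos)"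

lemma iso_run_trans:
  assumes W: "Well_order W" and ab: "iso_run W X a b" and bc: "iso_run W X b c"
  shows "iso_run W X a c"
  unfolding iso_run_def
proof (intro conjI allI impI)
  show "(a, c) \<in> W" using ab bc wo_trans[OF W] by (auto simp: iso_run_def)
  fix d e assume de: "succ_in W d e" "(a, d) \<in> W" "(e, c) \<in> W"
  have b: "b \<in> Field W" using ab by (auto simp: iso_run_def Field_def)
  have d: "d \<in> Field W" using de by (auto simp: Field_def)
  show "far X (d, e) \<in> isos"
  proof (cases "(b, d) \<in> W")
    case True
    then show ?thesis using bc de by (auto simp: iso_run_def)
  next
    case False
    then have "(d, b) \<in> W" "d \<noteq> b" using wo_total[OF W d b] wo_refl[OF W b] by auto
    then have "(e, b) \<in> W" using de(1) by (auto simp: succ_in_def)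
    then show ?thesis using ab de by (auto simp: iso_run_def)
  qed
qed

lemma iso_run_sub:
  assumes W: "Well_order W" and ad: "iso_run W X a d" and "(a, b) \<in> W" "(b, c) \<in> W" "(c, d) \<in> W"
  shows "iso_run W X b c"
  using assms(2-) wo_trans[OF W] unfolding iso_run_def by meson

text \<open>
  At a limit stage \<open>b\<close> the diagram below \<open>b\<close> is, up to isomorphism, constant from \<open>a\<close> onwards, so that
  restricting it to the single index \<open>a\<close> does not change its colimit.
\<close>
lemma iso_run_isos:
  assumes W: "Well_order W" and X: "transfinite_sequence C W X" and ab: "iso_run W X a b"
  shows "far X (a, b) \<in> isos"
proof -
  have X': "diagram W X"
    and lim: "\<And>g. limit_in W g \<Longrightarrow>
      colim (Restr W (underS W g)) X (fob X g) (\<lambda>b. far X (b, g))"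
    using X by (auto simp: transfinite_sequence_iff[OF W])
  have "wf (W - Id)" using W by (simp add: well_order_on_def)
  then show ?thesis using ab
  proof (induction b rule: wf_induct_rule)
    case (less b)
    have ab: "(a, b) \<in> W" using less.prems by (simp add: iso_run_def)
    note F = Field_left[OF ab] Field_right[OF ab]
    show ?case
    proof (cases "a = b")
      case True
      then show ?thesis using functorD[OF X'] F Ident_isos by simp
    next
      case False
      note ab' = this
      have run: "iso_run W X a t" if "(a, t) \<in> W" "(t, b) \<in> W" for t
        using iso_run_sub[OF W less.prems wo_refl[OF W F(1)] that] .
      have IH: "far X (a, t) \<in> isos" if "(a, t) \<in> W" "(t, b) \<in> W" "t \<noteq> b" for t
        using less.IH[of t] that run by auto
      show ?thesis
      proof (rule wo_cases[OF W F(2)])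
        assume "\<And>t. t \<in> Field W \<Longrightarrow> (b, t) \<in> W"
        then show ?thesis using F ab ab' wo_antisym[OF W] by blast
      next
        fix d assume d: "succ_in W d b"
        then have db: "(d, b) \<in> W" "d \<noteq> b" by (auto simp: succ_in_def)
        have ad: "(a, d) \<in> W" by (rule succ_between[OF W d ab ab'])
        have "far X (d, b) \<in> isos"
          using less.prems d ad wo_refl[OF W F(2)] by (auto simp: iso_run_def)
        then have "far X (d, b) \<cdot> far X (a, d) \<in> isos"
          using isos_comp[OF IH[OF ad db] functor_Hom[OF X' ad] _ functor_Hom[OF X' db(1)]] by simp
        then show ?thesis using functor_comp[OF X' ad db(1)] by simp
      next
        assume "limit_in W b"
        note lim = lim[OF this]
        let ?R' = "Restr W (underS W b)"
        have FR': "Field ?R' = underS W b"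
          using W by (intro Field_Restr) (auto simp: order_on_defs underS_def Field_def)
        have XR': "diagram ?R' X"
          by (rule functor_subset[OF X']) simp
        have "\<exists>e. e \<in> Hom C (fob X t) (fob X a) \<and> ((a, t) \<in> W \<longrightarrow> far X (a, t) \<cdot> e = Ident C (fob X t) \<and>
            e \<cdot> far X (a, t) = Ident C (fob X a)) \<and> ((t, a) \<in> W \<longrightarrow> e = far X (t, a))"
          if t: "t \<in> underS W b" for t
        proof (cases "(a, t) \<in> W")
          case True
          from t have "far X (a, t) \<in> isos" using IH True by (auto simp: underS_def)
          then obtain g where g: "g \<in> Hom C (fob X t) (fob X a)"
            "g \<cdot> far X (a, t) = Ident C (fob X a)" "far X (a, t) \<cdot> g = Ident C (fob X t)"
            using isosE functor_Hom[OF X' True] by metis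
          moreover have "g = far X (t, a)" if "(t, a) \<in> W"
          proof -
            have "t = a" using wo_antisym[OF W True that] by simp
            then show ?thesis using g functor_Ident[OF X'] F comp_Ident[OF g(1)] by simp
          qed
          ultimately show ?thesis by blast
        next
          case False
          then have ta: "(t, a) \<in> W" using t wo_total[OF W F(1), of t] by (auto simp: underS_def Field_def)
          then show ?thesis using functor_Hom[OF X' ta] False by blast
        qed
        then obtain e where e: "\<And>t. t \<in> underS W b \<Longrightarrow> e t \<in> Hom C (fob X t) (fob X a)"
          "\<And>t. t \<in> underS W b \<Longrightarrow> (a, t) \<in> W \<Longrightarrow> far X (a, t) \<cdot> e t = Ident C (fob X t)"
          "\<And>t. t \<in> underS W b \<Longrightarrow> (a, t) \<in> W \<Longrightarrow> e t \<cdot> far X (a, t) = Ident C (fob X a)"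
          "\<And>t. t \<in> underS W b \<Longrightarrow> (t, a) \<in> W \<Longrightarrow> e t = far X (t, a)"
          by metis
        have au: "a \<in> underS W b" using ab ab' by (auto simp: underS_def)
        have uF: "t \<in> Field W" if "t \<in> underS W b" for t
          using that by (auto simp: underS_def Field_def)
        let ?R = "{(a, a)}"
        have "colim ?R X (fob X b) (\<lambda>t. far X (id t, b)) \<longleftrightarrow>
            colim ?R' X (fob X b) (\<lambda>t. far X (t, b))"
        proof (rule colimit_along_final[where j = "\<lambda>_. a" and e = e, OF _ XR'])
          show "diagram ?R X"
            using wo_refl[OF W F(1)] by (intro functor_subset[OF X']) simp
          show "cocone ?R' X (fob X b) (\<lambda>t. far X (t, b))"
            by (rule colimit_cocone[OF lim])
        next
          fix t assume t: "t \<in> Field ?R'"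
          note t' = t[unfolded FR']
          show "\<exists>w. (id a, w) \<in> ?R' \<and> (t, w) \<in> ?R' \<and> far X (id a, w) \<cdot> e t = far X (t, w)"
          proof (cases "(a, t) \<in> W")
            case True
            then show ?thesis
              using t' au e(2)[OF t'] functor_Ident[OF X' uF[OF t']] wo_refl[OF W uF[OF t']] by auto
          next
            case False
            then have ta: "(t, a) \<in> W" using wo_total[OF W F(1) uF[OF t']] by auto
            then show ?thesis
              using t' au e(4)[OF t' ta] functor_Ident[OF X' F(1)] wo_refl[OF W F(1)]
                Ident_comp[OF functor_Hom[OF X' ta]] by auto
          qed
        next
          fix t t' assume tt: "(t, t') \<in> ?R'"
          then have t: "(t, t') \<in> W" "t \<in> underS W b" "t' \<in> underS W b" by auto
          have "e t = e t' \<cdot> far X (t, t')"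
          proof (cases "(a, t') \<in> W")
            case False
            then have ta: "(t', a) \<in> W" using wo_total[OF W F(1) uF[OF t(3)]] by auto
            then show ?thesis
              using e(4)[OF t(3) ta] e(4)[OF t(2)] wo_trans[OF W t(1) ta] functor_comp[OF X' t(1) ta]
              by simp
          next
            case True
            show ?thesis
            proof (cases "(a, t) \<in> W")
              case True
              note m = functor_Hom[OF X' True] functor_Hom[OF X' t(1)] e(1)[OF t(2)] e(1)[OF t(3)]
              have "far X (t, t') = far X (a, t') \<cdot> e t"
                using functor_comp[OF X' True t(1)] comp_assoc[OF m(3,1,2)] e(2)[OF t(2) True]
                  comp_Ident[OF m(2)] by simp
              then show ?thesis
                using comp_reduce[OF e(3)[OF t(3) \<open>(a, t') \<in> W\<close>] m(3)
                    functor_Hom[OF X' \<open>(a, t') \<in> W\<close>] m(4)] Ident_comp[OF m(3)] by simp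
            next
              case False
              then have ta: "(t, a) \<in> W" using wo_total[OF W F(1) uF[OF t(2)]] by auto
              have "far X (t, t') = far X (a, t') \<cdot> far X (t, a)"
                using functor_comp[OF X' ta \<open>(a, t') \<in> W\<close>] by simp
              then show ?thesis
                using comp_reduce[OF e(3)[OF t(3) \<open>(a, t') \<in> W\<close>] functor_Hom[OF X' ta]
                    functor_Hom[OF X' \<open>(a, t') \<in> W\<close>] e(1)[OF t(3)]]
                  Ident_comp[OF functor_Hom[OF X' ta]] e(4)[OF t(2) ta] by simp
            qed
          qed
          then show "\<exists>k. (a, k) \<in> ?R \<and> (a, k) \<in> ?R \<and>
              far X (a, k) \<cdot> e t = far X (a, k) \<cdot> e t' \<cdot> far X (t, t')" by auto
        qed (use e au FR' wo_refl[OF W F(1)] functor_Ident[OF X' F(1)] Ident_simps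
              functor_Obj[OF X' F(1)] in \<open>auto simp: Field_def\<close>)
        then have "colim ?R X (fob X b) (\<lambda>t. far X (t, b))" using lim by simp
        from colimit_greatest_iso[OF this functor_subset[OF X']] show ?thesis
          using wo_refl[OF W F(1)] by (auto simp: Field_def)
      qed
    qed
  qed
qed

text \<open>
  The maximal runs of isomorphisms partition \<open>W\<close> into intervals. Let \<open>S\<close> consist of the least elements
  of these intervals, and let \<open>\<rho>\<close> map every element to the least element of its interval. Restricted to
  \<open>S\<close>, the sequence has the same colimits, since \<open>X (\<rho> t) \<rightarrow> X t\<close> is invertible, and each of its steps
  is a run of isomorphisms followed by one step that is a pushout. A limit of \<open>S\<close> is a limit of \<open>W\<close>: if
  \<open>d + 1\<close> is in \<open>S\<close>, it is the successor of \<open>\<rho> d\<close> there. Well-orders of all types are admitted, with a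
  view to lexicographic sums; the proof copies \<open>S\<close> to \<open>'u\<close>.
\<close>
theorem cell_absorbs_isos:
  fixes U :: "'u rel" and W :: "'w rel"
  assumes U: "universe U" and W: "Well_order W" "small U (Field W)" and m: "m \<in> Field W"
      "\<And>a. a \<in> Field W \<Longrightarrow> (m, a) \<in> W"
    and X: "transfinite_sequence C W X"
    and step: "\<And>a b. succ_in W a b \<Longrightarrow> far X (a, b) \<in> pushouts C I \<union> isos"
    and co: "colim W X c \<iota>"
  shows "\<iota> m \<in> cell U C I"
proof -
  have X': "diagram W X"
    and lim: "\<And>g. limit_in W g \<Longrightarrow>
      colim (Restr W (underS W g)) X (fob X g) (\<lambda>b. far X (b, g))"
    using X by (auto simp: transfinite_sequence_iff[OF W(1)])
  have RW: "Refl W" using W(1) by (simp add: order_on_defs)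
  note [simp] = wo_refl[OF W(1)] and antisym = wo_antisym[OF W(1)] and trans = wo_trans[OF W(1)]
  let ?run = "iso_run W X"
  have run_refl: "?run a a" if "a \<in> Field W" for a
    unfolding iso_run_def
  proof (intro conjI allI impI)
    fix d e assume de: "succ_in W d e" "(a, d) \<in> W" "(e, a) \<in> W"
    have "(d, e) \<in> W" "d \<noteq> e" using de(1) by (simp_all add: succ_in_def)
    then show "far X (d, e) \<in> isos" using antisym[OF _ trans[OF de(3,2)]] by simp
  qed (use that in simp)
  have run_le: "(a, b) \<in> W" if "?run a b" for a b
    using that by (simp add: iso_run_def)
  \<comment> \<open>the least elements of the runs of isomorphisms, and the retraction of \<open>W\<close> onto them\<close>
  define S where "S = {b \<in> Field W. \<forall>a. ?run a b \<longrightarrow> a = b}"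
  have S_Field: "S \<subseteq> Field W" by (auto simp: S_def)
  have "\<exists>a. ?run a b \<and> (\<forall>a'. ?run a' b \<longrightarrow> (a, a') \<in> W)" if "b \<in> Field W" for b
  proof -
    have "{a. ?run a b} \<subseteq> Field W" using Field_left[OF run_le] by auto
    moreover have "{a. ?run a b} \<noteq> {}" using run_refl[OF that] by auto
    ultimately show ?thesis by (rule wo_least[OF W(1)]) auto
  qed
  then obtain \<rho> where \<rho>: "\<And>b. b \<in> Field W \<Longrightarrow> ?run (\<rho> b) b"
    and \<rho>_least: "\<And>a b. ?run a b \<Longrightarrow> (\<rho> b, a) \<in> W"
    by (metis Field_right run_le)
  have \<rho>_le: "(\<rho> b, b) \<in> W" if "b \<in> Field W" for b using run_le[OF \<rho>[OF that]] .
  have \<rho>_S: "\<rho> b \<in> S" if b: "b \<in> Field W" for b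
    unfolding S_def
  proof (intro CollectI conjI allI impI)
    show "\<rho> b \<in> Field W" using Field_left[OF \<rho>_le[OF b]] .
    fix a assume a: "?run a (\<rho> b)"
    then have "(\<rho> b, a) \<in> W" using \<rho>_least iso_run_trans[OF W(1) a \<rho>[OF b]] by blast
    then show "a = \<rho> b" using antisym run_le[OF a] by blast
  qed
  have \<rho>_id: "\<rho> b = b" if "b \<in> S" for b using that \<rho> by (auto simp: S_def)
  have \<rho>_mono: "(\<rho> b, \<rho> c) \<in> W" if bc: "(b, c) \<in> W" for b c
  proof -
    note F = Field_left[OF bc] Field_right[OF bc]
    have c: "\<rho> c \<in> Field W" using \<rho>_S[OF F(2)] S_Field by blast
    show ?thesis
    proof (cases "(\<rho> c, b) \<in> W")
      case True
      then show ?thesis using iso_run_sub[OF W(1) \<rho>[OF F(2)] _ True bc] c \<rho>_least by simp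
    next
      case False
      then show ?thesis using wo_total[OF W(1) c F(1)] trans[OF \<rho>_le[OF F(1)]] by blast
    qed
  qed
  have "\<exists>e. e \<in> Hom C (fob X t) (fob X (\<rho> t)) \<and> e \<cdot> far X (\<rho> t, t) = Ident C (fob X (\<rho> t)) \<and>
      far X (\<rho> t, t) \<cdot> e = Ident C (fob X t)" if t: "t \<in> Field W" for t
    using isosE[OF iso_run_isos[OF W(1) X \<rho>[OF t]] functor_Hom[OF X' \<rho>_le[OF t]]] by metis
  then obtain e where e: "\<And>t. t \<in> Field W \<Longrightarrow> e t \<in> Hom C (fob X t) (fob X (\<rho> t))"
    "\<And>t. t \<in> Field W \<Longrightarrow> e t \<cdot> far X (\<rho> t, t) = Ident C (fob X (\<rho> t))"
    "\<And>t. t \<in> Field W \<Longrightarrow> far X (\<rho> t, t) \<cdot> e t = Ident C (fob X t)"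
    by metis
  have e_nat: "far X (\<rho> t, \<rho> t') \<cdot> e t = e t' \<cdot> far X (t, t')" if tt: "(t, t') \<in> W" for t t'
  proof -
    note F = Field_left[OF tt] Field_right[OF tt]
    note m = functor_Hom[OF X' \<rho>_le[OF F(1)]] functor_Hom[OF X' \<rho>_le[OF F(2)]]
      functor_Hom[OF X' \<rho>_mono[OF tt]] functor_Hom[OF X' tt] e(1)[OF F(1)] e(1)[OF F(2)]
    have "far X (\<rho> t', t') \<cdot> far X (\<rho> t, \<rho> t') \<cdot> e t = far X (\<rho> t, t') \<cdot> e t"
      using comp_reduce[OF functor_comp[OF X' \<rho>_mono[OF tt] \<rho>_le[OF F(2)]] m(5,3,2)] .
    also have "\<dots> = far X (t, t') \<cdot> far X (\<rho> t, t) \<cdot> e t"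
      using comp_reduce[OF functor_comp[OF X' \<rho>_le[OF F(1)] tt] m(5,1,4)] by simp
    also have "\<dots> = far X (t, t')" using e(3)[OF F(1)] comp_Ident[OF m(4)] by simp
    finally have "e t' \<cdot> far X (t, t') = e t' \<cdot> far X (\<rho> t', t') \<cdot> far X (\<rho> t, \<rho> t') \<cdot> e t" by simp
    also have "\<dots> = far X (\<rho> t, \<rho> t') \<cdot> e t"
      using comp_reduce[OF e(2)[OF F(2)] comp_in_Hom[OF m(5,3)] m(2,6)]
        Ident_comp[OF comp_in_Hom[OF m(5,3)]] by simp
    finally show ?thesis by simp
  qed
  have FS: "Field (Restr W S) = S" by (rule Field_Restr[OF RW S_Field])
  obtain p :: "'u rel" and g where p: "small_ordinal U p" and g: "bij_betw g (Field p) (Field (Restr W S))"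
    and pg: "\<And>a b. a \<in> Field p \<Longrightarrow> b \<in> Field p \<Longrightarrow> (a, b) \<in> p \<longleftrightarrow> (g a, g b) \<in> Restr W S"
    using well_order_copy[OF U Well_order_Restr[OF W(1)], of S] FS small_subset[OF W(2) S_Field] by metis
  have po: "Well_order p" using p by (simp add: small_ordinal_def)
  have gS: "g a \<in> S" if "a \<in> Field p" for a using g that FS by (auto simp: bij_betw_def)
  have gF: "g a \<in> Field W" if "a \<in> Field p" for a using gS[OF that] S_Field by blast
  define g' where "g' = inv_into (Field p) g"
  have g'_Field: "g' b \<in> Field p" and g_g': "g (g' b) = b" if "b \<in> S" for b
    using g that FS by (auto simp: bij_betw_def g'_def inv_into_into f_inv_into_f)
  have g'_g: "g' (g a) = a" if "a \<in> Field p" for a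
    using g that by (auto simp: bij_betw_def g'_def)
  have pW: "(a, b) \<in> p \<longleftrightarrow> (g a, g b) \<in> W" if "a \<in> Field p" "b \<in> Field p" for a b
    using pg[OF that] gS that by auto
  have pW': "(g a, g b) \<in> W" if "(a, b) \<in> p" for a b
    using pW[of a b] that by (auto dest: Field_left Field_right)
  have g_inj: "g a = g b \<longleftrightarrow> a = b" if "a \<in> Field p" "b \<in> Field p" for a b
    using g'_g that by metis
  define Y where "Y = \<lparr>fob = (\<lambda>a. fob X (g a)), far = (\<lambda>(a, b). far X (g a, g b))\<rparr>"
  have Y: "diagram p Y"
    using functorD[OF X'] pW' gF unfolding is_functor_ordinal_cat by (simp add: Y_def)
  \<comment> \<open>thinning out to \<open>S\<close> does not change colimits over initial segments\<close>
  have thin: "colim (Restr p {a \<in> Field p. g a \<in> T}) Y c (\<lambda>a. \<iota> (g a)) \<longleftrightarrow>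
      colim (Restr W T) X c \<iota>"
    if T: "T \<subseteq> Field W" "\<And>a t. t \<in> T \<Longrightarrow> (a, t) \<in> W \<Longrightarrow> a \<in> T"
      and \<iota>: "cocone (Restr W T) X c \<iota>" for T c \<iota>
  proof -
    let ?R = "Restr p {a \<in> Field p. g a \<in> T}" and ?R' = "Restr W T"
    have FR': "Field ?R' = T" by (rule Field_Restr[OF RW T(1)])
    have FR: "Field ?R = {a \<in> Field p. g a \<in> T}"
      using po by (intro Field_Restr) (auto simp: order_on_defs)
    have TS: "\<rho> t \<in> T" if "t \<in> T" for t using T that \<rho>_le by blast
    show ?thesis
    proof (rule colimit_along_final[where j = "\<lambda>t. g' (\<rho> t)" and e = e])
      show "diagram ?R Y" by (rule functor_subset[OF Y]) auto
      show "diagram ?R' X" by (rule functor_subset[OF X']) auto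
      show "\<And>a. a \<in> Field ?R \<Longrightarrow> g a \<in> Field ?R'" by (simp add: FR FR')
      show "\<And>a b. (a, b) \<in> ?R \<Longrightarrow> (g a, g b) \<in> ?R'" by (auto simp: pW')
      show "\<And>a. a \<in> Field ?R \<Longrightarrow> fob Y a = fob X (g a)" by (simp add: Y_def)
      show "\<And>a b. (a, b) \<in> ?R \<Longrightarrow> far Y (a, b) = far X (g a, g b)" by (simp add: Y_def)
      show "cocone ?R' X c \<iota>" by (rule \<iota>)
    next
      fix t assume "t \<in> Field ?R'"
      then have t: "t \<in> T" "t \<in> Field W" using FR' T by auto
      note \<rho>t = \<rho>_S[OF t(2)] TS[OF t(1)]
      show "g' (\<rho> t) \<in> Field ?R" using \<rho>t g'_Field g_g' by (simp add: FR)
      show "e t \<in> Hom C (fob X t) (fob Y (g' (\<rho> t)))" using e(1)[OF t(2)] \<rho>t g_g' by (simp add: Y_def)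
      show "\<exists>w. (g (g' (\<rho> t)), w) \<in> ?R' \<and> (t, w) \<in> ?R' \<and> far X (g (g' (\<rho> t)), w) \<cdot> e t = far X (t, w)"
        using g_g'[OF \<rho>t(1)] \<rho>t t \<rho>_le e(3)[OF t(2)] functor_Ident[OF X' t(2)]
        by (intro exI[of _ t]) simp
    next
      fix t t' assume tt: "(t, t') \<in> ?R'"
      then have t: "t \<in> T" "t \<in> Field W" "t' \<in> T" "t' \<in> Field W" using T by auto
      note \<rho>t = \<rho>_S[OF t(2)] TS[OF t(1)] \<rho>_S[OF t(4)] TS[OF t(3)]
      have in_R: "(g' (\<rho> t), g' (\<rho> t')) \<in> ?R" "(g' (\<rho> t'), g' (\<rho> t')) \<in> ?R"
        using tt \<rho>t g'_Field g_g' pW \<rho>_mono S_Field by (auto simp: subset_iff)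
      have "e t' \<cdot> far X (t, t') \<in> Hom C (fob X t) (fob X (\<rho> t'))"
        using e(1)[OF t(4)] functor_Hom[OF X', of t t'] tt by blast
      then show "\<exists>k. (g' (\<rho> t), k) \<in> ?R \<and> (g' (\<rho> t'), k) \<in> ?R \<and>
          far Y (g' (\<rho> t), k) \<cdot> e t = far Y (g' (\<rho> t'), k) \<cdot> e t' \<cdot> far X (t, t')"
        using in_R e_nat[of t t'] tt \<rho>t g_g' S_Field functor_Ident[OF X', of "\<rho> t'"] Ident_comp
        by (intro exI[of _ "g' (\<rho> t')"]) (auto simp: Y_def)
    next
      fix a assume "a \<in> Field ?R"
      then have a: "a \<in> Field p" "g a \<in> S" "g a \<in> T" "g a \<in> Field W"
        using FR gS T by auto
      have "e (g a) = Ident C (fob X (g a))"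
        using e(1,2)[OF a(4)] \<rho>_id[OF a(2)] functor_Ident[OF X' a(4)] comp_Ident by simp
      then show "\<exists>k. (g' (\<rho> (g a)), k) \<in> ?R \<and> (a, k) \<in> ?R \<and>
          far Y (g' (\<rho> (g a)), k) \<cdot> e (g a) = far Y (a, k)"
        using \<rho>_id[OF a(2)] g'_g[OF a(1)] a wo_refl[OF po a(1)] functor_Ident[OF X' a(4)]
          comp_Ident[OF Ident_in_Hom[OF functor_Obj[OF X' a(4)]]]
        by (intro exI[of _ a]) (simp add: Y_def)
    qed
  qed
  have limit_g: "limit_in W (g c)" if c: "limit_in p c" for c
  proof -
    have cF: "c \<in> Field p" using c by (simp add: limit_in_def)
    have gc: "g c \<in> S" "g c \<in> Field W" using gS[OF cF] S_Field by auto
    have below: "\<exists>b. b \<in> Field p \<and> (a, b) \<in> p \<and> a \<noteq> b \<and> (b, c) \<in> p \<and> b \<noteq> c"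
      if "(a, c) \<in> p" "a \<noteq> c" for a
      using c that unfolding limit_in_def underS_def by (auto dest: Field_left)
    show ?thesis
    proof (rule wo_cases[OF W(1) gc(2)])
      assume least: "\<And>a. a \<in> Field W \<Longrightarrow> (g c, a) \<in> W"
      obtain a where a: "a \<noteq> c" "(a, c) \<in> p" using c by (auto simp: limit_in_def underS_def)
      have "a \<in> Field p" using Field_left[OF a(2)] .
      then have "(c, a) \<in> p" using pW[OF cF] least gS S_Field by blast
      then show ?thesis using a wo_antisym[OF po] by blast
    next
      fix a assume a: "succ_in W a (g c)"
      then have ac: "(a, g c) \<in> W" "a \<noteq> g c" by (auto simp: succ_in_def)
      note aF = Field_left[OF ac(1)]
      let ?x = "g' (\<rho> a)"
      have x: "?x \<in> Field p" "g ?x = \<rho> a" using g'_Field g_g' \<rho>_S[OF aF] by auto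
      have "(\<rho> a, g c) \<in> W" by (rule trans[OF \<rho>_le[OF aF] ac(1)])
      moreover have "\<rho> a \<noteq> g c" using antisym[OF ac(1)] \<rho>_le[OF aF] ac(2) by auto
      ultimately have "(?x, c) \<in> p" "?x \<noteq> c" using pW[OF x(1) cF] x by auto
      then obtain y where y: "y \<in> Field p" "(?x, y) \<in> p" "?x \<noteq> y" "(y, c) \<in> p" "y \<noteq> c"
        using below by blast
      have "(g y, g c) \<in> W" "g y \<noteq> g c" using y pW' g_inj[OF y(1) cF] by auto
      then have ya: "(g y, a) \<in> W" by (rule succ_between[OF W(1) a])
      have xy: "(\<rho> a, g y) \<in> W" using pW'[OF y(2)] x by simp
      \<comment> \<open>so \<open>g y\<close> lies inside the run from \<open>\<rho> a\<close> to \<open>a\<close>, which contradicts \<open>g y \<in> S\<close>\<close>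
      have "?run (\<rho> a) (g y)"
        using iso_run_sub[OF W(1) \<rho>[OF aF] _ xy ya] \<rho>_S[OF aF] S_Field by auto
      then have "\<rho> a = g y" using gS[OF y(1)] by (auto simp: S_def)
      then show ?thesis using y(3) x g'_g[OF y(1)] by simp
    qed
  qed
  have Y_lim: "colim (Restr p (underS p c)) Y (fob Y c) (\<lambda>b. far Y (b, c))"
    if c: "limit_in p c" for c
  proof -
    have cF: "c \<in> Field p" using c by (simp add: limit_in_def)
    let ?T = "underS W (g c)"
    have "{a \<in> Field p. g a \<in> ?T} = underS p c"
      using pW[OF _ cF] g_inj[OF _ cF] by (auto simp: underS_def dest: Field_left)
    moreover have "\<And>a t. t \<in> ?T \<Longrightarrow> (a, t) \<in> W \<Longrightarrow> a \<in> ?T"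
      using trans antisym unfolding underS_def by blast
    ultimately have "colim (Restr p (underS p c)) Y (fob X (g c)) (\<lambda>b. far X (g b, g c))"
      using thin[of ?T "fob X (g c)" "\<lambda>b. far X (b, g c)"] lim[OF limit_g[OF c]]
        colimit_cocone[OF lim[OF limit_g[OF c]]] Order_Relation.underS_Field[of W "g c"] by simp
    then show ?thesis by (simp add: Y_def)
  qed
  have Y_step: "far Y (x, y) \<in> pushouts C I" if xy: "succ_in p x y" for x y
  proof -
    have xyp: "(x, y) \<in> p" "x \<noteq> y" using xy by (auto simp: succ_in_def)
    note F = Field_left[OF xyp(1)] Field_right[OF xyp(1)]
    let ?b = "g x" and ?c = "g y"
    have bc: "(?b, ?c) \<in> W" "?b \<noteq> ?c" using pW'[OF xyp(1)] g_inj[OF F] xyp by auto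
    note S = gS[OF F(1)] gS[OF F(2)]
    \<comment> \<open>the first step after \<open>?b\<close> that is not invertible leads to \<open>?c\<close>\<close>
    let ?Q = "{d. (?b, d) \<in> W \<and> (\<exists>e. succ_in W d e \<and> (e, ?c) \<in> W \<and> far X (d, e) \<notin> isos)}"
    have "\<not> ?run ?b ?c" using S(2) bc by (auto simp: S_def)
    then have "?Q \<noteq> {}" using bc unfolding iso_run_def by auto
    have "?Q \<subseteq> Field W" by (auto dest: Field_right)
    from this \<open>?Q \<noteq> {}\<close> obtain d where d: "d \<in> ?Q" "\<And>q. q \<in> ?Q \<Longrightarrow> (d, q) \<in> W"
      by (rule wo_least[OF W(1)]) (rule that)
    then obtain e where e: "(?b, d) \<in> W" "succ_in W d e" "(e, ?c) \<in> W" "far X (d, e) \<notin> isos" by blast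
    have de: "(d, e) \<in> W" "d \<noteq> e" using e by (auto simp: succ_in_def)
    have run: "?run ?b d"
      unfolding iso_run_def
    proof (intro conjI allI impI e(1))
      fix d' e' assume q: "succ_in W d' e'" "(?b, d') \<in> W" "(e', d) \<in> W"
      show "far X (d', e') \<in> isos"
      proof (rule ccontr)
        assume "far X (d', e') \<notin> isos"
        then have "d' \<in> ?Q" using q trans[OF q(3) trans[OF de(1) e(3)]] by blast
        then have "(d, d') \<in> W" by (rule d(2))
        then have "d' = e'" using antisym[of d' e'] trans[OF q(3)] q(1) by (auto simp: succ_in_def)
        then show False using q(1) by (simp add: succ_in_def)
      qed
    qed
    have eS: "e \<in> S"
      unfolding S_def
    proof (intro CollectI conjI allI impI)
      show "e \<in> Field W" using Field_left[OF e(3)] .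
      fix a assume a: "?run a e"
      show "a = e"
      proof (rule ccontr)
        assume "a \<noteq> e"
        then have "(a, d) \<in> W" using succ_between[OF W(1) e(2) run_le[OF a]] by blast
        then have "far X (d, e) \<in> isos" using a e(2) Field_left[OF e(3)] by (auto simp: iso_run_def)
        then show False using e(4) by blast
      qed
    qed
    have be: "(?b, e) \<in> W" "?b \<noteq> e"
      using trans[OF e(1) de(1)] e(1) de antisym[OF de(1)] by auto
    have "(x, g' e) \<in> p" "x \<noteq> g' e"
      using be pW[OF F(1) g'_Field[OF eS]] g_g'[OF eS] by auto
    then have "(y, g' e) \<in> p" using xy by (auto simp: succ_in_def)
    then have "(?c, e) \<in> W" using pW' g_g'[OF eS] by metis
    then have ec: "e = ?c" using antisym e(3) by blast
    have "far X (d, e) \<in> pushouts C I" using step[OF e(2)] e(4) by blast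
    moreover have "Dom C (far X (d, e)) = fob X d"
      using functor_Hom[OF X' de(1)] by (rule HomD)
    ultimately have "far X (d, e) \<cdot> far X (?b, d) \<in> pushouts C I"
      using pushout_comp_iso iso_run_isos[OF W(1) X run] functor_Hom[OF X' e(1)] by metis
    then show ?thesis using functor_comp[OF X' e(1) de(1)] ec by (simp add: Y_def)
  qed
  have mS: "m \<in> S"
    using m antisym run_le unfolding S_def by (blast dest: Field_left)
  have pne: "Field p \<noteq> {}" using g'_Field[OF mS] by blast
  have "colim (Restr p {a \<in> Field p. g a \<in> Field W}) Y c (\<lambda>a. \<iota> (g a))"
    using thin[of "Field W" c \<iota>] co colimit_cocone[OF co] Restr_Field[of W] by (auto dest: Field_left)
  moreover have "{a \<in> Field p. g a \<in> Field W} = Field p" using gS S_Field by auto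
  ultimately have co': "colim p Y c (\<lambda>a. \<iota> (g a))"
    using Restr_Field[of p] by simp
  let ?m = "wo_rel.minim p (Field p)"
  have "(?m, g' m) \<in> p" "?m \<in> Field p" using wo_minim[OF po pne] g'_Field[OF mS] by auto
  then have "(g ?m, m) \<in> W" "(m, g ?m) \<in> W" using pW' g_g'[OF mS] m(2) gS S_Field by force+
  then have gm: "g ?m = m" by (rule antisym)
  have "transfinite_sequence C p Y" using Y Y_lim by (simp add: transfinite_sequence_iff[OF po])
  moreover have "steps_in (pushouts C I) p Y" using Y_step by (simp add: steps_in_iff[OF po])
  ultimately show ?thesis
    unfolding cell_def transfinite_compositions_def
    using p pne co' gm by blast
qed

section \<open>Relative cell complexes compose transfinitely\<close>

lemma functor_cocone_underS:
  assumes Y: "diagram W Y" and t: "t \<in> Field W"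
  shows "cocone (Restr W (underS W t)) Y (fob Y t) (\<lambda>u. far Y (u, t))"
  unfolding is_cocone_ordinal_cat
proof (intro conjI ballI allI impI)
  show "fob Y t \<in> Obj C" by (rule functor_Obj[OF Y t])
next
  fix a assume "a \<in> Field (Restr W (underS W t))"
  then have "a \<in> underS W t" using Field_Restr_subset[of W "underS W t"] by blast
  then show "far Y (a, t) \<in> Hom C (fob Y a) (fob Y t)" using functor_Hom[OF Y] by (simp add: underS_def)
next
  fix a b assume "(a, b) \<in> Restr W (underS W t)"
  then show "far Y (b, t) \<cdot> far Y (a, b) = far Y (a, t)"
    using functor_comp[OF Y] by (simp add: underS_def)
qed

lemma colimit_along_cofinal:
  assumes W: "Well_order W" and T: "T \<subseteq> Field W" and X': "diagram W X'"
    and h: "\<And>a. a \<in> Field R \<Longrightarrow> h a \<in> T"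
    and R: "\<And>a b. a \<in> Field R \<Longrightarrow> b \<in> Field R \<Longrightarrow> (a, b) \<in> R \<longleftrightarrow> (h a, h b) \<in> W"
    and cof: "\<And>t. t \<in> T \<Longrightarrow> \<exists>a\<in>Field R. (t, h a) \<in> W"
    and ob: "\<And>a. a \<in> Field R \<Longrightarrow> fob X a = fob X' (h a)"
    and ar: "\<And>a b. (a, b) \<in> R \<Longrightarrow> far X (a, b) = far X' (h a, h b)"
    and co: "cocone (Restr W T) X' c \<iota>"
    and L: "colim R X c (\<lambda>a. \<iota> (h a))"
  shows "colim (Restr W T) X' c \<iota>"
proof -
  let ?R' = "Restr W T"
  have FR': "Field ?R' = T" using W T by (intro Field_Restr) (auto simp: order_on_defs)
  have hW: "h a \<in> Field W" if "a \<in> Field R" for a using h[OF that] T by blast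
  have RW: "(h a, h b) \<in> W" if "(a, b) \<in> R" for a b
    using R[OF Field_left[OF that] Field_right[OF that]] that by simp
  have X: "diagram R X"
    unfolding is_functor_ordinal_cat
  proof (intro conjI ballI allI impI)
    fix a assume a: "a \<in> Field R"
    then have "(a, a) \<in> R" using R wo_refl[OF W hW] by simp
    then show "fob X a \<in> Obj C" "far X (a, a) = Ident C (fob X a)"
      using functor_Obj[OF X' hW[OF a]] functor_Ident[OF X' hW[OF a]] ob[OF a] ar by simp_all
  next
    fix a b assume ab: "(a, b) \<in> R"
    show "far X (a, b) \<in> Hom C (fob X a) (fob X b)"
      using functor_Hom[OF X' RW[OF ab]] ar[OF ab] ob Field_left[OF ab] Field_right[OF ab] by simp
    fix c assume bc: "(b, c) \<in> R"
    have "(a, c) \<in> R"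
      using R[OF Field_left[OF ab] Field_right[OF bc]] wo_trans[OF W RW[OF ab] RW[OF bc]] by simp
    then show "far X (a, c) = far X (b, c) \<cdot> far X (a, b)"
      using functor_comp[OF X' RW[OF ab] RW[OF bc]] ar ab bc by simp
  qed
  obtain j where j: "\<And>t. t \<in> T \<Longrightarrow> j t \<in> Field R" "\<And>t. t \<in> T \<Longrightarrow> (t, h (j t)) \<in> W"
    using cof by metis
  have upper: "\<exists>k. (a, k) \<in> R \<and> (b, k) \<in> R" if "a \<in> Field R" "b \<in> Field R" for a b
    using R that wo_total[OF W hW hW] wo_refl[OF W hW] by metis
  have "colim R X c (\<lambda>a. \<iota> (h a)) \<longleftrightarrow> colim ?R' X' c \<iota>"
  proof (rule colimit_along_final[where e = "\<lambda>t. far X' (t, h (j t))", OF X _ _ _ ob ar _ _ _ _ _ co])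
    show "diagram ?R' X'" by (rule functor_subset[OF X']) auto
    show "\<And>a. a \<in> Field R \<Longrightarrow> h a \<in> Field ?R'" using h FR' by simp
    show "(h a, h b) \<in> ?R'" if "(a, b) \<in> R" for a b
      using RW[OF that] h[OF Field_left[OF that]] h[OF Field_right[OF that]] by simp
    show "\<And>t. t \<in> Field ?R' \<Longrightarrow> j t \<in> Field R" using j FR' by simp
  next
    fix t assume "t \<in> Field ?R'"
    then have t: "t \<in> T" using FR' by simp
    show "far X' (t, h (j t)) \<in> Hom C (fob X' t) (fob X (j t))"
      using functor_Hom[OF X' j(2)[OF t]] ob[OF j(1)[OF t]] by simp
    show "\<exists>w. (h (j t), w) \<in> ?R' \<and> (t, w) \<in> ?R' \<and>
        far X' (h (j t), w) \<cdot> far X' (t, h (j t)) = far X' (t, w)"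
      using t j[OF t] h[OF j(1)[OF t]] wo_refl[OF W hW[OF j(1)[OF t]]]
        functor_comp[OF X' j(2)[OF t] wo_refl[OF W hW[OF j(1)[OF t]]]]
      by (intro exI[of _ "h (j t)"]) simp
  next
    fix t t' assume "(t, t') \<in> ?R'"
    then have t: "t \<in> T" "t' \<in> T" "(t, t') \<in> W" by auto
    obtain k where k: "(j t, k) \<in> R" "(j t', k) \<in> R" using upper j(1) t by blast
    have "far X' (h (j t'), h k) \<cdot> far X' (t', h (j t')) \<cdot> far X' (t, t') = far X' (t, h k)"
      using functor_comp[OF X' t(3) j(2)[OF t(2)]]
        functor_comp[OF X' wo_trans[OF W t(3) j(2)[OF t(2)]] RW[OF k(2)]] by simp
    then show "\<exists>k. (j t, k) \<in> R \<and> (j t', k) \<in> R \<and> far X (j t, k) \<cdot> far X' (t, h (j t)) =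
        far X (j t', k) \<cdot> far X' (t', h (j t')) \<cdot> far X' (t, t')"
      using k ar functor_comp[OF X' j(2)[OF t(1)] RW[OF k(1)]] by (intro exI[of _ k]) simp
  next
    fix a assume a: "a \<in> Field R"
    obtain k where k: "(j (h a), k) \<in> R" "(a, k) \<in> R" using upper j(1) h a by blast
    then show "\<exists>k. (j (h a), k) \<in> R \<and> (a, k) \<in> R \<and>
        far X (j (h a), k) \<cdot> far X' (h a, h (j (h a))) = far X (a, k)"
      using ar functor_comp[OF X' j(2)[OF h[OF a]] RW[OF k(1)]] by (intro exI[of _ k]) simp
  qed
  then show ?thesis using L by simp
qed

text \<open>
  Each step \<open>X b \<rightarrow> X (b + 1)\<close> is the composition of a sequence \<open>Z b\<close> over an ordinal \<open>rr b\<close>. These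
  sequences are concatenated along the lexicographic sum \<open>W\<close> of the \<open>rr b\<close>. If \<open>rr b\<close> has a greatest
  element \<open>x\<close>, then the step from \<open>(b, x)\<close> to the beginning of \<open>Z (b + 1)\<close> is the colimit map
  \<open>Z b x \<rightarrow> X (b + 1)\<close>, which is an isomorphism but need not be a pushout; \<open>cell_absorbs_isos\<close> removes it. The
  ordinal \<open>r\<close> is a limit, so every \<open>b\<close> has a step to be resolved.
\<close>
theorem cell_transfinite_composition:
  fixes U :: "'u rel" and r :: "'u rel"
  assumes U: "universe U" and r: "small_ordinal U r" "limit_ordinal r"
    and X: "transfinite_sequence C r X" and step: "steps_in (cell U C I) r X"
    and co: "colim r X c \<iota>"
  shows "\<iota> (wo_rel.minim r (Field r)) \<in> cell U C I"
proof -
  have wr: "Well_order r" and sr: "small U (Field r)" using r(1) by (simp_all add: small_ordinal_def)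
  have rne: "Field r \<noteq> {}" using r(2) by (simp add: limit_ordinal_def)
  have X': "diagram r X"
    and lim: "\<And>g. limit_in r g \<Longrightarrow>
      colim (Restr r (underS r g)) X (fob X g) (\<lambda>b. far X (b, g))"
    using X by (auto simp: transfinite_sequence_iff[OF wr])
  have "\<exists>b'. succ_in r b b'" if "b \<in> Field r" for b
    using succ_in_suc(1)[OF wr that] r(2) that unfolding limit_ordinal_def by blast
  then obtain s where s: "\<And>b. b \<in> Field r \<Longrightarrow> succ_in r b (s b)" by metis
  have bs: "(b, s b) \<in> r" if "b \<in> Field r" for b using s[OF that] by (simp add: succ_in_def)
  have sb: "(s a, b) \<in> r" if "(a, b) \<in> r" "a \<noteq> b" for a b
    using s[OF Field_left[OF that(1)]] that by (auto simp: succ_in_def)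
  have sF: "s b \<in> Field r" if "b \<in> Field r" for b using Field_right[OF bs[OF that]] .
  define cell_of where "cell_of b R Z \<kappa> \<longleftrightarrow> small_ordinal U R \<and> Field R \<noteq> {} \<and>
      transfinite_sequence C R Z \<and> steps_in (pushouts C I) R Z \<and>
      colim R Z (fob X (s b)) \<kappa> \<and>
      far X (b, s b) = \<kappa> (wo_rel.minim R (Field R)) \<and> fob X b = fob Z (wo_rel.minim R (Field R))"
    for b :: 'u and R :: "'u rel" and Z \<kappa>
  have "\<exists>R Z \<kappa>. cell_of b R Z \<kappa>"
    if b: "b \<in> Field r" for b
  proof -
    have "far X (b, s b) \<in> cell U C I"
      using step s[OF b] by (auto simp: steps_in_iff[OF wr])
    then obtain R :: "'u rel" and Z d \<kappa> where Z: "small_ordinal U R" "Field R \<noteq> {}"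
      "transfinite_sequence C R Z" "steps_in (pushouts C I) R Z"
      "colim R Z d \<kappa>" "far X (b, s b) = \<kappa> (wo_rel.minim R (Field R))"
      unfolding cell_def transfinite_compositions_def by blast
    have "wo_rel.minim R (Field R) \<in> Field R" using wo_minim(1) Z(1,2) by (auto simp: small_ordinal_def)
    then have "far X (b, s b) \<in> Hom C (fob Z (wo_rel.minim R (Field R))) d"
      unfolding Z(6) by (rule cocone_Hom[OF colimit_cocone[OF Z(5)]])
    then have "fob Z (wo_rel.minim R (Field R)) = fob X b" "d = fob X (s b)"
      using functor_Hom[OF X' bs[OF b]] by (auto simp: Hom_def)
    then show ?thesis using Z unfolding cell_of_def by metis
  qed
  then obtain rr Z \<kappa> where "\<And>b. b \<in> Field r \<Longrightarrow> cell_of b (rr b) (Z b) (\<kappa> b)"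
    by metis
  then have rr: "\<And>b. b \<in> Field r \<Longrightarrow> small_ordinal U (rr b)" "\<And>b. b \<in> Field r \<Longrightarrow> Field (rr b) \<noteq> {}"
    and Z: "\<And>b. b \<in> Field r \<Longrightarrow> transfinite_sequence C (rr b) (Z b)"
    and Zstep: "\<And>b. b \<in> Field r \<Longrightarrow> steps_in (pushouts C I) (rr b) (Z b)"
    and Zco: "\<And>b. b \<in> Field r \<Longrightarrow> colim (rr b) (Z b) (fob X (s b)) (\<kappa> b)"
    and \<kappa>_min': "\<And>b. b \<in> Field r \<Longrightarrow> far X (b, s b) = \<kappa> b (wo_rel.minim (rr b) (Field (rr b)))"
    and Z_min': "\<And>b. b \<in> Field r \<Longrightarrow> fob X b = fob (Z b) (wo_rel.minim (rr b) (Field (rr b)))"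
    unfolding cell_of_def by simp_all
  \<comment> \<open>the least element of \<open>rr b\<close>; stage \<open>(b, n b)\<close> of the sum is \<open>X b\<close>\<close>
  define n where "n b = wo_rel.minim (rr b) (Field (rr b))" for b
  note \<kappa>_min = \<kappa>_min'[folded n_def] and Z_min = Z_min'[folded n_def]
  have wrr: "Well_order (rr b)" if "b \<in> Field r" for b using rr(1)[OF that] by (simp add: small_ordinal_def)
  have n: "n b \<in> Field (rr b)" "\<And>x. x \<in> Field (rr b) \<Longrightarrow> (n b, x) \<in> rr b" if "b \<in> Field r" for b
    using wo_minim[OF wrr[OF that] rr(2)[OF that]] by (simp_all add: n_def)
  have Z': "diagram (rr b) (Z b)" if "b \<in> Field r" for b
    using Z[OF that] by (simp add: transfinite_sequence_iff[OF wrr[OF that]])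
  note \<kappa> = colimit_cocone[OF Zco]

  define P where "P = Sigma (Field r) (\<lambda>b. Field (rr b))"
  define W where "W = {((a, x), (b, y)). (a, x) \<in> P \<and> (b, y) \<in> P \<and>
    ((a, b) \<in> r \<and> a \<noteq> b \<or> a = b \<and> (x, y) \<in> rr a)}"
  have P: "(b, x) \<in> P \<longleftrightarrow> b \<in> Field r \<and> x \<in> Field (rr b)" for b x by (simp add: P_def)
  have W_iff: "((a, x), (b, y)) \<in> W \<longleftrightarrow> (a, x) \<in> P \<and> (b, y) \<in> P \<and>
    ((a, b) \<in> r \<and> a \<noteq> b \<or> a = b \<and> (x, y) \<in> rr a)" for a x b y by (simp add: W_def)
  have W_refl: "(t, t) \<in> W" if "t \<in> P" for t
    using that wo_refl[OF wrr] by (cases t) (simp add: W_iff P)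
  have FW: "Field W = P"
    using W_refl by (auto simp: W_def Field_def)
  have W_fst: "((a, x), (a, y)) \<in> W \<longleftrightarrow> a \<in> Field r \<and> (x, y) \<in> rr a" for a x y
    by (auto simp: W_iff P dest: Field_left Field_right)
  have W_lt: "((a, x), (b, y)) \<in> W"
    if "(a, b) \<in> r" "a \<noteq> b" "x \<in> Field (rr a)" "y \<in> Field (rr b)" for a x b y
    using that by (auto simp: W_iff P dest: Field_left Field_right)
  have WW: "Well_order W"
  proof -
    have "trans W"
    proof (rule transI)
      fix t u v assume tu: "(t, u) \<in> W" and uv: "(u, v) \<in> W"
      obtain a x b y d z where [simp]: "t = (a, x)" "u = (b, y)" "v = (d, z)"
        by (metis surj_pair)
      consider "a = b" "b = d" | "a = b" "(b, d) \<in> r" "b \<noteq> d" | "(a, b) \<in> r" "a \<noteq> b" "b = d"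
        | "(a, b) \<in> r" "a \<noteq> b" "(b, d) \<in> r" "b \<noteq> d"
        using tu uv by (auto simp: W_iff)
      then show "(t, v) \<in> W"
      proof cases
        case 1
        then show ?thesis using tu uv wo_trans[OF wrr, of a x y z] by (simp add: W_fst)
      next
        case 4
        then have "(a, d) \<in> r" "a \<noteq> d" using wo_trans[OF wr] wo_antisym[OF wr] by blast+
        then show ?thesis using tu uv by (simp add: W_iff)
      qed (use tu uv in \<open>simp_all add: W_iff\<close>)
    qed
    moreover have "antisym W"
    proof (rule antisymI)
      fix t u assume tu: "(t, u) \<in> W" "(u, t) \<in> W"
      obtain a x b y where [simp]: "t = (a, x)" "u = (b, y)" by (metis surj_pair)
      have "a = b" using tu wo_antisym[OF wr, of a b] by (auto simp: W_iff)
      then show "t = u" using tu wo_antisym[OF wrr, of a x y] by (simp add: W_fst)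
    qed
    moreover have "Total W"
      unfolding total_on_def FW
    proof (intro ballI impI)
      fix t u assume tu: "t \<in> P" "u \<in> P"
      obtain a x b y where [simp]: "t = (a, x)" "u = (b, y)" by (metis surj_pair)
      show "(t, u) \<in> W \<or> (u, t) \<in> W"
      proof (cases "a = b")
        case True
        then show ?thesis using tu wo_total[OF wrr, of a x y] by (auto simp: W_fst P)
      next
        case False
        then show ?thesis using tu wo_total[OF wr, of a b] by (auto simp: W_iff P)
      qed
    qed
    moreover have "wf (W - Id)"
      unfolding wf_eq_minimal
    proof (intro allI impI)
      fix Q :: "('u \<times> 'u) set" and t0 assume t0: "t0 \<in> Q"
      show "\<exists>t\<in>Q. \<forall>u. (u, t) \<in> W - Id \<longrightarrow> u \<notin> Q"
      proof (cases "Q \<inter> P = {}")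
        case True
        then have "(u, t0) \<notin> W" for u using t0 FW Field_right[of u t0 W] by auto
        then show ?thesis using t0 by blast
      next
        case False
        then have "fst ` (Q \<inter> P) \<subseteq> Field r" "fst ` (Q \<inter> P) \<noteq> {}" by (auto simp: P_def)
        from wo_least[OF wr this] obtain a where a: "a \<in> fst ` (Q \<inter> P)"
          "\<And>b. b \<in> fst ` (Q \<inter> P) \<Longrightarrow> (a, b) \<in> r" by metis
        have aF: "a \<in> Field r" using a(1) by (auto simp: P_def)
        have "{x. (a, x) \<in> Q \<inter> P} \<subseteq> Field (rr a)" "{x. (a, x) \<in> Q \<inter> P} \<noteq> {}"
          using a(1) by (auto simp: P_def)
        from wo_least[OF wrr[OF aF] this] obtain x where x: "(a, x) \<in> Q" "(a, x) \<in> P"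
          "\<And>y. (a, y) \<in> Q \<Longrightarrow> (a, y) \<in> P \<Longrightarrow> (x, y) \<in> rr a"
          by (metis (mono_tags, lifting) IntD1 IntD2 IntI mem_Collect_eq)
        have "(b, y) \<notin> Q" if lt: "((b, y), (a, x)) \<in> W" "(b, y) \<noteq> (a, x)" for b y
        proof
          assume q: "(b, y) \<in> Q"
          have bP: "(b, y) \<in> P" using lt(1) by (simp add: W_iff)
          then have "(a, b) \<in> r" using a(2) q by force
          then have "b = a" using lt(1) wo_antisym[OF wr, of a b] by (auto simp: W_iff)
          then show False
            using lt x(3)[of y] q bP wo_antisym[OF wrr[OF aF], of x y] by (simp add: W_fst)
        qed
        then show ?thesis using x(1) by (intro bexI[of _ "(a, x)"]) auto
      qed
    qed
    ultimately show ?thesis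
      using W_refl FW Field_left[of _ _ W] Field_right[of _ _ W]
      unfolding well_order_on_def linear_order_on_def partial_order_on_def preorder_on_def refl_on_def
      by (auto dest: Field_left Field_right)
  qed
  have sW: "small U (Field W)"
    unfolding FW P_def using rr(1) by (intro small_Sigma[OF U sr]) (simp add: small_ordinal_def)

  \<comment> \<open>from \<open>Z a x\<close> to a later block go through \<open>X (a + 1)\<close> and \<open>X b\<close>\<close>
  define Y where "Y = \<lparr>fob = (\<lambda>(b, x). fob (Z b) x),
    far = (\<lambda>((a, x), (b, y)). if a = b then far (Z a) (x, y)
      else far (Z b) (n b, y) \<cdot> far X (s a, b) \<cdot> \<kappa> a x)\<rparr>"
  have Y_fob: "fob Y (b, x) = fob (Z b) x" for b x by (simp add: Y_def)
  have Y_same: "far Y ((a, x), (a, y)) = far (Z a) (x, y)" for a x y by (simp add: Y_def)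
  have Y_diff: "far Y ((a, x), (b, y)) = far (Z b) (n b, y) \<cdot> far X (s a, b) \<cdot> \<kappa> a x" if "a \<noteq> b" for a x b y
    using that by (simp add: Y_def)
  have h1: "\<kappa> a x \<in> Hom C (fob (Z a) x) (fob X (s a))" if "(a, x) \<in> P" for a x
    using cocone_Hom[OF \<kappa>] that by (simp add: P)
  have h2: "far (Z b) (n b, y) \<in> Hom C (fob X b) (fob (Z b) y)" if "(b, y) \<in> P" for b y
    using functor_Hom[OF Z' n(2)] that Z_min by (simp add: P)
  have Y: "diagram W Y"
    unfolding is_functor_ordinal_cat FW
  proof (intro conjI ballI allI impI)
    fix t assume "t \<in> P"
    then obtain b x where t: "t = (b, x)" "b \<in> Field r" "x \<in> Field (rr b)" by (auto simp: P_def)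
    then show "fob Y t \<in> Obj C" "far Y (t, t) = Ident C (fob Y t)"
      using functor_Obj[OF Z'[OF t(2)] t(3)] functor_Ident[OF Z'[OF t(2)] t(3)]
      by (simp_all add: Y_fob Y_same)
  next
    fix t u assume tu: "(t, u) \<in> W"
    obtain a x b y where t: "t = (a, x)" "u = (b, y)" by (metis surj_pair)
    then have p: "(a, x) \<in> P" "(b, y) \<in> P" using tu by (auto simp: W_iff)
    show "far Y (t, u) \<in> Hom C (fob Y t) (fob Y u)"
    proof (cases "a = b")
      case True
      then show ?thesis using t tu functor_Hom[OF Z'] by (simp add: Y_same Y_fob W_fst)
    next
      case False
      then have "(a, b) \<in> r" using tu t by (simp add: W_iff)
      then show ?thesis
        using h1[OF p(1)] h2[OF p(2)] functor_Hom[OF X' sb] False t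
        by (auto simp: Y_diff Y_fob)
    qed
  next
    fix t u v assume tu: "(t, u) \<in> W" and uv: "(u, v) \<in> W"
    obtain a x b y d z where t: "t = (a, x)" "u = (b, y)" "v = (d, z)" by (metis surj_pair)
    then have p: "(a, x) \<in> P" "(b, y) \<in> P" "(d, z) \<in> P" using tu uv by (auto simp: W_iff)
    then have F: "a \<in> Field r" "b \<in> Field r" "d \<in> Field r" by (simp_all add: P)
    note m = h1[OF p(1)] h1[OF p(2)] h2[OF p(2)] h2[OF p(3)]
    consider "a = b" "b = d" | "a = b" "(b, d) \<in> r" "b \<noteq> d" | "(a, b) \<in> r" "a \<noteq> b" "b = d"
      | "(a, b) \<in> r" "a \<noteq> b" "(b, d) \<in> r" "b \<noteq> d"
      using tu uv t by (auto simp: W_iff)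
    then show "far Y (t, v) = far Y (u, v) \<cdot> far Y (t, u)"
    proof cases
      case 1
      then show ?thesis using t tu uv functor_comp[OF Z'] by (simp add: Y_same W_fst)
    next
      case 2
      then have xy: "(x, y) \<in> rr a" using tu t by (simp add: W_fst)
      have X1: "far X (s b, d) \<in> Hom C (fob X (s b)) (fob X d)" using functor_Hom[OF X' sb] 2 by simp
      have "\<kappa> a y \<cdot> far (Z a) (x, y) = \<kappa> a x" using cocone_comp[OF \<kappa>[OF F(1)] xy] .
      then show ?thesis
        using 2 t m X1 functor_Hom[OF Z'[OF F(1)] xy]
        by (simp add: Y_same Y_diff Hom_def arr_simps)
    next
      case 3
      then have yz: "(y, z) \<in> rr b" using uv t by (simp add: W_fst)
      have X1: "far X (s a, b) \<in> Hom C (fob X (s a)) (fob X b)" using functor_Hom[OF X' sb] 3 by simp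
      have "far (Z b) (y, z) \<cdot> far (Z b) (n b, y) \<cdot> far X (s a, b) \<cdot> \<kappa> a x =
          far (Z b) (n b, z) \<cdot> far X (s a, b) \<cdot> \<kappa> a x"
        using comp_reduce[OF functor_comp[OF Z'[OF F(2)] n(2)[OF F(2)] yz] _ _ functor_Hom[OF Z'[OF F(2)] yz]]
          p m X1 Z_min[OF F(2)] by (auto simp: P)
      then show ?thesis using 3 t by (simp add: Y_same Y_diff)
    next
      case 4
      have X1: "far X (s a, b) \<in> Hom C (fob X (s a)) (fob X b)" 
        and X2: "far X (s b, d) \<in> Hom C (fob X (s b)) (fob X d)"
        and X3: "far X (b, s b) \<in> Hom C (fob X b) (fob X (s b))" 
        using functor_Hom[OF X' sb] 4 functor_Hom[OF X' bs[OF F(2)]] by simp_all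
      have ad: "a \<noteq> d" using 4 wo_antisym[OF wr] by blast
      have k: "\<kappa> b y \<cdot> far (Z b) (n b, y) = far X (b, s b)"
        using cocone_comp[OF \<kappa>[OF F(2)] n(2)[OF F(2)]] p \<kappa>_min[OF F(2)] by (simp add: P)
      have "far X (s b, d) \<cdot> far X (b, s b) \<cdot> far X (s a, b) = far X (s a, d)"
        using functor_comp[OF X' sb[OF 4(1,2)] wo_trans[OF wr bs[OF F(2)] sb[OF 4(3,4)]]]
          comp_assoc[OF X1 X3 X2] functor_comp[OF X' bs[OF F(2)] sb[OF 4(3,4)]] by simp
      then have "far X (s a, d) \<cdot> \<kappa> a x = far X (s b, d) \<cdot> (\<kappa> b y \<cdot> far (Z b) (n b, y)) \<cdot> far X (s a, b) \<cdot> \<kappa> a x"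
        unfolding k using m X1 X2 X3 by (auto simp: Hom_def arr_simps dest: sym)
      then show ?thesis
        using 4 ad t m X1 X2 by (simp add: Y_diff Hom_def arr_simps)
    qed
  qed
  have Y_n: "far Y ((a, n a), (b, n b)) = far X (a, b)" if ab: "(a, b) \<in> r" for a b
  proof (cases "a = b")
    case True
    then show ?thesis
      using ab Field_left[OF ab] functor_Ident[OF X'] functor_Ident[OF Z' n(1)] Z_min by (simp add: Y_same)
  next
    case False
    note F = Field_left[OF ab] Field_right[OF ab]
    have "far X (s a, b) \<cdot> far X (a, s a) \<in> Hom C (fob X a) (fob X b)"
      using functor_Hom[OF X' bs[OF F(1)]] functor_Hom[OF X' sb[OF ab False]] by blast
    then show ?thesis
      using False \<kappa>_min[OF F(1)] functor_Ident[OF Z'[OF F(2)] n(1)[OF F(2)]] Z_min[OF F(2)]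
        functor_comp[OF X' bs[OF F(1)] sb[OF ab False]] Ident_comp
      by (simp add: Y_diff)
  qed
  have Y_s: "far Y ((a, x), (s a, n (s a))) = \<kappa> a x" if a: "a \<in> Field r" and x: "x \<in> Field (rr a)" for a x
  proof -
    have "a \<noteq> s a" using s[OF a] by (simp add: succ_in_def)
    then show ?thesis
      using h1[of a x] a x functor_Ident[OF Z'[OF sF[OF a]] n(1)[OF sF[OF a]]] Z_min[OF sF[OF a]]
        functor_Ident[OF X' sF[OF a]] Ident_comp by (simp add: Y_diff P)
  qed
  have W_s: "((a, x), (s a, n (s a))) \<in> W" if "a \<in> Field r" "x \<in> Field (rr a)" for a x
    using W_lt[OF bs[OF that(1)] _ that(2) n(1)[OF sF[OF that(1)]]] s[OF that(1)] by (auto simp: succ_in_def)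
  have W_n: "((a, n a), (b, n b)) \<in> W \<longleftrightarrow> (a, b) \<in> r" if "a \<in> Field r" "b \<in> Field r" for a b
    using that n(1) wo_refl[OF wrr[OF that(1)] n(1)[OF that(1)]] wo_refl[OF wr] by (auto simp: W_iff P)

  have Y_cocone: "cocone (Restr W (underS W t)) Y (fob Y t) (\<lambda>u. far Y (u, t))"
    if t: "t \<in> Field W" for t
    by (rule functor_cocone_underS[OF Y t])
  have Y_lim: "colim (Restr W (underS W t)) Y (fob Y t) (\<lambda>u. far Y (u, t))"
    if t: "limit_in W t" for t
  proof -
    obtain g z where gz: "t = (g, z)" by (cases t)
    have tF: "t \<in> Field W" using t by (simp add: limit_in_def)
    then have gzF: "g \<in> Field r" "z \<in> Field (rr g)" by (simp_all add: FW P gz)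
    have T: "underS W t \<subseteq> Field W" by (rule Order_Relation.underS_Field)
    note cofinal = colimit_along_cofinal[OF WW T Y _ _ _ _ _ Y_cocone[OF tF]]
    show ?thesis
    proof (cases "z = n g")
      case False
      have nz: "n g \<in> underS (rr g) z" using n[OF gzF(1)] gzF(2) False by (auto simp: underS_def)
      have in_T: "(g, x) \<in> underS W t \<longleftrightarrow> x \<in> underS (rr g) z" for x
        using gzF by (auto simp: underS_def gz W_fst)
      have "limit_in (rr g) z"
        unfolding limit_in_def
      proof (intro conjI ballI)
        fix x assume "x \<in> underS (rr g) z"
        then obtain u where u: "u \<in> underS W t" "((g, x), u) \<in> W" "(g, x) \<noteq> u"
          using t in_T unfolding limit_in_def by blast
        then obtain y where "u = (g, y)"
          using wo_antisym[OF wr] by (cases u) (auto simp: underS_def gz W_iff)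
        then show "\<exists>y\<in>underS (rr g) z. (x, y) \<in> rr g \<and> x \<noteq> y"
          using u in_T by (auto simp: W_fst)
      qed (use gzF nz in auto)
      then have lim_z: "is_colimit (ordinal_cat (Restr (rr g) (underS (rr g) z))) C (Z g) (fob (Z g) z)
          (\<lambda>x. far (Z g) (x, z))"
        using Z[OF gzF(1)] by (simp add: transfinite_sequence_iff[OF wrr[OF gzF(1)]])
      have FR: "Field (Restr (rr g) (underS (rr g) z)) = underS (rr g) z"
        using wrr[OF gzF(1)] by (intro Field_Restr Order_Relation.underS_Field) (simp add: order_on_defs)
      show ?thesis
      proof (rule cofinal[where h = "Pair g" and X = "Z g" and R = "Restr (rr g) (underS (rr g) z)", unfolded FR])
        fix u assume u: "u \<in> underS W t"
        obtain b x where bx: "u = (b, x)" by (cases u)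
        show "\<exists>y\<in>underS (rr g) z. (u, (g, y)) \<in> W"
        proof (cases "b = g")
          case True
          then show ?thesis using u in_T bx W_refl[of u] T FW by auto
        next
          case False
          then show ?thesis
            using u bx nz n(1)[OF gzF(1)] by (intro bexI[of _ "n g"]) (auto simp: underS_def gz W_iff P)
        qed
      qed (use in_T lim_z gzF in \<open>auto simp: W_fst Y_fob Y_same gz\<close>)
    next
      case True
      have below: "(b, g) \<in> r \<and> b \<noteq> g \<and> x \<in> Field (rr b)" if "(b, x) \<in> underS W t" for b x
        using that True gzF n(2)[OF gzF(1)] wo_antisym[OF wrr[OF gzF(1)]]
        by (auto simp: underS_def gz W_iff P)
      have in_T: "(b, x) \<in> underS W t" if "(b, g) \<in> r" "b \<noteq> g" "x \<in> Field (rr b)" for b x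
        using W_lt[OF that gzF(2)] that by (simp add: underS_def gz)
      show ?thesis
      proof (rule wo_cases[OF wr gzF(1)])
        assume least: "\<And>a. a \<in> Field r \<Longrightarrow> (g, a) \<in> r"
        obtain b x where "(b, x) \<in> underS W t" using t by (auto simp: limit_in_def)
        then show ?thesis using below least wo_antisym[OF wr] by (blast dest: Field_left)
      next
        fix a assume a: "succ_in r a g"
        then have ag: "(a, g) \<in> r" "a \<noteq> g" by (auto simp: succ_in_def)
        note aF = Field_left[OF ag(1)]
        have sa: "s a = g"
          using succ_in_suc(2)[OF wr aF a] succ_in_suc(2)[OF wr aF s[OF aF]] by simp
        show ?thesis
        proof (rule cofinal[where h = "Pair a" and X = "Z a" and R = "rr a"])
          fix u assume u: "u \<in> underS W t"
          obtain b x where bx: "u = (b, x)" by (cases u)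
          have b: "(b, g) \<in> r" "b \<noteq> g" "x \<in> Field (rr b)" using below u bx by auto
          have ba: "(b, a) \<in> r" by (rule succ_between[OF wr a b(1,2)])
          show "\<exists>y\<in>Field (rr a). (u, (a, y)) \<in> W"
          proof (cases "b = a")
            case True
            then show ?thesis using b bx wo_refl[OF wrr[OF aF]] aF by (auto simp: W_fst)
          next
            case False
            then show ?thesis using W_lt[OF ba False b(3) n(1)[OF aF]] n(1)[OF aF] bx by blast
          qed
        next
          show "colim (rr a) (Z a) (fob Y t) (\<lambda>x. far Y ((a, x), t))"
            using Zco[OF aF] sa True gz Z_min[OF gzF(1)] Y_s[OF aF]
            by (auto simp: Y_fob intro: colimit_cong)
        qed (use in_T ag aF in \<open>auto simp: W_fst Y_fob Y_same\<close>)
      next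
        assume g: "limit_in r g"
        have FR: "Field (Restr r (underS r g)) = underS r g"
          using wr by (intro Field_Restr Order_Relation.underS_Field) (simp add: order_on_defs)
        have uF: "b \<in> Field r" if "b \<in> underS r g" for b using that by (auto simp: underS_def Field_def)
        show ?thesis
        proof (rule cofinal[where h = "\<lambda>b. (b, n b)" and X = X and R = "Restr r (underS r g)", unfolded FR])
          fix u assume u: "u \<in> underS W t"
          obtain b x where bx: "u = (b, x)" by (cases u)
          have b: "b \<in> underS r g" "x \<in> Field (rr b)" using below u bx by (auto simp: underS_def)
          then obtain b' where b': "b' \<in> underS r g" "(b, b') \<in> r" "b \<noteq> b'"
            using g by (auto simp: limit_in_def)
          then show "\<exists>y\<in>underS r g. (u, (y, n y)) \<in> W"
            using W_lt[OF b'(2,3) b(2) n(1)[OF uF[OF b'(1)]]] bx by blast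
        next
          show "colim (Restr r (underS r g)) X (fob Y t) (\<lambda>b. far Y ((b, n b), t))"
            by (rule colimit_cong[OF lim[OF g, unfolded Z_min[OF gzF(1)], folded Y_fob True, folded gz]])
              (use FR True gz Y_n in \<open>auto simp: underS_def\<close>)
        next
          fix b assume b: "b \<in> underS r g"
          then show "(b, n b) \<in> underS W t" using in_T n(1)[OF uF[OF b]] by (auto simp: underS_def)
          show "fob X b = fob Y (b, n b)" using Z_min[OF uF[OF b]] by (simp add: Y_fob)
          fix a assume a: "a \<in> underS r g"
          show "(b, a) \<in> Restr r (underS r g) \<longleftrightarrow> ((b, n b), (a, n a)) \<in> W"
            using W_n[OF uF[OF b] uF[OF a]] a b by simp
        qed (use Y_n in auto)
      qed
    qed
  qed
  have Y_step: "far Y (t, u) \<in> pushouts C I \<union> isos" if tu: "succ_in W t u" for t u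
  proof -
    obtain a x b y where [simp]: "t = (a, x)" "u = (b, y)" by (metis surj_pair)
    have tuW: "((a, x), (b, y)) \<in> W" "(a, x) \<noteq> (b, y)"
      and next_u: "\<And>v. (t, v) \<in> W \<Longrightarrow> v = t \<or> (u, v) \<in> W"
      using tu by (auto simp: succ_in_def)
    have F: "a \<in> Field r" "b \<in> Field r" "x \<in> Field (rr a)" "y \<in> Field (rr b)"
      using tuW by (auto simp: W_iff P)
    show ?thesis
    proof (cases "a = b")
      case True
      have "succ_in (rr a) x y"
        unfolding succ_in_def
      proof (intro conjI allI impI)
        fix z assume "(x, z) \<in> rr a"
        then show "z = x \<or> (y, z) \<in> rr a" using next_u[of "(a, z)"] F True by (simp add: W_fst)
      qed (use tuW True in \<open>auto simp: W_fst\<close>)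
      then have "far (Z a) (x, y) \<in> pushouts C I"
        using Zstep[OF F(1)] by (simp add: steps_in_iff[OF wrr[OF F(1)]])
      then show ?thesis using True by (simp add: Y_same)
    next
      case False
      then have ab: "(a, b) \<in> r" using tuW by (simp add: W_iff)
      have top: "(x', x) \<in> rr a" if x': "x' \<in> Field (rr a)" for x'
      proof (rule ccontr)
        assume "(x', x) \<notin> rr a"
        then have "(x, x') \<in> rr a" "x' \<noteq> x"
          using wo_total[OF wrr[OF F(1)] F(3) x'] wo_refl[OF wrr[OF F(1)] F(3)] by auto
        then have "(u, (a, x')) \<in> W" using next_u[of "(a, x')"] F by (simp add: W_fst)
        then show False using ab False wo_antisym[OF wr] by (auto simp: W_iff)
      qed
      have "(u, (s a, n (s a))) \<in> W"
        using next_u[OF W_s[OF F(1,3), folded \<open>t = (a, x)\<close>]] s[OF F(1)] by (auto simp: succ_in_def)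
      then have b: "b = s a" "(y, n b) \<in> rr b"
        using sb[OF ab False] wo_antisym[OF wr, of b "s a"] by (auto simp: W_iff)
      then have "y = n b" using wo_antisym[OF wrr[OF F(2)] b(2)] n(2)[OF F(2,4)] by simp
      then have "far Y (t, u) = \<kappa> a x" using b Y_s[OF F(1,3)] by simp
      then show ?thesis using colimit_greatest_iso[OF Zco[OF F(1)] Z'[OF F(1)] F(3) top] by simp
    qed
  qed
  \<comment> \<open>the next block absorbs \<open>Z a x\<close>, so that \<open>\<iota>\<close> extends to the sum\<close>
  define \<iota>' where "\<iota>' = (\<lambda>(a, x). \<iota> (s a) \<cdot> \<kappa> a x)"
  note \<iota> = colimit_cocone[OF co]
  have \<iota>'_alt: "\<iota>' t = \<iota> b \<cdot> far Y (t, (b, n b))" if t: "t \<in> P" "(t, (b, n b)) \<in> W" "fst t \<noteq> b" for t b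
  proof -
    obtain a x where [simp]: "t = (a, x)" by (cases t)
    have ab: "(a, b) \<in> r" "a \<noteq> b" using t by (auto simp: W_iff)
    note F = Field_left[OF ab(1)] Field_right[OF ab(1)]
    have X1: "far X (s a, b) \<in> Hom C (fob X (s a)) (fob X b)" using functor_Hom[OF X' sb[OF ab]] .
    have m: "\<kappa> a x \<in> Hom C (fob (Z a) x) (fob X (s a))" using h1 t by simp
    have "far Y (t, (b, n b)) = far X (s a, b) \<cdot> \<kappa> a x"
      using ab functor_Ident[OF Z'[OF F(2)] n(1)[OF F(2)]] Z_min[OF F(2)] Ident_comp[OF comp_in_Hom[OF m X1]]
      by (simp add: Y_diff)
    then show ?thesis
      using comp_reduce[OF cocone_comp[OF \<iota> sb[OF ab]] m X1 cocone_Hom[OF \<iota> F(2)]] by (simp add: \<iota>'_def)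
  qed
  have \<iota>'_n: "\<iota>' (b, n b) = \<iota> b" if "b \<in> Field r" for b
    using cocone_comp[OF \<iota> bs[OF that]] \<kappa>_min[OF that] by (simp add: \<iota>'_def)
  have "cocone W Y c \<iota>'"
    unfolding is_cocone_ordinal_cat FW
  proof (intro conjI ballI allI impI)
    show "c \<in> Obj C" by (rule cocone_Obj[OF \<iota>])
  next
    fix t assume "t \<in> P"
    then obtain a x where "t = (a, x)" "(a, x) \<in> P" by (cases t) auto
    then show "\<iota>' t \<in> Hom C (fob Y t) c"
      using h1 cocone_Hom[OF \<iota> sF] by (auto simp: \<iota>'_def Y_fob P)
  next
    fix t u assume tu: "(t, u) \<in> W"
    obtain b y where u: "u = (b, y)" by (cases u)
    have P': "t \<in> P" "u \<in> P" using tu by (auto simp: W_def)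
    let ?v = "(s b, n (s b))"
    have bF: "b \<in> Field r" "y \<in> Field (rr b)" using P' u by (simp_all add: P)
    have uv: "(u, ?v) \<in> W" using W_s[OF bF] u by simp
    have tv: "(t, ?v) \<in> W" by (rule wo_trans[OF WW tu uv])
    have ne: "b \<noteq> s b" using s[OF bF(1)] by (simp add: succ_in_def)
    moreover have "fst t \<noteq> s b"
      using tu u wo_antisym[OF wr bs[OF bF(1)]] ne by (cases t) (auto simp: W_iff)
    ultimately have "\<iota>' u = \<iota> (s b) \<cdot> far Y (u, ?v)" "\<iota>' t = \<iota> (s b) \<cdot> far Y (t, ?v)"
      using \<iota>'_alt P' uv tv u by simp_all
    moreover have "far Y (t, ?v) = far Y (u, ?v) \<cdot> far Y (t, u)" using functor_comp[OF Y tu uv] by simp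
    moreover have "\<iota> (s b) \<in> Hom C (fob Y ?v) c"
      using cocone_Hom[OF \<iota> sF[OF bF(1)]] Z_min[OF sF[OF bF(1)]] by (simp add: Y_fob)
    ultimately show "\<iota>' u \<cdot> far Y (t, u) = \<iota>' t"
      using comp_assoc[OF functor_Hom[OF Y tu] functor_Hom[OF Y uv]] by simp
  qed
  then have "cocone (Restr W P) Y c \<iota>'"
    using Restr_Field[of W] FW by simp
  note cofinal = colimit_along_cofinal[OF WW _ Y _ _ _ _ _ this]
  have "colim (Restr W P) Y c \<iota>'"
  proof (rule cofinal[where h = "\<lambda>b. (b, n b)" and X = X and R = r])
    show "colim r X c (\<lambda>b. \<iota>' (b, n b))"
      by (rule colimit_cong[OF co]) (simp_all add: \<iota>'_n)
    fix t assume "t \<in> P"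
    then show "\<exists>b\<in>Field r. (t, (b, n b)) \<in> W" using W_s sF by (cases t) (auto simp: P)
  qed (use n W_n Z_min Y_n FW in \<open>auto simp: P Y_fob\<close>)
  then have Y_co: "colim W Y c \<iota>'" using Restr_Field[of W] FW by simp
  let ?b = "wo_rel.minim r (Field r)"
  have b: "?b \<in> Field r" "\<And>a. a \<in> Field r \<Longrightarrow> (?b, a) \<in> r" using wo_minim[OF wr rne] by simp_all
  have "((?b, n ?b), t) \<in> W" if "t \<in> Field W" for t
    using that b n by (cases t) (auto simp: FW P W_iff)
  then have "\<iota>' (?b, n ?b) \<in> cell U C I"
    using b n Y Y_lim Y_step FW
    by (intro cell_absorbs_isos[OF U WW sW _ _ _ _ Y_co]) (auto simp: P transfinite_sequence_iff[OF WW])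
  then show ?thesis using \<iota>'_n[OF b(1)] by simp
qed

section \<open>Attachments are relative cell complexes\<close>

lemma attachment_empty:
  assumes "E \<in> Obj C"
  shows "attachment {} i u (Ident C E) v"
  using assms comp_Ident unfolding attachment_def by (auto simp: Ident_simps Hom_def)

lemma attachment_map:
  assumes at: "attachment A i u j v" and at': "attachment B i u j' v'"
    and AB: "A \<subseteq> B" and d: "Dom C j' = Dom C j"
  shows "\<exists>h. h \<in> Hom C (Cod C j) (Cod C j') \<and> h \<cdot> j = j' \<and> (\<forall>s\<in>A. h \<cdot> v s = v' s)"
proof -
  have "\<exists>!h. h \<in> Hom C (Cod C j) (Cod C j') \<and> h \<cdot> j = j' \<and> (\<forall>s\<in>A. h \<cdot> v s = v' s)"
  proof (rule attachment_ex1[OF at])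
    show "j' \<in> Hom C (Dom C j) (Cod C j')" using HomI[OF attachment_Arr[OF at']] d by simp
  qed (use AB attachmentD(2-5)[OF at'] in auto)
  then show ?thesis by blast
qed

lemma attachment_iso:
  assumes at: "attachment A i u j v" and at': "attachment A i u j' v'" and d: "Dom C j' = Dom C j"
    and h: "h \<in> Hom C (Cod C j) (Cod C j')" "h \<cdot> j = j'" "\<And>s. s \<in> A \<Longrightarrow> h \<cdot> v s = v' s"
  shows "h \<in> isos"
proof -
  note j = HomI[OF attachment_Arr[OF at]] and j' = HomI[OF attachment_Arr[OF at']]
  obtain k where k: "k \<in> Hom C (Cod C j') (Cod C j)" "k \<cdot> j' = j" "\<And>s. s \<in> A \<Longrightarrow> k \<cdot> v' s = v s"
    using attachment_map[OF at' at] d by auto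
  show ?thesis
  proof (rule isosI[OF h(1) k(1)])
    show "k \<cdot> h = Ident C (Cod C j)"
    proof (rule attachment_ext[OF at])
      show "k \<cdot> h \<in> Hom C (Cod C j) (Cod C j)" using h k by blast
      show "Ident C (Cod C j) \<in> Hom C (Cod C j) (Cod C j)" using HomD[OF j] by blast
      show "(k \<cdot> h) \<cdot> j = Ident C (Cod C j) \<cdot> j"
        using comp_assoc[OF j h(1) k(1)] h k Ident_comp[OF j] by simp
      show "(k \<cdot> h) \<cdot> v s = Ident C (Cod C j) \<cdot> v s" if "s \<in> A" for s
        using comp_assoc[OF attachmentD(4)[OF at that] h(1) k(1)] h(3) k(3) that
          Ident_comp[OF attachmentD(4)[OF at that]] by simp
    qed
    show "h \<cdot> k = Ident C (Cod C j')"
    proof (rule attachment_ext[OF at'])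
      show "h \<cdot> k \<in> Hom C (Cod C j') (Cod C j')" using h k by blast
      show "Ident C (Cod C j') \<in> Hom C (Cod C j') (Cod C j')" using HomD[OF j'] by blast
      show "(h \<cdot> k) \<cdot> j' = Ident C (Cod C j') \<cdot> j'"
        using comp_assoc[OF j' k(1) h(1)] h k Ident_comp[OF j'] by simp
      show "(h \<cdot> k) \<cdot> v' s = Ident C (Cod C j') \<cdot> v' s" if "s \<in> A" for s
        using comp_assoc[OF attachmentD(4)[OF at' that] k(1) h(1)] h(3) k(3) that
          Ident_comp[OF attachmentD(4)[OF at' that]] by simp
    qed
  qed
qed

lemma attachment_insert_pushout:
  assumes at: "attachment A i u j v" and at': "attachment (insert s A) i u j' v'"
    and s: "s \<notin> A" and d: "Dom C j' = Dom C j"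
    and h: "h \<in> Hom C (Cod C j) (Cod C j')" "h \<cdot> j = j'" "\<And>t. t \<in> A \<Longrightarrow> h \<cdot> v t = v' t"
  shows "is_pushout C (i s) (j \<cdot> u s) h (v' s)"
proof -
  note j = HomI[OF attachment_Arr[OF at]]
  have S: "i s \<in> Arr C" "u s \<in> Hom C (Dom C (i s)) (Dom C j)"
    "v' s \<in> Hom C (Cod C (i s)) (Cod C j')" "j' \<cdot> u s = v' s \<cdot> i s"
    using attachmentD(2-5)[OF at', of s] d by auto
  show ?thesis
    unfolding is_pushout_def
  proof (intro conjI ballI impI)
    have "h \<cdot> j \<cdot> u s = v' s \<cdot> i s"
      using comp_assoc[OF S(2) j h(1)] h(2) S(4) by simp
    then show "comm_square C (Square (i s) h (j \<cdot> u s) (v' s))"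
      using S h(1) j by (auto simp: comm_square_def Hom_def arr_simps)
    fix x y assume x: "x \<in> Arr C" and y: "y \<in> Arr C"
      and xy: "Dom C x = Cod C (j \<cdot> u s) \<and> Dom C y = Cod C (i s) \<and> Cod C x = Cod C y \<and>
        x \<cdot> j \<cdot> u s = y \<cdot> i s"
    let ?T = "Cod C x"
    have x': "x \<in> Hom C (Cod C j) ?T" using x xy j S by (simp add: Hom_def arr_simps)
    have y': "y \<in> Hom C (Cod C (i s)) ?T" using y xy by (simp add: Hom_def)
    have ex: "\<exists>!k. k \<in> Hom C (Cod C j') ?T \<and> k \<cdot> j' = x \<cdot> j \<and>
        (\<forall>t\<in>insert s A. k \<cdot> v' t = (if t = s then y else x \<cdot> v t))"
    proof (rule attachment_ex1[OF at'])
      show "x \<cdot> j \<in> Hom C (Dom C j') ?T" using x' j d by auto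
      fix t assume t: "t \<in> insert s A"
      show "(if t = s then y else x \<cdot> v t) \<in> Hom C (Cod C (i t)) ?T"
        using t y' x' attachmentD(4)[OF at, of t] by auto
      show "(x \<cdot> j) \<cdot> u t = (if t = s then y else x \<cdot> v t) \<cdot> i t"
      proof (cases "t = s")
        case True
        then show ?thesis using comp_assoc[OF S(2) j x'] xy by simp
      next
        case False
        then have "t \<in> A" using t by simp
        note T = attachmentD(2-5)[OF at this]
        show ?thesis
          using comp_assoc[OF T(2) j x'] comp_assoc[OF HomI[OF T(1)] T(3) x'] T(4) False by simp
      qed
    qed
    have "(k \<cdot> j' = x \<cdot> j \<and> (\<forall>t\<in>insert s A. k \<cdot> v' t = (if t = s then y else x \<cdot> v t))) \<longleftrightarrow>
        (k \<cdot> h = x \<and> k \<cdot> v' s = y)" if k: "k \<in> Hom C (Cod C j') ?T" for k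
    proof -
      have kh: "k \<cdot> h \<in> Hom C (Cod C j) ?T" using h(1) k by blast
      have kj: "(k \<cdot> h) \<cdot> j = k \<cdot> j'" using comp_assoc[OF j h(1) k] h(2) by simp
      have kv: "(k \<cdot> h) \<cdot> v t = k \<cdot> v' t" if "t \<in> A" for t
        using comp_assoc[OF attachmentD(4)[OF at that] h(1) k] h(3)[OF that] by simp
      show ?thesis
      proof
        assume L: "k \<cdot> j' = x \<cdot> j \<and> (\<forall>t\<in>insert s A. k \<cdot> v' t = (if t = s then y else x \<cdot> v t))"
        have "k \<cdot> h = x"
          by (rule attachment_ext[OF at kh x']) (use L kj kv s in auto)
        then show "k \<cdot> h = x \<and> k \<cdot> v' s = y" using L by simp
      qed (use kj kv s in auto)
    qed
    then have eq: "k \<in> Hom C (Cod C j') ?T \<and> k \<cdot> j' = x \<cdot> j \<and>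
        (\<forall>t\<in>insert s A. k \<cdot> v' t = (if t = s then y else x \<cdot> v t)) \<longleftrightarrow>
      k \<in> Hom C (Cod C h) ?T \<and> k \<cdot> h = x \<and> k \<cdot> v' s = y" for k
      using HomD(3)[OF h(1)] by metis
    show "\<exists>!k. k \<in> Hom C (Cod C h) ?T \<and> k \<cdot> h = x \<and> k \<cdot> v' s = y"
      using ex unfolding eq .
  qed
qed

text \<open>
  Attaching the union of a chain of families is the colimit of attaching its members: both sides represent
  the maps out of \<open>E\<close> together with compatible maps out of all attached codomains.
\<close>
lemma attachment_chain_colimit:
  assumes R: "Field R \<noteq> {}" "\<And>a b. a \<in> Field R \<Longrightarrow> b \<in> Field R \<Longrightarrow> (a, b) \<in> R \<or> (b, a) \<in> R"
    and at: "\<And>b. b \<in> Field R \<Longrightarrow> attachment (A b) i u (j b) (v b)"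
      "\<And>b. b \<in> Field R \<Longrightarrow> Dom C (j b) = Dom C j'"
    and mono: "\<And>a b. (a, b) \<in> R \<Longrightarrow> A a \<subseteq> A b"
    and X: "\<And>b. b \<in> Field R \<Longrightarrow> fob X b = Cod C (j b)" "diagram R X"
      "\<And>a b. (a, b) \<in> R \<Longrightarrow> far X (a, b) \<cdot> j a = j b"
      "\<And>a b s. (a, b) \<in> R \<Longrightarrow> s \<in> A a \<Longrightarrow> far X (a, b) \<cdot> v a s = v b s"
    and at': "attachment (\<Union>b\<in>Field R. A b) i u j' v'"
    and \<iota>: "\<And>b. b \<in> Field R \<Longrightarrow> \<iota> b \<in> Hom C (Cod C (j b)) (Cod C j')"
      "\<And>b. b \<in> Field R \<Longrightarrow> \<iota> b \<cdot> j b = j'"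
      "\<And>b s. b \<in> Field R \<Longrightarrow> s \<in> A b \<Longrightarrow> \<iota> b \<cdot> v b s = v' s"
  shows "colim R X (Cod C j') \<iota>"
proof -
  have jH: "j b \<in> Hom C (Dom C j') (Cod C (j b))" if "b \<in> Field R" for b
    using HomI[OF attachment_Arr[OF at(1)[OF that]]] at(2)[OF that] by simp
  have j'H: "j' \<in> Hom C (Dom C j') (Cod C j')" by (rule HomI[OF attachment_Arr[OF at']])
  have vH: "v b s \<in> Hom C (Cod C (i s)) (Cod C (j b))" if "b \<in> Field R" "s \<in> A b" for b s
    by (rule attachmentD(4)[OF at(1)[OF that(1)] that(2)])
  have XH: "far X (a, b) \<in> Hom C (Cod C (j a)) (Cod C (j b))" if "(a, b) \<in> R" for a b
    using functor_Hom[OF X(2) that] X(1) Field_left[OF that] Field_right[OF that] by simp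
  have co: "cocone R X (Cod C j') \<iota>"
    unfolding is_cocone_ordinal_cat
  proof (intro conjI ballI allI impI)
    show "Cod C j' \<in> Obj C" using HomD[OF j'H] by simp
    show "\<iota> b \<in> Hom C (fob X b) (Cod C j')" if "b \<in> Field R" for b using \<iota>(1) X(1) that by simp
    fix a b assume ab: "(a, b) \<in> R"
    note F = Field_left[OF ab] Field_right[OF ab]
    show "\<iota> b \<cdot> far X (a, b) = \<iota> a"
    proof (rule attachment_ext[OF at(1)[OF F(1)] _ \<iota>(1)[OF F(1)]])
      show "\<iota> b \<cdot> far X (a, b) \<in> Hom C (Cod C (j a)) (Cod C j')" using XH[OF ab] \<iota>(1)[OF F(2)] by blast
      show "(\<iota> b \<cdot> far X (a, b)) \<cdot> j a = \<iota> a \<cdot> j a"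
        using comp_assoc[OF jH[OF F(1)] XH[OF ab] \<iota>(1)[OF F(2)]] X(3)[OF ab] \<iota>(2) F by simp
      show "(\<iota> b \<cdot> far X (a, b)) \<cdot> v a s = \<iota> a \<cdot> v a s" if s: "s \<in> A a" for s
        using comp_assoc[OF vH[OF F(1) s] XH[OF ab] \<iota>(1)[OF F(2)]] X(4)[OF ab s] \<iota>(3) F s mono[OF ab]
        by auto
    qed
  qed
  show ?thesis
    unfolding is_colimit_ordinal_cat
  proof (intro conjI allI impI co)
    fix d \<tau> assume \<tau>: "cocone R X d \<tau>"
    have \<tau>H: "\<tau> b \<in> Hom C (Cod C (j b)) d" if "b \<in> Field R" for b
      using cocone_Hom[OF \<tau> that] X(1)[OF that] by simp
    obtain b0 where b0: "b0 \<in> Field R" using R(1) by blast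
    have step: "\<tau> a \<cdot> j a = \<tau> b \<cdot> j b" "\<And>s. s \<in> A a \<Longrightarrow> \<tau> a \<cdot> v a s = \<tau> b \<cdot> v b s" if ab: "(a, b) \<in> R" for a b
      using comp_assoc[OF jH XH[OF ab] \<tau>H] comp_assoc[OF vH XH[OF ab] \<tau>H] X(3,4)[OF ab]
        cocone_comp[OF \<tau> ab] Field_left[OF ab] Field_right[OF ab] by metis+
    define x where "x = \<tau> b0 \<cdot> j b0"
    have x: "\<tau> b \<cdot> j b = x" if "b \<in> Field R" for b
      using R(2)[OF that b0] step(1)[of b b0] step(1)[of b0 b] by (auto simp: x_def)
    have "\<exists>y. \<forall>b\<in>Field R. s \<in> A b \<longrightarrow> \<tau> b \<cdot> v b s = y" for s
    proof (cases "\<exists>a\<in>Field R. s \<in> A a")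
      case True
      then obtain a where a: "a \<in> Field R" "s \<in> A a" by blast
      have "\<tau> b \<cdot> v b s = \<tau> a \<cdot> v a s" if "b \<in> Field R" "s \<in> A b" for b
        using R(2)[OF a(1) that(1)] step(2)[of a b s] step(2)[of b a s] a that by auto
      then show ?thesis by blast
    qed blast
    then obtain y where y: "\<And>b s. b \<in> Field R \<Longrightarrow> s \<in> A b \<Longrightarrow> \<tau> b \<cdot> v b s = y s" by metis
    have ex: "\<exists>!h. h \<in> Hom C (Cod C j') d \<and> h \<cdot> j' = x \<and> (\<forall>s\<in>\<Union>b\<in>Field R. A b. h \<cdot> v' s = y s)"
    proof (rule attachment_ex1[OF at'])
      show "x \<in> Hom C (Dom C j') d" unfolding x_def using jH[OF b0] \<tau>H[OF b0] by blast
      fix s assume "s \<in> (\<Union>b\<in>Field R. A b)"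
      then obtain b where b: "b \<in> Field R" "s \<in> A b" by blast
      note S = attachmentD(2-5)[OF at(1)[OF b(1)] b(2)]
      show "y s \<in> Hom C (Cod C (i s)) d" using y[OF b] comp_in_Hom[OF vH[OF b] \<tau>H[OF b(1)]] by simp
      have "u s \<in> Hom C (Dom C (i s)) (Dom C j')" using S(2) at(2)[OF b(1)] by simp
      then show "x \<cdot> u s = y s \<cdot> i s"
        using comp_assoc[OF _ jH[OF b(1)] \<tau>H[OF b(1)]] comp_assoc[OF HomI[OF S(1)] vH[OF b] \<tau>H[OF b(1)]]
          S(4) x[OF b(1)] y[OF b] by metis
    qed
    have "(h \<cdot> j' = x \<and> (\<forall>s\<in>\<Union>b\<in>Field R. A b. h \<cdot> v' s = y s)) \<longleftrightarrow> (\<forall>b\<in>Field R. h \<cdot> \<iota> b = \<tau> b)"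
      if h: "h \<in> Hom C (Cod C j') d" for h
    proof -
      have hj: "(h \<cdot> \<iota> b) \<cdot> j b = h \<cdot> j'" if "b \<in> Field R" for b
        using comp_assoc[OF jH[OF that] \<iota>(1)[OF that] h] \<iota>(2)[OF that] by simp
      have hv: "(h \<cdot> \<iota> b) \<cdot> v b s = h \<cdot> v' s" if "b \<in> Field R" "s \<in> A b" for b s
        using comp_assoc[OF vH[OF that] \<iota>(1)[OF that(1)] h] \<iota>(3)[OF that] by simp
      show ?thesis
      proof (intro iffI ballI)
        fix b assume L: "h \<cdot> j' = x \<and> (\<forall>s\<in>\<Union>b\<in>Field R. A b. h \<cdot> v' s = y s)" and b: "b \<in> Field R"
        show "h \<cdot> \<iota> b = \<tau> b"
          by (rule attachment_ext[OF at(1)[OF b] comp_in_Hom[OF \<iota>(1)[OF b] h] \<tau>H[OF b]])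
            (use L hj hv x y b in auto)
      next
        assume L: "\<forall>b\<in>Field R. h \<cdot> \<iota> b = \<tau> b"
        have "h \<cdot> v' s = y s" if "b \<in> Field R" "s \<in> A b" for b s using hv[OF that] L y[OF that] that by simp
        moreover have "h \<cdot> j' = x" using hj[OF b0] L x[OF b0] b0 by simp
        ultimately show "h \<cdot> j' = x \<and> (\<forall>s\<in>\<Union>b\<in>Field R. A b. h \<cdot> v' s = y s)" by blast
      qed
    qed
    then have eq: "h \<in> Hom C (Cod C j') d \<and> h \<cdot> j' = x \<and> (\<forall>s\<in>\<Union>b\<in>Field R. A b. h \<cdot> v' s = y s) \<longleftrightarrow>
        h \<in> Hom C (Cod C j') d \<and> (\<forall>b\<in>Field R. h \<cdot> \<iota> b = \<tau> b)" for h by blast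
    show "\<exists>!h. h \<in> Hom C (Cod C j') d \<and> (\<forall>b\<in>Field R. h \<cdot> \<iota> b = \<tau> b)"
      using ex unfolding eq .
  qed
qed

end

text \<open>
  Adding \<open>nat\<close> makes the set infinite, so that its cardinal is a limit ordinal also when \<open>A\<close> is finite.
\<close>
lemma limit_ordinal_above:
  fixes U :: "'u rel"
  assumes U: "universe U" and A: "small U A"
  obtains r :: "'u rel" and \<nu> where "small_ordinal U r" "limit_ordinal r" "inj_on \<nu> A" "\<nu> ` A \<subseteq> Field r"
proof -
  let ?B = "A <+> (UNIV :: nat set)"
  have B: "small U ?B" by (intro small_Plus U A small_countable)
  have inf: "infinite ?B" by simp
  obtain r :: "'u rel" and g where r: "small_ordinal U r" and g: "bij_betw g (Field r) ?B"
    and rg: "\<And>a b. a \<in> Field r \<Longrightarrow> b \<in> Field r \<Longrightarrow> (a, b) \<in> r \<longleftrightarrow> (g a, g b) \<in> |?B|"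
    using well_order_copy[OF U card_of_Well_order[of ?B]] B by (metis Field_card_of)
  have "limit_ordinal r"
    unfolding limit_ordinal_def
  proof (intro conjI ballI)
    show "Field r \<noteq> {}" using g inf by (auto simp: bij_betw_def)
    fix a assume a: "a \<in> Field r"
    then have "g a \<in> Field |?B|" using bij_betwE[OF g] by (simp add: Field_card_of)
    then obtain c where "c \<in> ?B" "g a \<noteq> c" "(g a, c) \<in> |?B|"
      using infinite_Card_order_limit[OF card_of_Card_order, of ?B "g a"] inf by (auto simp: Field_card_of)
    moreover then obtain b where "b \<in> Field r" "c = g b" using g by (auto simp: bij_betw_def)
    ultimately have "b \<in> aboveS r a" using rg a by (auto simp: aboveS_def)
    then show "aboveS r a \<noteq> {}" by blast
  qed
  moreover have "inj_on (\<lambda>s. inv_into (Field r) g (Inl s)) A"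
    using g by (intro inj_onI) (auto simp: bij_betw_def dest: inv_into_injective)
  moreover have "(\<lambda>s. inv_into (Field r) g (Inl s)) ` A \<subseteq> Field r"
    using g by (auto simp: bij_betw_def intro: inv_into_into)
  ultimately show thesis using that r by blast
qed

context small_cocomplete
begin

text \<open>
  Number the family injectively by elements of a limit ordinal \<open>r\<close>, and let stage \<open>b\<close> attach the members with
  number below \<open>b\<close>. The step from \<open>b\<close> attaches the member with number \<open>b\<close> if there is one and is an
  isomorphism otherwise. With \<open>r\<close> a limit, the union of the stages is the whole family.
\<close>
theorem attachment_in_cell:
  assumes A: "small U A" and at: "attachment A i u j v" and I: "\<And>s. s \<in> A \<Longrightarrow> i s \<in> I"
  shows "j \<in> cell U C I"
proof -
  let ?E = "Dom C j"
  note jH = HomI[OF attachment_Arr[OF at]]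
  obtain r :: "'u rel" and \<nu> where r: "small_ordinal U r" "limit_ordinal r" and \<nu>: "inj_on \<nu> A" "\<nu> ` A \<subseteq> Field r"
    by (rule limit_ordinal_above[OF universe A])
  have wr: "Well_order r" and sr: "small U (Field r)" using r(1) by (simp_all add: small_ordinal_def)
  have rne: "Field r \<noteq> {}" and above: "\<And>b. b \<in> Field r \<Longrightarrow> aboveS r b \<noteq> {}"
    using r(2) by (auto simp: limit_ordinal_def)
  define A' where "A' b = {s \<in> A. \<nu> s \<in> underS r b}" for b
  have A'_mono: "A' a \<subseteq> A' b" if "(a, b) \<in> r" for a b
    using wo_trans[OF wr _ that] wo_antisym[OF wr that] unfolding A'_def underS_def by blast
  have A'_A: "A' b \<subseteq> A" for b by (auto simp: A'_def)
  \<comment> \<open>the identity is chosen for the empty family, so that the sequence starts with \<open>dom j\<close> itself\<close>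
  have "\<exists>j' v'. attachment (A' b) i u j' v' \<and> Dom C j' = ?E \<and> (A' b = {} \<longrightarrow> j' = Ident C ?E)" for b
  proof (cases "A' b = {}")
    case True
    then show ?thesis using attachment_empty[of ?E] HomD[OF jH] Ident_simps(4)[of ?E] by metis
  next
    case False
    have "small U (A' b)" by (rule small_subset[OF A A'_A])
    moreover have "i s \<in> Arr C" "u s \<in> Hom C (Dom C (i s)) ?E" if "s \<in> A' b" for s
      using attachmentD(2-5)[OF at, of s] that A'_A by auto
    ultimately show ?thesis using attachment_exists[of "A' b" ?E i u] HomD[OF jH] False by metis
  qed
  then obtain j' v' where at': "\<And>b. attachment (A' b) i u (j' b) (v' b)"
    and d: "\<And>b. Dom C (j' b) = ?E" and j'_empty: "\<And>b. A' b = {} \<Longrightarrow> j' b = Ident C ?E"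
    by metis
  have j'H: "j' b \<in> Hom C ?E (Cod C (j' b))" for b
    using HomI[OF attachment_Arr[OF at'[of b]]] d by simp
  have v'H: "v' b s \<in> Hom C (Cod C (i s)) (Cod C (j' b))" if "s \<in> A' b" for b s
    by (rule attachmentD(4)[OF at' that])
  have "\<exists>h. \<forall>a b. (a, b) \<in> r \<longrightarrow> h a b \<in> Hom C (Cod C (j' a)) (Cod C (j' b)) \<and> h a b \<cdot> j' a = j' b \<and>
      (\<forall>s\<in>A' a. h a b \<cdot> v' a s = v' b s)"
    using attachment_map[OF at' at' A'_mono] d by metis
  then obtain h where h: "\<And>a b. (a, b) \<in> r \<Longrightarrow> h a b \<in> Hom C (Cod C (j' a)) (Cod C (j' b))"
    "\<And>a b. (a, b) \<in> r \<Longrightarrow> h a b \<cdot> j' a = j' b"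
    "\<And>a b s. (a, b) \<in> r \<Longrightarrow> s \<in> A' a \<Longrightarrow> h a b \<cdot> v' a s = v' b s" by metis
  define X where "X = \<lparr>fob = (\<lambda>b. Cod C (j' b)), far = (\<lambda>(a, b). h a b)\<rparr>"
  have X: "diagram r X"
    unfolding is_functor_ordinal_cat X_def
  proof (simp, intro conjI ballI allI impI)
    fix b assume b: "b \<in> Field r"
    show bO: "Cod C (j' b) \<in> Obj C" using HomD[OF j'H] by simp
    have bb: "(b, b) \<in> r" by (rule wo_refl[OF wr b])
    show "h b b = Ident C (Cod C (j' b))"
      by (rule attachment_ext[OF at' h(1)[OF bb] Ident_in_Hom[OF bO]])
        (use h(2,3)[OF bb] Ident_comp[OF j'H] Ident_comp[OF v'H] in simp_all)
  next
    fix a b c assume ab: "(a, b) \<in> r" and bc: "(b, c) \<in> r"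
    have ac: "(a, c) \<in> r" by (rule wo_trans[OF wr ab bc])
    show "h a c = h b c \<cdot> h a b"
    proof (rule attachment_ext[OF at' h(1)[OF ac] comp_in_Hom[OF h(1)[OF ab] h(1)[OF bc]]])
      show "h a c \<cdot> j' a = (h b c \<cdot> h a b) \<cdot> j' a"
        using comp_assoc[OF j'H h(1)[OF ab] h(1)[OF bc]] h(2) ab bc ac by simp
      show "h a c \<cdot> v' a s = (h b c \<cdot> h a b) \<cdot> v' a s" if s: "s \<in> A' a" for s
        using comp_assoc[OF v'H[OF s] h(1)[OF ab] h(1)[OF bc]] h(3) ab bc ac s A'_mono[OF ab] by auto
    qed
  qed (use h in auto)
  have total: "(a, b) \<in> r \<or> (b, a) \<in> r" if "a \<in> Field r" "b \<in> Field r" for a b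
    by (rule wo_total[OF wr that])
  have X_lim: "colim (Restr r (underS r g)) X (fob X g) (\<lambda>b. far X (b, g))"
    if g: "limit_in r g" for g
  proof -
    let ?R = "Restr r (underS r g)"
    have FR: "Field ?R = underS r g"
      using wr by (intro Field_Restr Order_Relation.underS_Field) (simp add: order_on_defs)
    have un: "(\<Union>b\<in>underS r g. A' b) = A' g"
    proof
      show "(\<Union>b\<in>underS r g. A' b) \<subseteq> A' g" using A'_mono by (auto simp: underS_def)
      show "A' g \<subseteq> (\<Union>b\<in>underS r g. A' b)"
      proof
        fix s assume s: "s \<in> A' g"
        then obtain b where "b \<in> underS r g" "(\<nu> s, b) \<in> r" "\<nu> s \<noteq> b"
          using g unfolding limit_in_def A'_def by blast
        then show "s \<in> (\<Union>b\<in>underS r g. A' b)" using s by (auto simp: A'_def underS_def)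
      qed
    qed
    have "colim ?R X (Cod C (j' g)) (\<lambda>b. far X (b, g))"
    proof (rule attachment_chain_colimit[where A = A' and v = v', OF _ _ at' _ A'_mono])
      show "diagram ?R X" by (rule functor_subset[OF X]) simp
      show "attachment (\<Union>b\<in>Field ?R. A' b) i u (j' g) (v' g)" unfolding FR un by (rule at')
      show "Field ?R \<noteq> {}" using g FR by (simp add: limit_in_def)
      show "(a, b) \<in> ?R \<or> (b, a) \<in> ?R" if "a \<in> Field ?R" "b \<in> Field ?R" for a b
        using that total[of a b] FR Order_Relation.underS_Field[of r g] by auto
    qed (use d h FR in \<open>auto simp: X_def underS_def\<close>)
    then show ?thesis by (simp add: X_def)
  qed
  have X_step: "far X (a, b) \<in> pushouts C I \<union> isos" if ab: "succ_in r a b" for a b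
  proof -
    have ab': "(a, b) \<in> r" "a \<noteq> b" using ab by (auto simp: succ_in_def)
    have A'_b: "s \<in> A' b \<longleftrightarrow> s \<in> A' a \<or> (s \<in> A \<and> \<nu> s = a)" for s
      using A'_mono[OF ab'(1)] ab' succ_between[OF wr ab, of "\<nu> s"] by (auto simp: A'_def underS_def)
    show ?thesis
    proof (cases "\<exists>s\<in>A. \<nu> s = a")
      case True
      then obtain s where s: "s \<in> A" "\<nu> s = a" by blast
      have "A' b = insert s (A' a)"
        using A'_b s \<nu>(1) by (auto simp: inj_on_def)
      then have "is_pushout C (i s) (j' a \<cdot> u s) (h a b) (v' b s)"
        using at'[of b] d h ab'(1) s
        by (intro attachment_insert_pushout[OF at'[of a]]) (auto simp: A'_def underS_def)
      then show ?thesis using I[OF s(1)] by (auto simp: X_def pushouts_def)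
    next
      case False
      then have "A' b = A' a" using A'_b by auto
      then have "h a b \<in> isos"
        using at'[of b] d h ab'(1) by (intro attachment_iso[OF at'[of a], of "j' b" "v' b"]) auto
      then show ?thesis by (simp add: X_def)
    qed
  qed
  have "\<exists>\<iota>. \<forall>b. \<iota> b \<in> Hom C (Cod C (j' b)) (Cod C j) \<and> \<iota> b \<cdot> j' b = j \<and> (\<forall>s\<in>A' b. \<iota> b \<cdot> v' b s = v s)"
    using attachment_map[OF at' at A'_A] d by metis
  then obtain \<iota> where \<iota>: "\<And>b. \<iota> b \<in> Hom C (Cod C (j' b)) (Cod C j)" "\<And>b. \<iota> b \<cdot> j' b = j"
    "\<And>b s. s \<in> A' b \<Longrightarrow> \<iota> b \<cdot> v' b s = v s" by metis
  have un: "(\<Union>b\<in>Field r. A' b) = A"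
  proof
    show "A \<subseteq> (\<Union>b\<in>Field r. A' b)"
    proof
      fix s assume s: "s \<in> A"
      then obtain b where "b \<in> aboveS r (\<nu> s)" using above \<nu>(2) by blast
      then have "(\<nu> s, b) \<in> r" "s \<in> A' b" using s by (auto simp: A'_def underS_def aboveS_def)
      then show "s \<in> (\<Union>b\<in>Field r. A' b)" by (auto dest: Field_right)
    qed
  qed (use A'_A in auto)
  have X_co: "colim r X (Cod C j) \<iota>"
    by (rule attachment_chain_colimit[where A = A' and v = v' and v' = v, OF rne total at' d A'_mono _ X _ _ _ \<iota>])
      (use h at un in \<open>auto simp: X_def\<close>)
  let ?m = "wo_rel.minim r (Field r)"
  have m: "?m \<in> Field r" "\<And>a. a \<in> Field r \<Longrightarrow> (?m, a) \<in> r" using wo_minim[OF wr rne] by simp_all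
  have "A' ?m = {}"
    using m wo_antisym[OF wr] unfolding A'_def underS_def by (blast dest: Field_left)
  then have "\<iota> ?m = j" using \<iota>(2)[of ?m] j'_empty[of ?m] comp_Ident \<iota>(1)[of ?m] HomD(5)[OF j'H[of ?m]] HomD(4)[OF jH] Ident_simps(5) by metis
  moreover have "transfinite_sequence C r X" using X X_lim by (simp add: transfinite_sequence_iff[OF wr])
  then have "\<iota> ?m \<in> cell U C I"
    using cell_absorbs_isos[OF universe wr sr m _ X_step X_co] by blast
  ultimately show ?thesis by simp
qed

end

context cat
begin

section \<open>Transfinite iteration\<close>

text \<open>
  The stage at \<open>x\<close> is an object together with the maps from all earlier stages into it, chosen by well-founded
  recursion. What is demanded of the cocone at a limit is left open as \<open>Good\<close>, because the iteration
  below takes place in a category of functors but needs colimits in \<open>C\<close>, one for each map of \<open>C\<close>.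
\<close>

lemma transfinite_iteration:
  fixes r :: "'u rel"
  assumes r: "Well_order r" and K0: "K0 \<in> Obj C"
    and t: "\<And>K. K \<in> Obj C \<Longrightarrow> t K \<in> Arr C" "\<And>K. K \<in> Obj C \<Longrightarrow> Dom C (t K) = K"
    and Good_cong: "\<And>g X Y c \<iota> \<kappa>. Good g X c \<iota> \<Longrightarrow> (\<And>b. b \<in> underS r g \<Longrightarrow> fob X b = fob Y b) \<Longrightarrow>
      (\<And>a b. (a, b) \<in> r \<Longrightarrow> b \<in> underS r g \<Longrightarrow> far X (a, b) = far Y (a, b)) \<Longrightarrow>
      (\<And>b. b \<in> underS r g \<Longrightarrow> \<iota> b = \<kappa> b) \<Longrightarrow> Good g Y c \<kappa>"
    and lim: "\<And>g X. limit_in r g \<Longrightarrow> diagram (Restr r (underS r g)) X \<Longrightarrow>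
      \<exists>c \<iota>. cocone (Restr r (underS r g)) X c \<iota> \<and> Good g X c \<iota>"
  obtains X where "diagram r X"
    "\<And>m. m \<in> Field r \<Longrightarrow> (\<And>a. a \<in> Field r \<Longrightarrow> (m, a) \<in> r) \<Longrightarrow> fob X m = K0"
    "\<And>a b. succ_in r a b \<Longrightarrow> far X (a, b) = t (fob X a)"
    "\<And>g. limit_in r g \<Longrightarrow> Good g X (fob X g) (\<lambda>b. far X (b, g))"
proof -
  \<comment> \<open>the component \<open>fst (f b)\<close> is stage \<open>b\<close>, and \<open>snd (f b) a\<close> is the map to it from stage \<open>a\<close>\<close>
  define mk where "mk f = \<lparr>fob = (\<lambda>b. fst (f b)), far = (\<lambda>(a, b). snd (f b) a)\<rparr>"
    for f :: "'u \<Rightarrow> 'o \<times> ('u \<Rightarrow> 'm)"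
  define P where "P f x ca \<longleftrightarrow> (x \<in> Field r \<longrightarrow> fst ca \<in> Obj C \<and> snd ca x = Ident C (fst ca) \<and>
    (\<forall>a\<in>underS r x. snd ca a \<in> Hom C (fst (f a)) (fst ca)) \<and>
    (\<forall>a b. b \<in> underS r x \<longrightarrow> (a, b) \<in> r \<longrightarrow> snd ca b \<cdot> snd (f b) a = snd ca a) \<and>
    ((\<forall>b\<in>Field r. (x, b) \<in> r) \<longrightarrow> fst ca = K0) \<and>
    (\<forall>a. succ_in r a x \<longrightarrow> snd ca a = t (fst (f a))) \<and>
    (limit_in r x \<longrightarrow> Good x (mk f) (fst ca) (snd ca)))"
    for f :: "'u \<Rightarrow> 'o \<times> ('u \<Rightarrow> 'm)" and x ca
  have PD: "fst ca \<in> Obj C" "snd ca x = Ident C (fst ca)"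
      "\<And>a. a \<in> underS r x \<Longrightarrow> snd ca a \<in> Hom C (fst (f a)) (fst ca)"
      "\<And>a b. b \<in> underS r x \<Longrightarrow> (a, b) \<in> r \<Longrightarrow> snd ca b \<cdot> snd (f b) a = snd ca a"
      "(\<And>b. b \<in> Field r \<Longrightarrow> (x, b) \<in> r) \<Longrightarrow> fst ca = K0"
      "\<And>a. succ_in r a x \<Longrightarrow> snd ca a = t (fst (f a))"
      "limit_in r x \<Longrightarrow> Good x (mk f) (fst ca) (snd ca)"
    if "P f x ca" "x \<in> Field r" for f x ca
    using that unfolding P_def by blast+
  have uF: "b \<in> Field r" if "b \<in> underS r x" for b x using that by (auto simp: underS_def Field_def)
  have refl: "(a, a) \<in> r" if "a \<in> Field r" for a by (rule wo_refl[OF r that])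
  have u_down: "a \<in> underS r x" if "(a, b) \<in> r" "b \<in> underS r x" for a b x
    using that wo_trans[OF r that(1), of x] wo_antisym[OF r, of x b] by (auto simp: underS_def)
  have "wf (r - Id)" using r by (simp add: well_order_on_def)
  then have "\<exists>f. \<forall>x. P f x (f x)"
  proof (rule dependent_wf_choice)
    fix f g x ca assume "\<And>z. (z, x) \<in> r - Id \<Longrightarrow> f z = (g z :: 'o \<times> ('u \<Rightarrow> 'm))"
    then have eq: "f z = g z" if "z \<in> underS r x" for z using that by (auto simp: underS_def)
    have "Good x (mk f) (fst ca) (snd ca) \<longleftrightarrow> Good x (mk g) (fst ca) (snd ca)"
      using Good_cong[of x "mk f" "fst ca" "snd ca" "mk g" "snd ca"]
        Good_cong[of x "mk g" "fst ca" "snd ca" "mk f" "snd ca"] eq by (auto simp: mk_def)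
    moreover have "a \<in> underS r x" if "succ_in r a x" for a
      using that by (auto simp: succ_in_def underS_def)
    ultimately show "P f x ca = P g x ca" using eq unfolding P_def by (simp cong: conj_cong imp_cong)
  next
    fix x f assume "\<And>y. (y, x) \<in> r - Id \<Longrightarrow> P f y (f y)"
    then have IH: "P f y (f y)" if "y \<in> underS r x" for y using that by (auto simp: underS_def)
    show "\<exists>ca. P f x ca"
    proof (cases "x \<in> Field r")
      case x: True
      show ?thesis
      proof (rule wo_cases[OF r x])
        assume least: "\<And>a. a \<in> Field r \<Longrightarrow> (x, a) \<in> r"
        have u: "underS r x = {}" using least wo_antisym[OF r] by (auto simp: underS_def dest: Field_left)
        moreover have "\<not> succ_in r a x" for a using u by (auto simp: succ_in_def underS_def)
        moreover have "\<not> limit_in r x" using u by (simp add: limit_in_def)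
        ultimately show ?thesis
          using K0 unfolding P_def by (intro exI[of _ "(K0, \<lambda>_. Ident C K0)"]) simp
      next
        fix d assume d: "succ_in r d x"
        then have dx: "(d, x) \<in> r" "d \<noteq> x" and du: "d \<in> underS r x" by (auto simp: succ_in_def underS_def)
        note D = PD[OF IH[OF du] uF[OF du]]
        let ?K = "fst (f d)"
        let ?c = "Cod C (t ?K)"
        let ?a = "\<lambda>b. if b = x then Ident C ?c else t ?K \<cdot> snd (f d) b"
        have tH: "t ?K \<in> Hom C ?K ?c" using t[OF D(1)] by (simp add: Hom_def)
        have below: "b = d \<or> b \<in> underS r d" if "b \<in> underS r x" for b
          using succ_between[OF r d, of b] that by (auto simp: underS_def)
        have fd: "snd (f d) b \<in> Hom C (fst (f b)) ?K" if "b \<in> underS r x" for b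
          using below[OF that] D(1,2) D(3)[of b] by auto
        have a: "?a b = t ?K \<cdot> snd (f d) b" if "b \<in> underS r x" for b using that by (auto simp: underS_def)
        have "P f x (?c, ?a)"
          unfolding P_def fst_conv snd_conv
        proof (intro impI conjI ballI allI)
          show "?c \<in> Obj C" using HomD[OF tH] by simp
          show "?a b \<in> Hom C (fst (f b)) ?c" if "b \<in> underS r x" for b
            unfolding a[OF that] using fd[OF that] tH by blast
          show "?a b \<cdot> snd (f b) e = ?a e" if b: "b \<in> underS r x" and eb: "(e, b) \<in> r" for e b
          proof -
            note e = u_down[OF eb b]
            have fb: "snd (f b) e \<in> Hom C (fst (f e)) (fst (f b))"
              using PD(1,2,3)[OF IH[OF b] uF[OF b]] eb by (cases "e = b") (auto simp: underS_def)
            have "snd (f d) b \<cdot> snd (f b) e = snd (f d) e"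
            proof (cases "b = d")
              case True
              then show ?thesis using D(2) Ident_comp[OF fb] by simp
            next
              case False
              then show ?thesis using below[OF b] D(4)[of b e] eb by auto
            qed
            then show ?thesis
              unfolding a[OF b] a[OF e] using comp_assoc[OF fb fd[OF b] tH] by simp
          qed
          show "?c = K0" if "\<forall>b\<in>Field r. (x, b) \<in> r"
            using that dx wo_antisym[OF r dx(1)] uF[OF du] by auto
          show "?a e = t (fst (f e))" if e: "succ_in r e x" for e
          proof -
            have "e = d"
              using succ_between[OF r d, of e] succ_between[OF r e, of d] e dx wo_antisym[OF r, of e d]
              by (auto simp: succ_in_def)
            then show ?thesis using D(2) comp_Ident[OF tH] dx(2) by simp
          qed
          show "Good x (mk f) ?c ?a" if "limit_in r x" using limit_in_not_succ[OF r that] d by blast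
        qed simp
        then show ?thesis by blast
      next
        assume x_lim: "limit_in r x"
        have FR: "Field (Restr r (underS r x)) = underS r x"
          using r by (intro Field_Restr Order_Relation.underS_Field) (simp add: order_on_defs)
        have fH: "snd (f b) a \<in> Hom C (fst (f a)) (fst (f b))" if "(a, b) \<in> r" "b \<in> underS r x" for a b
          using PD(1,2,3)[OF IH[OF that(2)] uF[OF that(2)]] that(1) by (cases "a = b") (auto simp: underS_def)
        have "diagram (Restr r (underS r x)) (mk f)"
          unfolding is_functor_ordinal_cat FR
        proof (intro conjI ballI allI impI)
          fix a assume "a \<in> underS r x"
          then show "fob (mk f) a \<in> Obj C" "far (mk f) (a, a) = Ident C (fob (mk f) a)"
            using PD(1,2)[OF IH uF] by (auto simp: mk_def)
        next
          fix a b assume ab: "(a, b) \<in> Restr r (underS r x)"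
          then show "far (mk f) (a, b) \<in> Hom C (fob (mk f) a) (fob (mk f) b)"
            using fH by (simp add: mk_def)
          fix c assume bc: "(b, c) \<in> Restr r (underS r x)"
          have cx: "c \<in> underS r x" using bc by simp
          have "snd (f c) a = snd (f c) b \<cdot> snd (f b) a"
          proof (cases "b = c")
            case True
            then show ?thesis using PD(2)[OF IH[OF cx] uF[OF cx]] Ident_comp[OF fH[of a b]] ab by simp
          next
            case False
            then show ?thesis using PD(4)[OF IH[OF cx] uF[OF cx], of b a] bc ab by (simp add: underS_def)
          qed
          then show "far (mk f) (a, c) = far (mk f) (b, c) \<cdot> far (mk f) (a, b)" by (simp add: mk_def)
        qed
        then obtain c \<iota> where c: "cocone (Restr r (underS r x)) (mk f) c \<iota>" "Good x (mk f) c \<iota>"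
          using lim[OF x_lim] by blast
        let ?a = "\<lambda>b. if b = x then Ident C c else \<iota> b"
        have nx: "x \<notin> underS r x" by (simp add: underS_def)
        have "P f x (c, ?a)"
          unfolding P_def fst_conv snd_conv
        proof (intro impI conjI ballI allI)
          show "c \<in> Obj C" by (rule cocone_Obj[OF c(1)])
          show "?a b \<in> Hom C (fst (f b)) c" if "b \<in> underS r x" for b
            using cocone_Hom[OF c(1), unfolded FR, OF that] that nx by (auto simp: mk_def)
          show "?a b \<cdot> snd (f b) e = ?a e" if "b \<in> underS r x" "(e, b) \<in> r" for e b
            using cocone_comp[OF c(1), of e b] that u_down[OF that(2,1)] nx by (auto simp: mk_def)
          show "c = K0" if "\<forall>b\<in>Field r. (x, b) \<in> r"
          proof -
            obtain b where "b \<in> underS r x" using x_lim by (auto simp: limit_in_def)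
            then show ?thesis using that wo_antisym[OF r, of b x] uF by (auto simp: underS_def)
          qed
          show "?a e = t (fst (f e))" if "succ_in r e x" for e
            using limit_in_not_succ[OF r x_lim] that by blast
          show "Good x (mk f) c ?a" by (rule Good_cong[OF c(2)]) (auto simp: underS_def)
        qed simp
        then show ?thesis by blast
      qed
    qed (simp add: P_def)
  qed
  then obtain f where f: "\<And>x. P f x (f x)" by blast
  note F = PD[OF f]
  have H: "snd (f b) a \<in> Hom C (fst (f a)) (fst (f b))" if "(a, b) \<in> r" for a b
    using F(1)[of b] F(2)[of b] F(3)[of b a] that Field_right[OF that] by (cases "a = b") (auto simp: underS_def)
  show thesis
  proof (rule that)
    show "diagram r (mk f)"
      unfolding is_functor_ordinal_cat
    proof (intro conjI ballI allI impI)
      fix a b c assume ab: "(a, b) \<in> r" and bc: "(b, c) \<in> r"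
      have "snd (f c) a = snd (f c) b \<cdot> snd (f b) a"
      proof (cases "b = c")
        case True
        then show ?thesis using F(2) Field_right[OF ab] Ident_comp[OF H[OF ab]] by simp
      next
        case False
        then show ?thesis using F(4)[of c b a] bc ab Field_right[OF bc] by (simp add: underS_def)
      qed
      then show "far (mk f) (a, c) = far (mk f) (b, c) \<cdot> far (mk f) (a, b)" by (simp add: mk_def)
    qed (use F(1,2) H in \<open>simp_all add: mk_def\<close>)
    show "fob (mk f) m = K0" if "m \<in> Field r" "\<And>a. a \<in> Field r \<Longrightarrow> (m, a) \<in> r" for m
      using F(5)[OF that] by (simp add: mk_def)
    show "far (mk f) (a, b) = t (fob (mk f) a)" if "succ_in r a b" for a b
      using F(6)[OF _ that] that by (auto simp: mk_def succ_in_def dest: Field_right)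
    show "Good g (mk f) (fob (mk f) g) (\<lambda>b. far (mk f) (b, g))" if "limit_in r g" for g
      using F(7)[OF _ that] that by (simp add: mk_def limit_in_def)
  qed
qed

end

section \<open>Endofunctors of the category of maps over the codomain\<close>

lemma map_cat_simps [simp]:
  "Obj (map_cat C) = Arr C" "Dom (map_cat C) = sq_dom" "Cod (map_cat C) = sq_cod"
  "s \<in> Arr (map_cat C) \<longleftrightarrow> comm_square C s"
  "Ident (map_cat C) f = Square f f (Ident C (Dom C f)) (Ident C (Cod C f))"
  "Comp (map_cat C) s' s = Square (sq_dom s) (sq_cod s')
     (Comp C (sq_top s') (sq_top s)) (Comp C (sq_bot s') (sq_bot s))"
  by (simp_all add: map_cat_def)

type_synonym 'm endo = "('m, 'm square, 'm, 'm square) funct"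

context cat
begin

lemma comm_squareD:
  assumes "comm_square C s"
  shows "sq_dom s \<in> Arr C" "sq_cod s \<in> Arr C"
    "sq_top s \<in> Hom C (Dom C (sq_dom s)) (Dom C (sq_cod s))"
    "sq_bot s \<in> Hom C (Cod C (sq_dom s)) (Cod C (sq_cod s))"
    "sq_cod s \<cdot> sq_top s = sq_bot s \<cdot> sq_dom s"
  using assms by (simp_all add: comm_square_def)

lemma comm_square_Ident: "f \<in> Arr C \<Longrightarrow> comm_square C (Ident (map_cat C) f)"
  using category_map_cat[OF category] by (auto simp: category_def)

lemma comm_square_Comp:
  "comm_square C s \<Longrightarrow> comm_square C s' \<Longrightarrow> sq_cod s = sq_dom s' \<Longrightarrow> comm_square C (Comp (map_cat C) s' s)"
  using category_map_cat[OF category] unfolding category_def by (metis map_cat_simps(2,3,4))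

text \<open>
  An endofunctor of \<open>Map C\<close> that commutes with the codomain functor is what the right part
  \<open>\<delta>\<close> of a functorial factorization has to be. The definition mentions only morphisms: applied to
  identities, it says that \<open>fob K f\<close> has the same codomain as \<open>f\<close>.
\<close>
definition right_part :: "'m endo \<Rightarrow> bool" where
  "right_part K \<longleftrightarrow> is_functor (map_cat C) (map_cat C) K \<and>
    (\<forall>s. comm_square C s \<longrightarrow> sq_bot (far K s) = sq_bot s)"

lemma right_partD:
  assumes K: "right_part K"
  shows "f \<in> Arr C \<Longrightarrow> fob K f \<in> Arr C"
    and "f \<in> Arr C \<Longrightarrow> Cod C (fob K f) = Cod C f"
    and "f \<in> Arr C \<Longrightarrow> sq_top (far K (Ident (map_cat C) f)) = Ident C (Dom C (fob K f))"
    and "comm_square C s \<Longrightarrow> comm_square C (far K s)"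
    and "comm_square C s \<Longrightarrow> sq_dom (far K s) = fob K (sq_dom s)"
    and "comm_square C s \<Longrightarrow> sq_cod (far K s) = fob K (sq_cod s)"
    and "comm_square C s \<Longrightarrow> sq_bot (far K s) = sq_bot s"
    and "comm_square C s \<Longrightarrow> sq_top (far K s) \<in> Hom C (Dom C (fob K (sq_dom s))) (Dom C (fob K (sq_cod s)))"
    and "comm_square C s \<Longrightarrow> fob K (sq_cod s) \<cdot> sq_top (far K s) = sq_bot s \<cdot> fob K (sq_dom s)"
    and "comm_square C s \<Longrightarrow> comm_square C s' \<Longrightarrow> sq_cod s = sq_dom s' \<Longrightarrow>
      sq_top (far K (Comp (map_cat C) s' s)) = sq_top (far K s') \<cdot> sq_top (far K s)"
proof -
  have F: "is_functor (map_cat C) (map_cat C) K"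
    and b: "\<And>s. comm_square C s \<Longrightarrow> sq_bot (far K s) = sq_bot s"
    using K by (auto simp: right_part_def)
  show ob: "fob K f \<in> Arr C" if "f \<in> Arr C" for f using F that by (simp add: is_functor_def)
  have id: "far K (Ident (map_cat C) f) = Ident (map_cat C) (fob K f)" if "f \<in> Arr C" for f
    using F that by (simp add: is_functor_def)
  then show "sq_top (far K (Ident (map_cat C) f)) = Ident C (Dom C (fob K f))" if "f \<in> Arr C" for f
    using that by simp
  have "Ident C (Cod C (fob K f)) = Ident C (Cod C f)" if "f \<in> Arr C" for f
    using b[OF comm_square_Ident[OF that]] id[OF that] by simp
  then show "Cod C (fob K f) = Cod C f" if "f \<in> Arr C" for f
    using HomD(5)[OF HomI[OF that]] HomD(5)[OF HomI[OF ob[OF that]]] Ident_simps(4) that by metis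
  have H: "far K s \<in> Hom (map_cat C) (fob K (sq_dom s)) (fob K (sq_cod s))" if "comm_square C s" for s
    using F that by (simp add: is_functor_def)
  show sq: "comm_square C (far K s)" and d: "sq_dom (far K s) = fob K (sq_dom s)"
    and c: "sq_cod (far K s) = fob K (sq_cod s)" if "comm_square C s" for s
    using H[OF that] by (simp_all add: Hom_def)
  show "sq_bot (far K s) = sq_bot s" if "comm_square C s" for s by (rule b[OF that])
  show "sq_top (far K s) \<in> Hom C (Dom C (fob K (sq_dom s))) (Dom C (fob K (sq_cod s)))"
    "fob K (sq_cod s) \<cdot> sq_top (far K s) = sq_bot s \<cdot> fob K (sq_dom s)" if "comm_square C s" for s
    using comm_squareD(3,5)[OF sq[OF that]] d c b that by simp_all
  show "sq_top (far K (Comp (map_cat C) s' s)) = sq_top (far K s') \<cdot> sq_top (far K s)"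
    if "comm_square C s" "comm_square C s'" "sq_cod s = sq_dom s'" for s s'
    using F that by (simp add: is_functor_def)
qed

lemma right_partI:
  assumes ob: "\<And>f. f \<in> Arr C \<Longrightarrow> \<rho> f \<in> Hom C (E f) (Cod C f)"
    and ar: "\<And>s. comm_square C s \<Longrightarrow> e s \<in> Hom C (E (sq_dom s)) (E (sq_cod s))"
    and sq: "\<And>s. comm_square C s \<Longrightarrow> \<rho> (sq_cod s) \<cdot> e s = sq_bot s \<cdot> \<rho> (sq_dom s)"
    and id: "\<And>f. f \<in> Arr C \<Longrightarrow> e (Ident (map_cat C) f) = Ident C (E f)"
    and comp: "\<And>s s'. comm_square C s \<Longrightarrow> comm_square C s' \<Longrightarrow> sq_cod s = sq_dom s' \<Longrightarrow>
      e (Comp (map_cat C) s' s) = e s' \<cdot> e s"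
  shows "right_part \<lparr>fob = \<rho>, far = \<lambda>s. Square (\<rho> (sq_dom s)) (\<rho> (sq_cod s)) (e s) (sq_bot s)\<rparr>"
proof -
  have \<rho>: "\<rho> f \<in> Arr C" "Dom C (\<rho> f) = E f" "Cod C (\<rho> f) = Cod C f" if "f \<in> Arr C" for f
    using HomD[OF ob[OF that]] by auto
  have "comm_square C (Square (\<rho> (sq_dom s)) (\<rho> (sq_cod s)) (e s) (sq_bot s))" if "comm_square C s" for s
    using comm_squareD[OF that] \<rho> ar[OF that] sq[OF that] by (simp add: comm_square_def)
  then show ?thesis
    using \<rho> id comp unfolding right_part_def is_functor_def by (simp add: Hom_def)
qed

lemma right_part_comp:
  assumes K: "right_part K" and T: "right_part T"
  shows "right_part \<lparr>fob = \<lambda>f. fob T (fob K f), far = \<lambda>s. far T (far K s)\<rparr>"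
proof -
  have "is_functor (map_cat C) (map_cat C) K" "is_functor (map_cat C) (map_cat C) T"
    using K T by (simp_all add: right_part_def)
  then have "is_functor (map_cat C) (map_cat C) \<lparr>fob = \<lambda>f. fob T (fob K f), far = \<lambda>s. far T (far K s)\<rparr>"
    unfolding is_functor_def by (auto simp del: map_cat_simps simp: Hom_def)
  then show ?thesis
    using right_partD(4,7)[OF K] right_partD(7)[OF T] by (simp add: right_part_def)
qed

definition id_part :: "'m endo" where "id_part = \<lparr>fob = \<lambda>f. f, far = \<lambda>s. s\<rparr>"

lemma right_part_id: "right_part id_part"
  by (auto simp: id_part_def right_part_def is_functor_def Hom_def)

text \<open>
  A natural transformation over the codomain, given by its components between the domains. A map from the
  identity functor to \<open>K\<close> is a functorial factorization with right part \<open>K\<close>.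
\<close>
definition right_part_map :: "'m endo \<Rightarrow> 'm endo \<Rightarrow> ('m \<Rightarrow> 'm) \<Rightarrow> bool" where
  "right_part_map K L t \<longleftrightarrow>
    (\<forall>f\<in>Arr C. t f \<in> Hom C (Dom C (fob K f)) (Dom C (fob L f)) \<and> fob L f \<cdot> t f = fob K f) \<and>
    (\<forall>s. comm_square C s \<longrightarrow> sq_top (far L s) \<cdot> t (sq_dom s) = t (sq_cod s) \<cdot> sq_top (far K s))"

lemma right_part_map_comp:
  assumes K: "right_part K" "right_part L" "right_part M"
    and t: "right_part_map K L t" and t': "right_part_map L M t'"
  shows "right_part_map K M (\<lambda>f. t' f \<cdot> t f)"
  unfolding right_part_map_def
proof (intro conjI ballI allI impI)
  fix f assume f: "f \<in> Arr C"
  have T: "t f \<in> Hom C (Dom C (fob K f)) (Dom C (fob L f))" "fob L f \<cdot> t f = fob K f"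
    and T': "t' f \<in> Hom C (Dom C (fob L f)) (Dom C (fob M f))" "fob M f \<cdot> t' f = fob L f"
    using t t' f by (auto simp: right_part_map_def)
  show "t' f \<cdot> t f \<in> Hom C (Dom C (fob K f)) (Dom C (fob M f))" using T T' by blast
  show "fob M f \<cdot> t' f \<cdot> t f = fob K f"
    using comp_reduce[OF T'(2) T(1) T'(1) HomI[OF right_partD(1)[OF K(3) f]]] T(2) by simp
next
  fix s assume s: "comm_square C s"
  note d = comm_squareD(1,2)[OF s]
  have T: "t (sq_dom s) \<in> Hom C (Dom C (fob K (sq_dom s))) (Dom C (fob L (sq_dom s)))"
      "t (sq_cod s) \<in> Hom C (Dom C (fob K (sq_cod s))) (Dom C (fob L (sq_cod s)))"
      "sq_top (far L s) \<cdot> t (sq_dom s) = t (sq_cod s) \<cdot> sq_top (far K s)"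
    and T': "t' (sq_dom s) \<in> Hom C (Dom C (fob L (sq_dom s))) (Dom C (fob M (sq_dom s)))"
      "t' (sq_cod s) \<in> Hom C (Dom C (fob L (sq_cod s))) (Dom C (fob M (sq_cod s)))"
      "sq_top (far M s) \<cdot> t' (sq_dom s) = t' (sq_cod s) \<cdot> sq_top (far L s)"
    using t t' d s by (auto simp: right_part_map_def)
  note k = right_partD(8)[OF K(1) s] right_partD(8)[OF K(2) s] right_partD(8)[OF K(3) s]
  have "sq_top (far M s) \<cdot> t' (sq_dom s) \<cdot> t (sq_dom s) = t' (sq_cod s) \<cdot> sq_top (far L s) \<cdot> t (sq_dom s)"
    using comp_reduce[OF T'(3) T(1) T'(1) k(3)] comp_assoc[OF T(1) k(2) T'(2)] by simp
  also have "\<dots> = (t' (sq_cod s) \<cdot> t (sq_cod s)) \<cdot> sq_top (far K s)"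
    using T(3) comp_assoc[OF k(1) T(2) T'(2)] by simp
  finally show "sq_top (far M s) \<cdot> t' (sq_dom s) \<cdot> t (sq_dom s) = (t' (sq_cod s) \<cdot> t (sq_cod s)) \<cdot> sq_top (far K s)" .
qed

lemma right_part_map_cong:
  assumes "right_part_map K L t" "\<And>f. f \<in> Arr C \<Longrightarrow> t f = t' f"
  shows "right_part_map K L t'"
  using assms comm_squareD(1,2) unfolding right_part_map_def by metis

lemma right_part_map_id:
  assumes K: "right_part K"
  shows "right_part_map K K (\<lambda>f. Ident C (Dom C (fob K f)))"
  unfolding right_part_map_def
proof (intro conjI ballI allI impI)
  fix f assume f: "f \<in> Arr C"
  have k: "fob K f \<in> Hom C (Dom C (fob K f)) (Cod C (fob K f))" using HomI[OF right_partD(1)[OF K f]] .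
  show "Ident C (Dom C (fob K f)) \<in> Hom C (Dom C (fob K f)) (Dom C (fob K f))" using HomD(4)[OF k] by blast
  show "fob K f \<cdot> Ident C (Dom C (fob K f)) = fob K f" by (rule comp_Ident[OF k])
next
  fix s assume s: "comm_square C s"
  show "sq_top (far K s) \<cdot> Ident C (Dom C (fob K (sq_dom s))) = Ident C (Dom C (fob K (sq_cod s))) \<cdot> sq_top (far K s)"
    using comp_Ident[OF right_partD(8)[OF K s]] Ident_comp[OF right_partD(8)[OF K s]] by simp
qed

definition right_part_cat :: "('m endo, 'm endo \<times> 'm endo \<times> ('m \<Rightarrow> 'm)) category" where
  "right_part_cat = \<lparr>
     Obj = {K. right_part K},
     Arr = {(K, L, t). right_part K \<and> right_part L \<and> t \<in> extensional (Arr C) \<and> right_part_map K L t},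
     Dom = (\<lambda>(K, L, t). K),
     Cod = (\<lambda>(K, L, t). L),
     Ident = (\<lambda>K. (K, K, \<lambda>f\<in>Arr C. Ident C (Dom C (fob K f)))),
     Comp = (\<lambda>(L', M, t') (K, L, t). (K, M, \<lambda>f\<in>Arr C. t' f \<cdot> t f))\<rparr>"

lemma category_right_part_cat: "category right_part_cat"
proof -
  have id: "right_part_map K K (\<lambda>f\<in>Arr C. Ident C (Dom C (fob K f)))" if "right_part K" for K
    by (rule right_part_map_cong[OF right_part_map_id[OF that]]) simp
  have cmp: "right_part_map K M (\<lambda>f\<in>Arr C. t' f \<cdot> t f)"
    if "right_part K" "right_part L" "right_part M" "right_part_map K L t" "right_part_map L M t'" for K L M t t'
    by (rule right_part_map_cong[OF right_part_map_comp[OF that]]) simp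
  have H: "t f \<in> Hom C (Dom C (fob K f)) (Dom C (fob L f))" if "right_part_map K L t" "f \<in> Arr C" for K L t f
    using that by (simp add: right_part_map_def)
  show ?thesis
    unfolding category_def
  proof (intro conjI ballI impI)
    fix x assume "x \<in> Arr right_part_cat"
    then obtain K L t where x: "x = (K, L, t)" "right_part_map K L t" "t \<in> extensional (Arr C)"
      by (auto simp: right_part_cat_def)
    have "(\<lambda>f\<in>Arr C. t f \<cdot> (\<lambda>f\<in>Arr C. Ident C (Dom C (fob K f))) f) = t"
      "(\<lambda>f\<in>Arr C. (\<lambda>f\<in>Arr C. Ident C (Dom C (fob L f))) f \<cdot> t f) = t"
      using x(3) comp_Ident[OF H[OF x(2)]] Ident_comp[OF H[OF x(2)]]
      by (auto simp: fun_eq_iff extensional_def)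
    then show "Comp right_part_cat x (Ident right_part_cat (Dom right_part_cat x)) = x"
      "Comp right_part_cat (Ident right_part_cat (Cod right_part_cat x)) x = x"
      using x(1) by (simp_all add: right_part_cat_def)
  next
    fix x y z assume xyz: "x \<in> Arr right_part_cat" "y \<in> Arr right_part_cat" "z \<in> Arr right_part_cat"
      "Cod right_part_cat x = Dom right_part_cat y \<and> Cod right_part_cat y = Dom right_part_cat z"
    then obtain K L M N t t' t'' where x: "x = (K, L, t)" "y = (L, M, t')" "z = (M, N, t'')"
      and m: "right_part_map K L t" "right_part_map L M t'" "right_part_map M N t''"
      by (auto simp: right_part_cat_def)
    show "Comp right_part_cat z (Comp right_part_cat y x) = Comp right_part_cat (Comp right_part_cat z y) x"
      using comp_assoc[OF H[OF m(1)] H[OF m(2)] H[OF m(3)]]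
      by (simp add: right_part_cat_def x restrict_def fun_eq_iff)
  qed (auto simp: right_part_cat_def id cmp)
qed

text \<open>Evaluation at \<open>f\<close> followed by the domain functor turns a diagram of endofunctors into one in \<open>C\<close>.\<close>
definition at_map :: "'m \<Rightarrow> ('j, 'k, 'm endo, 'm endo \<times> 'm endo \<times> ('m \<Rightarrow> 'm)) funct \<Rightarrow> ('j, 'k, 'o, 'm) funct" where
  "at_map f X = \<lparr>fob = \<lambda>b. Dom C (fob (fob X b) f), far = \<lambda>k. snd (snd (far X k)) f\<rparr>"

lemma right_part_cat_Hom:
  assumes "x \<in> Hom right_part_cat K L"
  shows "right_part K" "right_part L" "right_part_map K L (snd (snd x))" "x = (K, L, snd (snd x))"
  using assms by (auto simp: Hom_def right_part_cat_def)

lemma right_part_mapD: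
  assumes "right_part_map K L t"
  shows "f \<in> Arr C \<Longrightarrow> t f \<in> Hom C (Dom C (fob K f)) (Dom C (fob L f))"
    and "f \<in> Arr C \<Longrightarrow> fob L f \<cdot> t f = fob K f"
    and "comm_square C s \<Longrightarrow> sq_top (far L s) \<cdot> t (sq_dom s) = t (sq_cod s) \<cdot> sq_top (far K s)"
  using assms by (simp_all add: right_part_map_def)

lemma at_map_functor:
  assumes X: "is_functor (ordinal_cat R) right_part_cat X" and f: "f \<in> Arr C"
  shows "diagram R (at_map f X)"
proof -
  interpret D: cat right_part_cat by unfold_locales (rule category_right_part_cat)
  have ob: "right_part (fob X b)" if "b \<in> Field R" for b
    using D.functor_Obj[OF X that] by (simp add: right_part_cat_def)
  note H = right_part_cat_Hom[OF D.functor_Hom[OF X]]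
  show ?thesis
    unfolding is_functor_ordinal_cat
  proof (intro conjI ballI allI impI)
    fix b assume b: "b \<in> Field R"
    show "fob (at_map f X) b \<in> Obj C"
      using HomD(4)[OF HomI[OF right_partD(1)[OF ob[OF b] f]]] by (simp add: at_map_def)
    show "far (at_map f X) (b, b) = Ident C (fob (at_map f X) b)"
      using D.functor_Ident[OF X b] f by (simp add: at_map_def right_part_cat_def)
  next
    fix a b c assume ab: "(a, b) \<in> R" and bc: "(b, c) \<in> R"
    have "far X (a, c) = Comp right_part_cat (far X (b, c)) (far X (a, b))"
      using D.functor_comp[OF X ab bc] by simp
    then show "far (at_map f X) (a, c) = far (at_map f X) (b, c) \<cdot> far (at_map f X) (a, b)"
      using H(4)[OF ab] H(4)[OF bc] f by (cases "far X (a, b)"; cases "far X (b, c)") (simp add: at_map_def right_part_cat_def)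
  qed (use right_part_mapD(1)[OF H(3) f] in \<open>simp add: at_map_def\<close>)
qed

end

context small_cocomplete
begin

text \<open>
  The colimits of the domains, one chosen for each map of \<open>C\<close>, assemble to a functor over
  the codomain by their universal properties, just as colimits in a slice category are computed on domains.
\<close>
lemma right_part_colimit:
  assumes R: "Preorder R" "small U (Field R)" and X: "is_functor (ordinal_cat R) right_part_cat X"
  shows "\<exists>K \<iota>. is_cocone (ordinal_cat R) right_part_cat X K \<iota> \<and>
    (\<forall>f\<in>Arr C. colim R (at_map f X) (Dom C (fob K f)) (\<lambda>b. snd (snd (\<iota> b)) f))"
proof -
  interpret D: cat right_part_cat by unfold_locales (rule category_right_part_cat)
  have ob: "right_part (fob X b)" if "b \<in> Field R" for b
    using D.functor_Obj[OF X that] by (simp add: right_part_cat_def)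
  have H: "right_part_map (fob X a) (fob X b) (snd (snd (far X (a, b))))" if "(a, b) \<in> R" for a b
    using right_part_cat_Hom[OF D.functor_Hom[OF X that]] by simp
  note at = at_map_functor[OF X]
  have "\<exists>c \<iota>. colim R (at_map f X) c \<iota>" if "f \<in> Arr C" for f
    using small_preorder_colimit[OF R at[OF that]] by blast
  then obtain E i where co: "\<And>f. f \<in> Arr C \<Longrightarrow> colim R (at_map f X) (E f) (i f)"
    by metis
  note coc = colimit_cocone[OF co]
  have iH: "i f b \<in> Hom C (Dom C (fob (fob X b) f)) (E f)" if "f \<in> Arr C" "b \<in> Field R" for f b
    using cocone_Hom[OF coc[OF that(1)] that(2)] by (simp add: at_map_def)
  have "\<exists>h. h \<in> Hom C (E f) (Cod C f) \<and> (\<forall>b\<in>Field R. h \<cdot> i f b = fob (fob X b) f)" if f: "f \<in> Arr C" for f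
  proof -
    have "cocone R (at_map f X) (Cod C f) (\<lambda>b. fob (fob X b) f)"
      unfolding is_cocone_ordinal_cat
      using HomD(5)[OF HomI[OF f]] HomI[OF right_partD(1)[OF ob f]] right_partD(2)[OF ob f]
        right_part_mapD(2)[OF H f] by (simp add: at_map_def)
    from colimit_ex1[OF co[OF f] this] show ?thesis by blast
  qed
  then obtain \<rho> where \<rho>: "\<And>f. f \<in> Arr C \<Longrightarrow> \<rho> f \<in> Hom C (E f) (Cod C f)"
    "\<And>f b. f \<in> Arr C \<Longrightarrow> b \<in> Field R \<Longrightarrow> \<rho> f \<cdot> i f b = fob (fob X b) f" by metis
  have "\<exists>h. h \<in> Hom C (E (sq_dom s)) (E (sq_cod s)) \<and>
      (\<forall>b\<in>Field R. h \<cdot> i (sq_dom s) b = i (sq_cod s) b \<cdot> sq_top (far (fob X b) s))" if s: "comm_square C s" for s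
  proof -
    note d = comm_squareD(1,2)[OF s]
    have "cocone R (at_map (sq_dom s) X) (E (sq_cod s))
        (\<lambda>b. i (sq_cod s) b \<cdot> sq_top (far (fob X b) s))"
      unfolding is_cocone_ordinal_cat
    proof (intro conjI ballI allI impI)
      show "E (sq_cod s) \<in> Obj C" by (rule cocone_Obj[OF coc[OF d(2)]])
      show "i (sq_cod s) b \<cdot> sq_top (far (fob X b) s) \<in> Hom C (fob (at_map (sq_dom s) X) b) (E (sq_cod s))"
        if "b \<in> Field R" for b
        using comp_in_Hom[OF right_partD(8)[OF ob[OF that] s] iH[OF d(2) that]] by (simp add: at_map_def)
      fix a b assume ab: "(a, b) \<in> R"
      note F = Field_left[OF ab] Field_right[OF ab]
      let ?t = "snd (snd (far X (a, b)))"
      note T = right_part_mapD[OF H[OF ab]]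
      have "(i (sq_cod s) b \<cdot> sq_top (far (fob X b) s)) \<cdot> ?t (sq_dom s) =
          i (sq_cod s) b \<cdot> ?t (sq_cod s) \<cdot> sq_top (far (fob X a) s)"
        using comp_assoc[OF T(1)[OF d(1)] right_partD(8)[OF ob[OF F(2)] s] iH[OF d(2) F(2)]] T(3)[OF s] by simp
      also have "\<dots> = i (sq_cod s) a \<cdot> sq_top (far (fob X a) s)"
        using comp_reduce[OF cocone_comp[OF coc[OF d(2)] ab, simplified at_map_def funct.simps]
            right_partD(8)[OF ob[OF F(1)] s] T(1)[OF d(2)] iH[OF d(2) F(2)]] .
      finally show "(i (sq_cod s) b \<cdot> sq_top (far (fob X b) s)) \<cdot> far (at_map (sq_dom s) X) (a, b) =
          i (sq_cod s) a \<cdot> sq_top (far (fob X a) s)" by (simp add: at_map_def)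
    qed
    from colimit_ex1[OF co[OF d(1)] this] show ?thesis by blast
  qed
  then obtain e where e: "\<And>s. comm_square C s \<Longrightarrow> e s \<in> Hom C (E (sq_dom s)) (E (sq_cod s))"
    "\<And>s b. comm_square C s \<Longrightarrow> b \<in> Field R \<Longrightarrow> e s \<cdot> i (sq_dom s) b = i (sq_cod s) b \<cdot> sq_top (far (fob X b) s)"
    by metis
  let ?K = "\<lparr>fob = \<rho>, far = \<lambda>s. Square (\<rho> (sq_dom s)) (\<rho> (sq_cod s)) (e s) (sq_bot s)\<rparr>"
  have K: "right_part ?K"
  proof (rule right_partI[OF \<rho>(1) e(1)])
    fix s assume s: "comm_square C s"
    note d = comm_squareD[OF s]
    show "\<rho> (sq_cod s) \<cdot> e s = sq_bot s \<cdot> \<rho> (sq_dom s)"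
    proof (rule colimit_ext[OF co[OF d(1)] at[OF d(1)]])
      show "\<rho> (sq_cod s) \<cdot> e s \<in> Hom C (E (sq_dom s)) (Cod C (sq_cod s))" using \<rho>(1)[OF d(2)] e(1)[OF s] by blast
      show "sq_bot s \<cdot> \<rho> (sq_dom s) \<in> Hom C (E (sq_dom s)) (Cod C (sq_cod s))" using \<rho>(1)[OF d(1)] d(4) by blast
      fix b assume b: "b \<in> Field R"
      have "(\<rho> (sq_cod s) \<cdot> e s) \<cdot> i (sq_dom s) b = \<rho> (sq_cod s) \<cdot> i (sq_cod s) b \<cdot> sq_top (far (fob X b) s)"
        using comp_assoc[OF iH[OF d(1) b] e(1)[OF s] \<rho>(1)[OF d(2)]] e(2)[OF s b] by simp
      also have "\<dots> = fob (fob X b) (sq_cod s) \<cdot> sq_top (far (fob X b) s)"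
        by (rule comp_reduce[OF \<rho>(2)[OF d(2) b] right_partD(8)[OF ob[OF b] s] iH[OF d(2) b] \<rho>(1)[OF d(2)]])
      also have "\<dots> = (sq_bot s \<cdot> \<rho> (sq_dom s)) \<cdot> i (sq_dom s) b"
        using right_partD(9)[OF ob[OF b] s] comp_assoc[OF iH[OF d(1) b] \<rho>(1)[OF d(1)] d(4)] \<rho>(2)[OF d(1) b] by simp
      finally show "(\<rho> (sq_cod s) \<cdot> e s) \<cdot> i (sq_dom s) b = (sq_bot s \<cdot> \<rho> (sq_dom s)) \<cdot> i (sq_dom s) b" .
    qed
  next
    fix f assume f: "f \<in> Arr C"
    note s = comm_square_Ident[OF f]
    have Ef: "E f \<in> Obj C" by (rule cocone_Obj[OF coc[OF f]])
    have "e (Ident (map_cat C) f) \<in> Hom C (E f) (E f)" using e(1)[OF s] by simp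
    then show "e (Ident (map_cat C) f) = Ident C (E f)"
    proof (rule colimit_ext[OF co[OF f] at[OF f]])
      fix b assume b: "b \<in> Field R"
      show "e (Ident (map_cat C) f) \<cdot> i f b = Ident C (E f) \<cdot> i f b"
        using e(2)[OF s b] right_partD(3)[OF ob[OF b] f] comp_Ident[OF iH[OF f b]] Ident_comp[OF iH[OF f b]] by simp
    qed (use Ef in blast)
  next
    fix s s' assume s: "comm_square C s" and s': "comm_square C s'" and ss: "sq_cod s = sq_dom s'"
    note d = comm_squareD(1,2)[OF s] and d' = comm_squareD(1,2)[OF s'] and c = comm_square_Comp[OF s s' ss]
    have "e (Comp (map_cat C) s' s) \<in> Hom C (E (sq_dom s)) (E (sq_cod s'))" using e(1)[OF c] by simp
    then show "e (Comp (map_cat C) s' s) = e s' \<cdot> e s"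
    proof (rule colimit_ext[OF co[OF d(1)] at[OF d(1)]])
      have e1: "e s \<in> Hom C (E (sq_dom s)) (E (sq_dom s'))" using e(1)[OF s] ss by simp
      show "e s' \<cdot> e s \<in> Hom C (E (sq_dom s)) (E (sq_cod s'))" using e1 e(1)[OF s'] by blast
      fix b assume b: "b \<in> Field R"
      note k = right_partD(8)[OF ob[OF b] s, unfolded ss] right_partD(8)[OF ob[OF b] s']
      have "(e s' \<cdot> e s) \<cdot> i (sq_dom s) b = e s' \<cdot> i (sq_dom s') b \<cdot> sq_top (far (fob X b) s)"
        using comp_assoc[OF iH[OF d(1) b] e1 e(1)[OF s']] e(2)[OF s b] ss by simp
      also have "\<dots> = i (sq_cod s') b \<cdot> sq_top (far (fob X b) s') \<cdot> sq_top (far (fob X b) s)"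
        using comp_reduce[OF e(2)[OF s' b] k(1) iH[OF d'(1) b] e(1)[OF s']] comp_assoc[OF k iH[OF d'(2) b]] by simp
      also have "\<dots> = e (Comp (map_cat C) s' s) \<cdot> i (sq_dom s) b"
        using e(2)[OF c b] right_partD(10)[OF ob[OF b] s s' ss] by simp
      finally show "e (Comp (map_cat C) s' s) \<cdot> i (sq_dom s) b = (e s' \<cdot> e s) \<cdot> i (sq_dom s) b" by simp
    qed
  qed
  have dK: "Dom C (fob ?K f) = E f" if "f \<in> Arr C" for f using HomD(2)[OF \<rho>(1)[OF that]] by simp
  let ?\<iota> = "\<lambda>b. (fob X b, ?K, \<lambda>f\<in>Arr C. i f b)"
  have i_map: "right_part_map (fob X b) ?K (\<lambda>f\<in>Arr C. i f b)" if b: "b \<in> Field R" for b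
    unfolding right_part_map_def
    using iH[OF _ b] dK \<rho>(2)[OF _ b] e(2)[OF _ b] comm_squareD(1,2) by simp
  have "is_cocone (ordinal_cat R) right_part_cat X ?K ?\<iota>"
    unfolding D.is_cocone_ordinal_cat
  proof (intro conjI ballI allI impI)
    fix a b assume ab: "(a, b) \<in> R"
    obtain t where t: "far X (a, b) = (fob X a, fob X b, t)"
      using right_part_cat_Hom(4)[OF D.functor_Hom[OF X ab]] by blast
    have "i f b \<cdot> t f = i f a" if "f \<in> Arr C" for f
      using cocone_comp[OF coc[OF that] ab] t by (simp add: at_map_def)
    then show "Comp right_part_cat (?\<iota> b) (far X (a, b)) = ?\<iota> a"
      unfolding t by (auto simp: right_part_cat_def restrict_def)
  qed (use K ob i_map in \<open>auto simp: right_part_cat_def Hom_def\<close>)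
  moreover have "colim R (at_map f X) (Dom C (fob ?K f)) (\<lambda>b. snd (snd (?\<iota> b)) f)"
    if f: "f \<in> Arr C" for f
    unfolding dK[OF f] by (rule colimit_cong[OF co[OF f]]) (use f in simp_all)
  ultimately show ?thesis by blast
qed

section \<open>One step of the construction\<close>

text \<open>
  A square \<open>s \<in> F p\<close> has a map of \<open>I\<close> as its left side, and \<open>j p\<close> attaches all these maps. A morphism \<open>\<sigma>: p \<rightarrow> q\<close> of \<open>Map C\<close> sends each square
  \<open>s \<in> F p\<close> to a square \<open>s' \<in> F q\<close> together with a map \<open>g\<close> between the attached maps, and so induces a map
  between the attachments; functoriality of \<open>F\<close> makes this functorial. A square \<open>\<psi>\<close> from \<open>i\<close> to \<open>p\<close> factors
  through some \<open>s \<in> F p\<close>, and the cell attached for \<open>s\<close> yields a lift of \<open>\<psi>\<close> one step later.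
\<close>

theorem one_step_factorization:
  assumes F: "factorization_setup U (map_cat C) I F"
  obtains T j where "right_part T" "right_part_map id_part T j"
    "\<And>p. p \<in> Arr C \<Longrightarrow> j p \<in> cell U C I"
    "\<And>i p u v. p \<in> Arr C \<Longrightarrow> i \<in> I \<Longrightarrow> comm_square C (Square i p u v) \<Longrightarrow>
      \<exists>h \<in> Hom C (Cod C i) (Dom C (fob T p)). h \<cdot> i = j p \<cdot> u \<and> fob T p \<cdot> h = v"
proof -
  have FF: "is_functor (map_cat C) (pow_cat U (map_cat (map_cat C))) F"
    and F_obj: "\<And>p. p \<in> Arr C \<Longrightarrow> fob F p \<subseteq> {s. comm_square C s \<and> sq_dom s \<in> I \<and> sq_cod s = p}"
    and F_fact: "\<And>p. p \<in> Arr C \<Longrightarrow> factorization_property (map_cat C) I p (fob F p)"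
    and F_arr: "\<And>\<sigma>. comm_square C \<sigma> \<Longrightarrow> case far F \<sigma> of (A, B, G) \<Rightarrow> \<forall>s \<in> fob F (sq_dom \<sigma>).
      sq_dom (G s) = s \<and> sq_cod (G s) \<in> fob F (sq_cod \<sigma>) \<and> sq_bot (G s) = \<sigma>"
    using F by (auto simp: factorization_setup_def)
  let ?A = "fob F"
  have small_A: "small U (?A p)" if "p \<in> Arr C" for p
    using FF that by (simp add: is_functor_def pow_cat_def)
  have A: "comm_square C s" "sq_dom s \<in> I" "sq_cod s = p" if "s \<in> ?A p" "p \<in> Arr C" for s p
    using F_obj[OF that(2)] that(1) by auto
  have As: "sq_dom s \<in> Arr C" "sq_top s \<in> Hom C (Dom C (sq_dom s)) (Dom C p)"
    "sq_bot s \<in> Hom C (Cod C (sq_dom s)) (Cod C p)" "p \<cdot> sq_top s = sq_bot s \<cdot> sq_dom s"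
    if "s \<in> ?A p" "p \<in> Arr C" for s p
    using comm_squareD[OF A(1)[OF that]] A(3)[OF that] by simp_all
  have "\<exists>j v. attachment (?A p) sq_dom sq_top j v \<and> Dom C j = Dom C p" if "p \<in> Arr C" for p
    by (rule attachment_exists[OF small_A[OF that] HomD(4)[OF HomI[OF that]], of sq_dom sq_top])
      (use As(1,2)[OF _ that] in blast)+
  then obtain j v where at: "\<And>p. p \<in> Arr C \<Longrightarrow> attachment (?A p) sq_dom sq_top (j p) (v p)"
    and dj: "\<And>p. p \<in> Arr C \<Longrightarrow> Dom C (j p) = Dom C p" by metis
  let ?E = "\<lambda>p. Cod C (j p)"
  have jH: "j p \<in> Hom C (Dom C p) (?E p)" if "p \<in> Arr C" for p
    using HomI[OF attachment_Arr[OF at[OF that]]] dj[OF that] by simp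
  have vH: "v p s \<in> Hom C (Cod C (sq_dom s)) (?E p)" and jv: "j p \<cdot> sq_top s = v p s \<cdot> sq_dom s"
    if "s \<in> ?A p" "p \<in> Arr C" for p s
    using attachmentD(4,5)[OF at[OF that(2)] that(1)] by simp_all
  have "\<exists>\<rho>. \<rho> \<in> Hom C (?E p) (Cod C p) \<and> \<rho> \<cdot> j p = p \<and> (\<forall>s\<in>?A p. \<rho> \<cdot> v p s = sq_bot s)" if p: "p \<in> Arr C" for p
  proof -
    have "p \<in> Hom C (Dom C (j p)) (Cod C p)" using HomI[OF p] dj[OF p] by simp
    from attachment_ex1[OF at[OF p] this As(3,4)[OF _ p]] show ?thesis by blast
  qed
  then obtain \<rho> where \<rho>: "\<And>p. p \<in> Arr C \<Longrightarrow> \<rho> p \<in> Hom C (?E p) (Cod C p)" "\<And>p. p \<in> Arr C \<Longrightarrow> \<rho> p \<cdot> j p = p"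
    "\<And>p s. p \<in> Arr C \<Longrightarrow> s \<in> ?A p \<Longrightarrow> \<rho> p \<cdot> v p s = sq_bot s" by metis

  define G where "G \<sigma> = snd (snd (far F \<sigma>))" for \<sigma>
  have farH: "far F \<sigma> \<in> Hom (pow_cat U (map_cat (map_cat C))) (?A (sq_dom \<sigma>)) (?A (sq_cod \<sigma>))"
    if "comm_square C \<sigma>" for \<sigma>
    using FF that by (simp add: is_functor_def)
  have far_F: "far F \<sigma> = (?A (sq_dom \<sigma>), ?A (sq_cod \<sigma>), G \<sigma>)" if "comm_square C \<sigma>" for \<sigma>
    using farH[OF that] by (cases "far F \<sigma>") (simp add: pow_cat_def Hom_def G_def)
  have G: "sq_dom (G \<sigma> s) = s" "sq_cod (G \<sigma> s) \<in> ?A (sq_cod \<sigma>)" "sq_bot (G \<sigma> s) = \<sigma>"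
    "comm_square (map_cat C) (G \<sigma> s)" if "comm_square C \<sigma>" "s \<in> ?A (sq_dom \<sigma>)" for \<sigma> s
    using F_arr[OF that(1)] farH[OF that(1)] that(2) unfolding far_F[OF that(1)]
    by (simp_all add: pow_cat_def Hom_def)
  define s' g where "s' \<sigma> s = sq_cod (G \<sigma> s)" and "g \<sigma> s = sq_top (G \<sigma> s)" for \<sigma> s
  have g: "s' \<sigma> s \<in> ?A (sq_cod \<sigma>)" "sq_dom (g \<sigma> s) = sq_dom s" "sq_cod (g \<sigma> s) = sq_dom (s' \<sigma> s)"
    "comm_square C (g \<sigma> s)" "sq_top (s' \<sigma> s) \<cdot> sq_top (g \<sigma> s) = sq_top \<sigma> \<cdot> sq_top s"
    "sq_bot (s' \<sigma> s) \<cdot> sq_bot (g \<sigma> s) = sq_bot \<sigma> \<cdot> sq_bot s"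
    if "comm_square C \<sigma>" "s \<in> ?A (sq_dom \<sigma>)" for \<sigma> s
  proof -
    have "g \<sigma> s \<in> Hom (map_cat C) (sq_dom s) (sq_dom (s' \<sigma> s))"
      and eq: "Comp (map_cat C) (s' \<sigma> s) (g \<sigma> s) = Comp (map_cat C) \<sigma> s"
      using G(4)[OF that] G(1,3)[OF that] unfolding comm_square_def[of "map_cat C"] g_def s'_def
      by (simp_all only: map_cat_simps)
    then show "sq_dom (g \<sigma> s) = sq_dom s" "sq_cod (g \<sigma> s) = sq_dom (s' \<sigma> s)" "comm_square C (g \<sigma> s)"
      by (simp_all add: Hom_def)
    show "sq_top (s' \<sigma> s) \<cdot> sq_top (g \<sigma> s) = sq_top \<sigma> \<cdot> sq_top s"
      "sq_bot (s' \<sigma> s) \<cdot> sq_bot (g \<sigma> s) = sq_bot \<sigma> \<cdot> sq_bot s"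
      using eq by simp_all
    show "s' \<sigma> s \<in> ?A (sq_cod \<sigma>)" using G(2)[OF that] by (simp add: s'_def)
  qed
  have gH: "sq_bot (g \<sigma> s) \<in> Hom C (Cod C (sq_dom s)) (Cod C (sq_dom (s' \<sigma> s)))"
    "sq_top (g \<sigma> s) \<in> Hom C (Dom C (sq_dom s)) (Dom C (sq_dom (s' \<sigma> s)))"
    "sq_dom (s' \<sigma> s) \<cdot> sq_top (g \<sigma> s) = sq_bot (g \<sigma> s) \<cdot> sq_dom s"
    if "comm_square C \<sigma>" "s \<in> ?A (sq_dom \<sigma>)" for \<sigma> s
    using comm_squareD(3-5)[OF g(4)[OF that]] g(2,3)[OF that] by simp_all
  have "\<exists>h. h \<in> Hom C (?E (sq_dom \<sigma>)) (?E (sq_cod \<sigma>)) \<and> h \<cdot> j (sq_dom \<sigma>) = j (sq_cod \<sigma>) \<cdot> sq_top \<sigma> \<and>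
      (\<forall>s\<in>?A (sq_dom \<sigma>). h \<cdot> v (sq_dom \<sigma>) s = v (sq_cod \<sigma>) (s' \<sigma> s) \<cdot> sq_bot (g \<sigma> s))"
    if \<sigma>: "comm_square C \<sigma>" for \<sigma>
  proof -
    note d = comm_squareD[OF \<sigma>]
    have "j (sq_cod \<sigma>) \<cdot> sq_top \<sigma> \<in> Hom C (Dom C (j (sq_dom \<sigma>))) (?E (sq_cod \<sigma>))"
      using jH[OF d(2)] d(3) dj[OF d(1)] by auto
    moreover have "v (sq_cod \<sigma>) (s' \<sigma> s) \<cdot> sq_bot (g \<sigma> s) \<in> Hom C (Cod C (sq_dom s)) (?E (sq_cod \<sigma>))"
      and "(j (sq_cod \<sigma>) \<cdot> sq_top \<sigma>) \<cdot> sq_top s = (v (sq_cod \<sigma>) (s' \<sigma> s) \<cdot> sq_bot (g \<sigma> s)) \<cdot> sq_dom s"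
      if s: "s \<in> ?A (sq_dom \<sigma>)" for s
    proof -
      note gs = g[OF \<sigma> s] and gHs = gH[OF \<sigma> s]
      note v' = vH[OF gs(1) d(2)]
      show "v (sq_cod \<sigma>) (s' \<sigma> s) \<cdot> sq_bot (g \<sigma> s) \<in> Hom C (Cod C (sq_dom s)) (?E (sq_cod \<sigma>))"
        using v' gHs(1) by blast
      have "(j (sq_cod \<sigma>) \<cdot> sq_top \<sigma>) \<cdot> sq_top s = j (sq_cod \<sigma>) \<cdot> sq_top (s' \<sigma> s) \<cdot> sq_top (g \<sigma> s)"
        using comp_assoc[OF As(2)[OF s d(1)] d(3) jH[OF d(2)]] gs(5) by simp
      also have "\<dots> = (v (sq_cod \<sigma>) (s' \<sigma> s) \<cdot> sq_dom (s' \<sigma> s)) \<cdot> sq_top (g \<sigma> s)"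
        by (rule comp_reduce[OF jv[OF gs(1) d(2)] gHs(2) As(2)[OF gs(1) d(2)] jH[OF d(2)]])
      also have "\<dots> = v (sq_cod \<sigma>) (s' \<sigma> s) \<cdot> sq_bot (g \<sigma> s) \<cdot> sq_dom s"
        using comp_assoc[OF gHs(2) HomI[OF As(1)[OF gs(1) d(2)]] v'] gHs(3) by simp
      also have "\<dots> = (v (sq_cod \<sigma>) (s' \<sigma> s) \<cdot> sq_bot (g \<sigma> s)) \<cdot> sq_dom s"
        using comp_assoc[OF HomI[OF As(1)[OF s d(1)]] gHs(1) v'] by simp
      finally show "(j (sq_cod \<sigma>) \<cdot> sq_top \<sigma>) \<cdot> sq_top s =
        (v (sq_cod \<sigma>) (s' \<sigma> s) \<cdot> sq_bot (g \<sigma> s)) \<cdot> sq_dom s" .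
    qed
    ultimately show ?thesis
      using attachment_ex1[OF at[OF d(1)], of "j (sq_cod \<sigma>) \<cdot> sq_top \<sigma>" _
          "\<lambda>s. v (sq_cod \<sigma>) (s' \<sigma> s) \<cdot> sq_bot (g \<sigma> s)"] by blast
  qed
  then obtain e where e: "\<And>\<sigma>. comm_square C \<sigma> \<Longrightarrow> e \<sigma> \<in> Hom C (?E (sq_dom \<sigma>)) (?E (sq_cod \<sigma>))"
    "\<And>\<sigma>. comm_square C \<sigma> \<Longrightarrow> e \<sigma> \<cdot> j (sq_dom \<sigma>) = j (sq_cod \<sigma>) \<cdot> sq_top \<sigma>"
    "\<And>\<sigma> s. comm_square C \<sigma> \<Longrightarrow> s \<in> ?A (sq_dom \<sigma>) \<Longrightarrow>
      e \<sigma> \<cdot> v (sq_dom \<sigma>) s = v (sq_cod \<sigma>) (s' \<sigma> s) \<cdot> sq_bot (g \<sigma> s)" by metis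
  let ?T = "\<lparr>fob = \<rho>, far = \<lambda>s. Square (\<rho> (sq_dom s)) (\<rho> (sq_cod s)) (e s) (sq_bot s)\<rparr>"
  have T: "right_part ?T"
  proof (rule right_partI[OF \<rho>(1) e(1)])
    fix \<sigma> assume \<sigma>: "comm_square C \<sigma>"
    note d = comm_squareD[OF \<sigma>]
    show "\<rho> (sq_cod \<sigma>) \<cdot> e \<sigma> = sq_bot \<sigma> \<cdot> \<rho> (sq_dom \<sigma>)"
    proof (rule attachment_ext[OF at[OF d(1)]])
      show "\<rho> (sq_cod \<sigma>) \<cdot> e \<sigma> \<in> Hom C (?E (sq_dom \<sigma>)) (Cod C (sq_cod \<sigma>))" using \<rho>(1)[OF d(2)] e(1)[OF \<sigma>] by blast
      show "sq_bot \<sigma> \<cdot> \<rho> (sq_dom \<sigma>) \<in> Hom C (?E (sq_dom \<sigma>)) (Cod C (sq_cod \<sigma>))" using \<rho>(1)[OF d(1)] d(4) by blast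
      have "(\<rho> (sq_cod \<sigma>) \<cdot> e \<sigma>) \<cdot> j (sq_dom \<sigma>) = \<rho> (sq_cod \<sigma>) \<cdot> j (sq_cod \<sigma>) \<cdot> sq_top \<sigma>"
        using comp_assoc[OF jH[OF d(1)] e(1)[OF \<sigma>] \<rho>(1)[OF d(2)]] e(2)[OF \<sigma>] by simp
      also have "\<dots> = sq_cod \<sigma> \<cdot> sq_top \<sigma>"
        by (rule comp_reduce[OF \<rho>(2)[OF d(2)] d(3) jH[OF d(2)] \<rho>(1)[OF d(2)]])
      also have "\<dots> = (sq_bot \<sigma> \<cdot> \<rho> (sq_dom \<sigma>)) \<cdot> j (sq_dom \<sigma>)"
        using comp_assoc[OF jH[OF d(1)] \<rho>(1)[OF d(1)] d(4)] \<rho>(2)[OF d(1)] d(5) by simp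
      finally show "(\<rho> (sq_cod \<sigma>) \<cdot> e \<sigma>) \<cdot> j (sq_dom \<sigma>) = (sq_bot \<sigma> \<cdot> \<rho> (sq_dom \<sigma>)) \<cdot> j (sq_dom \<sigma>)" .
      fix s assume s: "s \<in> ?A (sq_dom \<sigma>)"
      note gs = g[OF \<sigma> s] and gHs = gH[OF \<sigma> s]
      have "(\<rho> (sq_cod \<sigma>) \<cdot> e \<sigma>) \<cdot> v (sq_dom \<sigma>) s = \<rho> (sq_cod \<sigma>) \<cdot> v (sq_cod \<sigma>) (s' \<sigma> s) \<cdot> sq_bot (g \<sigma> s)"
        using comp_assoc[OF vH[OF s d(1)] e(1)[OF \<sigma>] \<rho>(1)[OF d(2)]] e(3)[OF \<sigma> s] by simp
      also have "\<dots> = sq_bot (s' \<sigma> s) \<cdot> sq_bot (g \<sigma> s)"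
        by (rule comp_reduce[OF \<rho>(3)[OF d(2) gs(1)] gHs(1) vH[OF gs(1) d(2)] \<rho>(1)[OF d(2)]])
      also have "\<dots> = (sq_bot \<sigma> \<cdot> \<rho> (sq_dom \<sigma>)) \<cdot> v (sq_dom \<sigma>) s"
        using comp_assoc[OF vH[OF s d(1)] \<rho>(1)[OF d(1)] d(4)] \<rho>(3)[OF d(1) s] gs(6) by simp
      finally show "(\<rho> (sq_cod \<sigma>) \<cdot> e \<sigma>) \<cdot> v (sq_dom \<sigma>) s = (sq_bot \<sigma> \<cdot> \<rho> (sq_dom \<sigma>)) \<cdot> v (sq_dom \<sigma>) s" .
    qed
  next
    fix p assume p: "p \<in> Arr C"
    note \<sigma> = comm_square_Ident[OF p]
    have E: "?E p \<in> Obj C" using HomD(5)[OF jH[OF p]] .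
    have "e (Ident (map_cat C) p) \<in> Hom C (?E p) (?E p)" using e(1)[OF \<sigma>] by simp
    then show "e (Ident (map_cat C) p) = Ident C (?E p)"
    proof (rule attachment_ext[OF at[OF p]])
      show "Ident C (?E p) \<in> Hom C (?E p) (?E p)" using E by blast
      show "e (Ident (map_cat C) p) \<cdot> j p = Ident C (?E p) \<cdot> j p"
        using e(2)[OF \<sigma>] comp_Ident[OF jH[OF p]] Ident_comp[OF jH[OF p]] by simp
      fix s assume s: "s \<in> ?A p"
      have "far F (Ident (map_cat C) p) = Ident (pow_cat U (map_cat (map_cat C))) (?A p)"
        using FF p unfolding is_functor_def by (metis map_cat_simps(1))
      then have "G (Ident (map_cat C) p) s = Ident (map_cat (map_cat C)) s"
        using s by (simp add: G_def pow_cat_def)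
      then have "s' (Ident (map_cat C) p) s = s" "sq_bot (g (Ident (map_cat C) p) s) = Ident C (Cod C (sq_dom s))"
        by (simp_all add: s'_def g_def)
      then show "e (Ident (map_cat C) p) \<cdot> v p s = Ident C (?E p) \<cdot> v p s"
        using e(3)[OF \<sigma>, of s] s comp_Ident[OF vH[OF s p]] Ident_comp[OF vH[OF s p]] by simp
    qed
  next
    fix \<sigma> \<tau> assume \<sigma>: "comm_square C \<sigma>" and \<tau>: "comm_square C \<tau>" and \<sigma>\<tau>: "sq_cod \<sigma> = sq_dom \<tau>"
    note d = comm_squareD[OF \<sigma>] and d' = comm_squareD[OF \<tau>] and c = comm_square_Comp[OF \<sigma> \<tau> \<sigma>\<tau>]
    let ?c = "Comp (map_cat C) \<tau> \<sigma>"
    have e\<sigma>: "e \<sigma> \<in> Hom C (?E (sq_dom \<sigma>)) (?E (sq_dom \<tau>))" using e(1)[OF \<sigma>] \<sigma>\<tau> by simp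
    have "e ?c \<in> Hom C (?E (sq_dom \<sigma>)) (?E (sq_cod \<tau>))" using e(1)[OF c] by simp
    then show "e ?c = e \<tau> \<cdot> e \<sigma>"
    proof (rule attachment_ext[OF at[OF d(1)]])
      show "e \<tau> \<cdot> e \<sigma> \<in> Hom C (?E (sq_dom \<sigma>)) (?E (sq_cod \<tau>))" using e\<sigma> e(1)[OF \<tau>] by blast
      have t: "sq_top \<sigma> \<in> Hom C (Dom C (sq_dom \<sigma>)) (Dom C (sq_dom \<tau>))" using d(3) \<sigma>\<tau> by simp
      have "(e \<tau> \<cdot> e \<sigma>) \<cdot> j (sq_dom \<sigma>) = e \<tau> \<cdot> j (sq_dom \<tau>) \<cdot> sq_top \<sigma>"
        using comp_assoc[OF jH[OF d(1)] e\<sigma> e(1)[OF \<tau>]] e(2)[OF \<sigma>] \<sigma>\<tau> by simp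
      also have "\<dots> = j (sq_cod \<tau>) \<cdot> sq_top \<tau> \<cdot> sq_top \<sigma>"
        using comp_reduce[OF e(2)[OF \<tau>] t jH[OF d'(1)] e(1)[OF \<tau>]] comp_assoc[OF t d'(3) jH[OF d'(2)]] by simp
      finally show "e ?c \<cdot> j (sq_dom \<sigma>) = (e \<tau> \<cdot> e \<sigma>) \<cdot> j (sq_dom \<sigma>)" using e(2)[OF c] by simp
      fix s assume s: "s \<in> ?A (sq_dom \<sigma>)"
      let ?s = "s' \<sigma> s"
      have s2: "?s \<in> ?A (sq_dom \<tau>)" using g(1)[OF \<sigma> s] \<sigma>\<tau> by simp
      have "far F ?c = Comp (pow_cat U (map_cat (map_cat C))) (far F \<tau>) (far F \<sigma>)"
        using FF \<sigma> \<tau> \<sigma>\<tau> unfolding is_functor_def by (metis map_cat_simps(2,3,4))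
      then have "G ?c s = Comp (map_cat (map_cat C)) (G \<tau> ?s) (G \<sigma> s)"
        unfolding far_F[OF c] far_F[OF \<sigma>] far_F[OF \<tau>] using s by (simp add: pow_cat_def s'_def)
      then have s'c: "s' ?c s = s' \<tau> ?s" "sq_bot (g ?c s) = sq_bot (g \<tau> ?s) \<cdot> sq_bot (g \<sigma> s)"
        by (simp_all add: s'_def g_def)
      note b = gH(1)[OF \<sigma> s] gH(1)[OF \<tau> s2]
      have "(e \<tau> \<cdot> e \<sigma>) \<cdot> v (sq_dom \<sigma>) s = e \<tau> \<cdot> v (sq_dom \<tau>) ?s \<cdot> sq_bot (g \<sigma> s)"
        using comp_assoc[OF vH[OF s d(1)] e\<sigma> e(1)[OF \<tau>]] e(3)[OF \<sigma> s] \<sigma>\<tau> by simp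
      also have "\<dots> = v (sq_cod \<tau>) (s' \<tau> ?s) \<cdot> sq_bot (g \<tau> ?s) \<cdot> sq_bot (g \<sigma> s)"
        using comp_reduce[OF e(3)[OF \<tau> s2] b(1) vH[OF s2 d'(1)] e(1)[OF \<tau>]]
          comp_assoc[OF b vH[OF g(1)[OF \<tau> s2] d'(2)]] by simp
      finally show "e ?c \<cdot> v (sq_dom \<sigma>) s = (e \<tau> \<cdot> e \<sigma>) \<cdot> v (sq_dom \<sigma>) s"
        using e(3)[OF c, of s] s s'c by simp
    qed
  qed
  have dT: "Dom C (fob ?T p) = ?E p" if "p \<in> Arr C" for p using HomD(2)[OF \<rho>(1)[OF that]] by simp
  show thesis
  proof (rule that[OF T])
    show "right_part_map id_part ?T j"
      unfolding right_part_map_def id_part_def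
      using jH dT \<rho>(2) e(2) by simp
    show "j p \<in> cell U C I" if "p \<in> Arr C" for p
      by (rule attachment_in_cell[OF small_A[OF that] at[OF that] A(2)[OF _ that]])
    fix i p u w assume p: "p \<in> Arr C" and i: "i \<in> I" and sq: "comm_square C (Square i p u w)"
    obtain s f where s: "s \<in> ?A p" and f: "f \<in> Hom (map_cat C) i (sq_dom s)"
      and uw: "Square i p u w = Comp (map_cat C) s f"
      using F_fact[OF p, unfolded factorization_property_def, rule_format, of "Square i p u w"] i sq by auto
    have f: "comm_square C f" "sq_dom f = i" "sq_cod f = sq_dom s" using f by (simp_all add: Hom_def)
    have uw: "u = sq_top s \<cdot> sq_top f" "w = sq_bot s \<cdot> sq_bot f" using uw by simp_all
    note fH = comm_squareD[OF f(1), unfolded f(2,3)] and v = vH[OF s p]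
    have "(v p s \<cdot> sq_bot f) \<cdot> i = v p s \<cdot> sq_dom s \<cdot> sq_top f"
      using comp_assoc[OF HomI[OF fH(1)] fH(4) v] fH(5) by simp
    also have "\<dots> = j p \<cdot> sq_top s \<cdot> sq_top f"
      using comp_assoc[OF fH(3) HomI[OF fH(2)] v] comp_assoc[OF fH(3) As(2)[OF s p] jH[OF p]] jv[OF s p] by simp
    finally have "(v p s \<cdot> sq_bot f) \<cdot> i = j p \<cdot> u" using uw by simp
    moreover have "\<rho> p \<cdot> v p s \<cdot> sq_bot f = w"
      using comp_reduce[OF \<rho>(3)[OF p s] fH(4) v \<rho>(1)[OF p]] uw by simp
    ultimately show "\<exists>h \<in> Hom C (Cod C i) (Dom C (fob ?T p)). h \<cdot> i = j p \<cdot> u \<and> fob ?T p \<cdot> h = w"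
      using fH(4) v dT[OF p] by (intro bexI[of _ "v p s \<cdot> sq_bot f"]) auto
  qed
qed

end

section \<open>The generalized small object argument\<close>

text \<open>
  The successor of an infinite cardinal \<open>\<mu> \<ge> \<kappa>\<close> is regular, so that no subset of size at most \<open>\<kappa>\<close> is cofinal
  in it, and it is below \<open>U\<close> because it is at most \<open>2\<^sup>\<mu>\<close>.
\<close>

lemma filtered_ordinal_exists:
  fixes U \<kappa> :: "'u rel"
  assumes U: "universe U" and \<kappa>: "Card_order \<kappa>" "\<kappa> <o U"
  obtains r :: "'u rel" where "small_ordinal U r" "filtered_ordinal \<kappa> r"
proof -
  let ?B = "Field \<kappa> <+> (UNIV :: nat set)"
  define W where "W = cardSuc |?B|"
  have \<kappa>B: "\<kappa> \<le>o |?B|"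
    using card_of_Field_ordIso[OF \<kappa>(1)] card_of_Plus1 ordIso_symmetric ordIso_ordLeq_trans by blast
  have "small U (Field \<kappa>)"
    using card_of_Field_ordIso[OF \<kappa>(1)] \<kappa>(2) unfolding small_def by (rule ordIso_ordLess_trans)
  then have B: "small U ?B" by (intro small_Plus U small_countable)
  obtain e :: "_ \<Rightarrow> 'u" where e: "inj_on e ?B" by (rule small_embed[OF U B])
  have "inj_on ((`) e) (Pow ?B)" by (rule inj_on_image_Pow[OF e])
  moreover have "(`) e ` Pow ?B \<subseteq> Pow (e ` ?B)" by blast
  ultimately have "|Pow ?B| \<le>o |Pow (e ` ?B)|" using card_of_ordLeq by blast
  moreover have "|Pow (e ` ?B)| <o U"
    using U small_image[OF B, of e] by (simp add: universe_def small_def)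
  ultimately have PB: "|Pow ?B| <o U" by (rule ordLeq_ordLess_trans)
  have cs: "Card_order W" unfolding W_def by (rule cardSuc_Card_order[OF card_of_Card_order])
  have wW: "Well_order W" using cs by (simp add: card_order_on_well_order_on)
  have "W \<le>o |Pow ?B|" unfolding W_def by (intro cardSuc_least card_of_Card_order card_of_Pow)
  then have "W <o U" using PB by (rule ordLeq_ordLess_trans)
  then have sW: "small U (Field W)"
    using card_of_Field_ordIso[OF cs] unfolding small_def by (rule ordIso_ordLess_trans[rotated])
  have inf: "infinite (Field W)" using cardSuc_finite[OF card_of_Card_order, of ?B] unfolding W_def by (simp add: Field_card_of)
  have reg: "regularCard W"
    unfolding W_def by (rule infinite_cardSuc_regularCard[OF _ card_of_Card_order]) (simp add: Field_card_of)
  obtain r :: "'u rel" and g where r: "small_ordinal U r" and g: "bij_betw g (Field r) (Field W)"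
    and rg: "\<And>a b. a \<in> Field r \<Longrightarrow> b \<in> Field r \<Longrightarrow> (a, b) \<in> r \<longleftrightarrow> (g a, g b) \<in> W"
    using well_order_copy[OF U wW sW] by metis
  have g_surj: "\<exists>b\<in>Field r. g b = w" if "w \<in> Field W" for w
    using bij_betw_imp_surj_on[OF g] that by (metis imageE)
  note gF = bij_betwE[OF g, rule_format]
  have "filtered_ordinal \<kappa> r"
    unfolding filtered_ordinal_def limit_ordinal_def
  proof (intro conjI ballI allI impI)
    show "Field r \<noteq> {}" using g inf by (auto simp: bij_betw_def)
    fix a assume a: "a \<in> Field r"
    obtain w where w: "w \<in> Field W" "g a \<noteq> w" "(g a, w) \<in> W"
      using infinite_Card_order_limit[OF cs inf gF[OF a]] by blast
    then obtain b where "b \<in> Field r" "g b = w" using g_surj by blast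
    then have "b \<in> aboveS r a" using w rg[OF a] by (auto simp: aboveS_def)
    then show "aboveS r a \<noteq> {}" by blast
  next
    fix A assume A: "A \<subseteq> Field r \<and> |A| \<le>o \<kappa>"
    have "|g ` A| \<le>o |?B|"
      by (rule ordLeq_transitive[OF ordLeq_transitive[OF card_of_image conjunct2[OF A]] \<kappa>B])
    then have "|g ` A| <o W"
      unfolding W_def by (rule ordLeq_ordLess_trans[OF _ cardSuc_greater[OF card_of_Card_order]])
    then have "\<not> |g ` A| =o W" by (rule not_ordLess_ordIso)
    moreover have gA: "g ` A \<subseteq> Field W" using A gF by auto
    ultimately have "\<not> cofinal (g ` A) W" using reg unfolding regularCard_def by blast
    then obtain w where w: "w \<in> Field W" "\<And>b. b \<in> g ` A \<Longrightarrow> w = b \<or> (w, b) \<notin> W"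
      unfolding cofinal_def by blast
    then obtain b where b: "b \<in> Field r" "g b = w" using g_surj by blast
    have "(a, b) \<in> r" if a: "a \<in> A" for a
    proof -
      have aF: "a \<in> Field r" using a A by blast
      have "(g a, w) \<in> W"
        using w(2)[of "g a"] a wo_total[OF wW gF[OF aF] w(1)] wo_refl[OF wW w(1)] by auto
      then show ?thesis using rg[OF aF b(1)] b(2) by simp
    qed
    then have "b \<in> Above r A" using b(1) by (simp add: Above_def)
    then show "Above r A \<noteq> {}" by blast
  qed
  then show thesis using that r by blast
qed

context cat
begin

text \<open>
  \<open>\<iota> b \<cdot> u'\<close> is constant on the equivalence classes of pairs \<open>(b, u')\<close>, so the natural map sends a class
  to this composite for any of its members.
\<close>
lemma hom_colim_surj:
  assumes bij: "bij_betw (hom_colim_map C \<iota>) (hom_colim (ordinal_cat R) C A X) (Hom C A c)"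
    and X: "diagram R X" and \<iota>: "cocone R X c \<iota>"
    and u: "u \<in> Hom C A c"
  obtains b u' where "b \<in> Field R" "u' \<in> Hom C A (fob X b)" "u = \<iota> b \<cdot> u'"
proof -
  let ?S = "\<lambda>b. Hom C A (fob X b)"
  let ?r = "set_colim_rel (ordinal_cat R) ?S (\<lambda>k g. far X k \<cdot> g)"
  let ?e = "(?r \<union> ?r\<inverse>)\<^sup>*"
  let ?f = "\<lambda>(b, g). \<iota> b \<cdot> g"
  have "u \<in> hom_colim_map C \<iota> ` hom_colim (ordinal_cat R) C A X" using bij u by (simp add: bij_betw_def)
  then obtain Q where Q: "Q \<in> hom_colim (ordinal_cat R) C A X" "u = hom_colim_map C \<iota> Q" by blast
  then obtain b u' where b: "b \<in> Field R" "u' \<in> Hom C A (fob X b)" and Qe: "Q = ?e `` {(b, u')}"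
    unfolding hom_colim_def set_colim_def quotient_def by (auto simp: ordinal_cat_def)
  have inv: "?f y = ?f x" if "(x, y) \<in> ?r" for x y
  proof -
    from that obtain a b g where xy: "x = (a, g)" "y = (b, far X (a, b) \<cdot> g)" "(a, b) \<in> R" "g \<in> Hom C A (fob X a)"
      unfolding set_colim_rel_def by (auto simp: ordinal_cat_def)
    have "\<iota> b \<cdot> far X (a, b) \<cdot> g = \<iota> a \<cdot> g"
      by (rule comp_reduce[OF cocone_comp[OF \<iota> xy(3)] xy(4) functor_Hom[OF X xy(3)]
            cocone_Hom[OF \<iota> Field_right[OF xy(3)]]])
    then show ?thesis using xy by simp
  qed
  have "?f y = ?f x" if "(x, y) \<in> ?e" for x y
    using that
  proof (induction rule: rtrancl_induct)
    case (step y z)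
    then have "(y, z) \<in> ?r \<or> (z, y) \<in> ?r" by auto
    then have "?f z = ?f y" using inv[of y z] inv[of z y] by metis
    then show ?case using step by simp
  qed simp
  then have "?f ` Q = {\<iota> b \<cdot> u'}"
    unfolding Qe by (force simp: image_iff)
  then have "u = \<iota> b \<cdot> u'" using Q(2) by (simp add: hom_colim_map_def)
  then show thesis using that b by blast
qed

end

theorem proposition4p1:
  fixes U :: "'u rel" and C :: "('o, 'm) category" and I :: "'m set"
  assumes "universe U"
    and "category C" and "has_small_colimits U C"
    and "instrumented U C I"
  shows "\<exists>\<gamma> \<delta>. functorial_factorization C \<gamma> \<delta> \<and>
    (\<forall>f\<in>Arr C. f = Comp C (fob \<delta> f) (fob \<gamma> f) \<and>
       fob \<gamma> f \<in> cell U C I \<and> fob \<delta> f \<in> inj_maps C I)"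
proof -
  interpret small_cocomplete C U by unfold_locales (use assms in auto)
  let ?D = right_part_cat
  interpret D: cat ?D by unfold_locales (rule category_right_part_cat)
  obtain \<kappa> :: "'u rel" and F where \<kappa>: "Card_order \<kappa>" "\<kappa> <o U"
    and small: "\<And>i. i \<in> I \<Longrightarrow> small_relative U C \<kappa> (cell U C I) (Dom C i)"
    and F: "factorization_setup U (map_cat C) I F"
    using assms(4) unfolding instrumented_def by blast
  obtain T j where T: "right_part T" and j: "right_part_map id_part T j"
    and j_cell: "\<And>p. p \<in> Arr C \<Longrightarrow> j p \<in> cell U C I"
    and solve: "\<And>i p u v. p \<in> Arr C \<Longrightarrow> i \<in> I \<Longrightarrow> comm_square C (Square i p u v) \<Longrightarrow>
      \<exists>h \<in> Hom C (Cod C i) (Dom C (fob T p)). h \<cdot> i = j p \<cdot> u \<and> fob T p \<cdot> h = v"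
    by (rule one_step_factorization[OF F]) (rule that)
  obtain r :: "'u rel" where r: "small_ordinal U r" "filtered_ordinal \<kappa> r"
    by (rule filtered_ordinal_exists[OF universe \<kappa>])
  have wr: "Well_order r" and sr: "small U (Field r)" using r(1) by (simp_all add: small_ordinal_def)
  have lr: "limit_ordinal r" using r(2) by (simp add: filtered_ordinal_def)
  have rne: "Field r \<noteq> {}" using lr by (simp add: limit_ordinal_def)

  let ?TK = "\<lambda>K. \<lparr>fob = \<lambda>f. fob T (fob K f), far = \<lambda>s. far T (far K s)\<rparr>"
  define t where "t K = (K, ?TK K, \<lambda>f\<in>Arr C. j (fob K f))" for K :: "'m endo"
  have jD: "j p \<in> Hom C (Dom C p) (Dom C (fob T p))" "fob T p \<cdot> j p = p" if "p \<in> Arr C" for p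
    using right_part_mapD(1,2)[OF j that] by (simp_all add: id_part_def)
  have j_nat: "sq_top (far T s) \<cdot> j (sq_dom s) = j (sq_cod s) \<cdot> sq_top s" if "comm_square C s" for s
    using right_part_mapD(3)[OF j that] by (simp add: id_part_def)
  have t_map: "right_part_map K (?TK K) (\<lambda>f\<in>Arr C. j (fob K f))" if K: "right_part K" for K
    unfolding right_part_map_def
    using jD[OF right_partD(1)[OF K]] j_nat[OF right_partD(4)[OF K]] right_partD(5,6)[OF K] comm_squareD(1,2)
    by simp
  have tH: "t K \<in> Hom ?D K (?TK K)" if K: "K \<in> Obj ?D" for K
    using K t_map[of K] right_part_comp[OF _ T, of K] by (simp add: t_def right_part_cat_def Hom_def)
  \<comment> \<open>colimits are required in \<open>C\<close>, after evaluation at each map\<close>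
  define Good where "Good g X K \<iota> \<longleftrightarrow> (\<forall>f\<in>Arr C. is_colimit (ordinal_cat (Restr r (underS r g))) C
    (at_map f X) (Dom C (fob K f)) (\<lambda>b. snd (snd (\<iota> b)) f))"
    for g and X :: "('u, 'u \<times> 'u, 'm endo, 'm endo \<times> 'm endo \<times> ('m \<Rightarrow> 'm)) funct"
      and K :: "'m endo" and \<iota> :: "'u \<Rightarrow> 'm endo \<times> 'm endo \<times> ('m \<Rightarrow> 'm)"
  have FR: "Field (Restr r (underS r g)) = underS r g" for g
    using wr by (intro Field_Restr Order_Relation.underS_Field) (simp add: order_on_defs)
  obtain X where X: "is_functor (ordinal_cat r) ?D X"
    and X_min: "\<And>m. m \<in> Field r \<Longrightarrow> (\<And>a. a \<in> Field r \<Longrightarrow> (m, a) \<in> r) \<Longrightarrow> fob X m = id_part"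
    and X_suc: "\<And>a b. succ_in r a b \<Longrightarrow> far X (a, b) = t (fob X a)"
    and X_lim: "\<And>g. limit_in r g \<Longrightarrow> Good g X (fob X g) (\<lambda>b. far X (b, g))"
  proof (rule D.transfinite_iteration[OF wr, of id_part t Good])
    show "id_part \<in> Obj ?D" using right_part_id by (simp add: right_part_cat_def)
    show "t K \<in> Arr ?D" "Dom ?D (t K) = K" if "K \<in> Obj ?D" for K
      using tH[OF that] by (simp_all add: Hom_def)
    show "Good g Y K \<kappa>"
      if "Good g X K \<iota>" and eq: "\<And>b. b \<in> underS r g \<Longrightarrow> fob X b = fob Y b"
        "\<And>a b. (a, b) \<in> r \<Longrightarrow> b \<in> underS r g \<Longrightarrow> far X (a, b) = far Y (a, b)"
        "\<And>b. b \<in> underS r g \<Longrightarrow> \<iota> b = \<kappa> b" for g X Y K \<iota> \<kappa>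
      unfolding Good_def
    proof (intro ballI)
      fix f assume "f \<in> Arr C"
      then have "is_colimit (ordinal_cat (Restr r (underS r g))) C
          (at_map f X) (Dom C (fob K f)) (\<lambda>b. snd (snd (\<iota> b)) f)" using that(1) by (simp add: Good_def)
      then show "is_colimit (ordinal_cat (Restr r (underS r g))) C
          (at_map f Y) (Dom C (fob K f)) (\<lambda>b. snd (snd (\<kappa> b)) f)"
        by (rule colimit_cong) (use eq FR in \<open>auto simp: at_map_def\<close>)
    qed
    show "\<exists>K \<iota>. is_cocone (ordinal_cat (Restr r (underS r g))) ?D X K \<iota> \<and> Good g X K \<iota>"
      if "is_functor (ordinal_cat (Restr r (underS r g))) ?D X" for g X
      unfolding Good_def
    proof (rule right_part_colimit[OF _ _ that])
      have "Well_order (Restr r (underS r g))" by (rule Well_order_Restr[OF wr])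
      then show "Preorder (Restr r (underS r g))" by (simp add: order_on_defs)
      show "small U (Field (Restr r (underS r g)))"
        unfolding FR by (rule small_subset[OF sr Order_Relation.underS_Field])
    qed
  qed (rule that; blast)
  have "Preorder r" using wr by (simp add: order_on_defs)
  from right_part_colimit[OF this sr X] obtain \<delta> \<iota> where \<iota>: "is_cocone (ordinal_cat r) ?D X \<delta> \<iota>"
    and \<delta>_co: "\<And>f. f \<in> Arr C \<Longrightarrow>
      colim r (at_map f X) (Dom C (fob \<delta> f)) (\<lambda>b. snd (snd (\<iota> b)) f)"
    by blast
  have \<delta>: "right_part \<delta>" using D.cocone_Obj[OF \<iota>] by (simp add: right_part_cat_def)
  have XR: "right_part (fob X b)" if "b \<in> Field r" for b
    using D.functor_Obj[OF X that] by (simp add: right_part_cat_def)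
  have \<iota>_map: "right_part_map (fob X b) \<delta> (snd (snd (\<iota> b)))" if "b \<in> Field r" for b
    using right_part_cat_Hom(3)[OF D.cocone_Hom[OF \<iota> that]] .

  have at_seq: "transfinite_sequence C r (at_map f X)" if f: "f \<in> Arr C" for f
    unfolding transfinite_sequence_iff[OF wr]
    using at_map_functor[OF X f] X_lim f by (simp add: Good_def at_map_def)
  have at_suc: "far (at_map f X) (a, b) = j (fob (fob X a) f)" if "f \<in> Arr C" "succ_in r a b" for f a b
    using X_suc[OF that(2)] that(1) by (simp add: at_map_def t_def)
  have at_steps: "steps_in (cell U C I) r (at_map f X)" if f: "f \<in> Arr C" for f
    unfolding steps_in_iff[OF wr]
    using at_suc[OF f] j_cell right_partD(1)[OF XR f] by (auto simp: succ_in_def dest: Field_left)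
  let ?m = "wo_rel.minim r (Field r)"
  define c where "c = snd (snd (\<iota> ?m))"
  have m: "?m \<in> Field r" "fob X ?m = id_part" using wo_minim[OF wr rne] X_min by simp_all
  have c_map: "right_part_map id_part \<delta> c" using \<iota>_map[OF m(1)] m(2) by (simp add: c_def)
  have cD: "c f \<in> Hom C (Dom C f) (Dom C (fob \<delta> f))" "fob \<delta> f \<cdot> c f = f" if "f \<in> Arr C" for f
    using right_part_mapD(1,2)[OF c_map that] by (simp_all add: id_part_def)
  have c_nat: "sq_top (far \<delta> s) \<cdot> c (sq_dom s) = c (sq_cod s) \<cdot> sq_top s" if "comm_square C s" for s
    using right_part_mapD(3)[OF c_map that] by (simp add: id_part_def)
  have c_cell: "c f \<in> cell U C I" if f: "f \<in> Arr C" for f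
    using cell_transfinite_composition[OF universe r(1) lr at_seq[OF f] at_steps[OF f] \<delta>_co[OF f]]
    by (simp add: c_def)

  have inj: "lifting_property C i (fob \<delta> f)" if f: "f \<in> Arr C" and i: "i \<in> I" for f i
    unfolding lifting_property_def
  proof (intro allI impI)
    fix u v assume sq: "comm_square C (Square i (fob \<delta> f) u v)"
    note q = comm_squareD[OF sq, simplified]
    note co = colimit_cocone[OF \<delta>_co[OF f]]
    have "bij_betw (hom_colim_map C (\<lambda>b. snd (snd (\<iota> b)) f))
        (hom_colim (ordinal_cat r) C (Dom C i) (at_map f X)) (Hom C (Dom C i) (Dom C (fob \<delta> f)))"
      using small[OF i] r at_seq[OF f] at_steps[OF f] \<delta>_co[OF f] unfolding small_relative_def by blast
    from hom_colim_surj[OF this at_map_functor[OF X f] co q(3)] obtain b u'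
      where b: "b \<in> Field r" and u': "u' \<in> Hom C (Dom C i) (fob (at_map f X) b)"
        and u: "u = snd (snd (\<iota> b)) f \<cdot> u'" by blast
    obtain b' where b': "succ_in r b b'"
      using succ_in_suc(1)[OF wr b] lr b unfolding limit_ordinal_def by blast
    have bb': "(b, b') \<in> r" using b' by (simp add: succ_in_def)
    have b'F: "b' \<in> Field r" by (rule Field_right[OF bb'])
    let ?p = "fob (fob X b) f"
    have p: "?p \<in> Arr C" "Cod C ?p = Cod C f" using right_partD(1,2)[OF XR[OF b] f] .
    have X_b': "fob X b' = ?TK (fob X b)"
      using D.functor_Hom[OF X bb'] X_suc[OF b'] by (simp add: Hom_def right_part_cat_def t_def)
    have u'H: "u' \<in> Hom C (Dom C i) (Dom C ?p)" using u' by (simp add: at_map_def)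
    note \<iota>b = right_part_mapD(1,2)[OF \<iota>_map[OF b] f] and \<iota>b' = right_part_mapD(1,2)[OF \<iota>_map[OF b'F] f, unfolded X_b', simplified]
    have \<delta>H: "fob \<delta> f \<in> Hom C (Dom C (fob \<delta> f)) (Cod C f)"
      using HomI[OF right_partD(1)[OF \<delta> f]] right_partD(2)[OF \<delta> f] by simp
    have "?p \<cdot> u' = v \<cdot> i"
      using comp_reduce[OF \<iota>b(2) u'H \<iota>b(1) \<delta>H] q(5) u by simp
    then have "comm_square C (Square i ?p u' v)"
      using q p u'H right_partD(2)[OF \<delta> f] by (simp add: comm_square_def)
    from solve[OF p(1) i this] obtain h where h: "h \<in> Hom C (Cod C i) (Dom C (fob T ?p))"
      "h \<cdot> i = j ?p \<cdot> u'" "fob T ?p \<cdot> h = v" by blast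
    \<comment> \<open>the square lives at stage \<open>b\<close>; its lift is found at the next stage \<open>b'\<close>\<close>
    let ?l = "snd (snd (\<iota> b')) f \<cdot> h"
    have "?l \<cdot> i = snd (snd (\<iota> b')) f \<cdot> j ?p \<cdot> u'"
      using comp_assoc[OF HomI[OF q(1)] h(1) \<iota>b'(1)] h(2) by simp
    also have "\<dots> = u"
      using comp_reduce[OF cocone_comp[OF co bb', unfolded at_suc[OF f b']] u'H jD(1)[OF p(1)] \<iota>b'(1)] u by simp
    finally have "?l \<cdot> i = u" .
    moreover have "fob \<delta> f \<cdot> ?l = v"
      using comp_reduce[OF \<iota>b'(2) h(1) \<iota>b'(1) \<delta>H] h(3) by simp
    ultimately show "\<exists>h\<in>Hom C (Cod C i) (Dom C (fob \<delta> f)). h \<cdot> i = u \<and> fob \<delta> f \<cdot> h = v"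
      using comp_in_Hom[OF h(1) \<iota>b'(1)] by blast
  qed

  let ?\<gamma> = "\<lparr>fob = c, far = \<lambda>s. Square (c (sq_dom s)) (c (sq_cod s)) (sq_top s) (sq_top (far \<delta> s))\<rparr>"
  have cA: "c f \<in> Arr C" "Dom C (c f) = Dom C f" "Cod C (c f) = Dom C (fob \<delta> f)" if "f \<in> Arr C" for f
    using HomD[OF cD(1)[OF that]] by simp_all
  have "comm_square C (far ?\<gamma> s)" if s: "comm_square C s" for s
    using comm_squareD[OF s] cA right_partD(8)[OF \<delta> s] c_nat[OF s] by (simp add: comm_square_def)
  then have \<gamma>: "is_functor (map_cat C) (map_cat C) ?\<gamma>"
    using cA right_partD(3,10)[OF \<delta>] unfolding is_functor_def by (simp add: Hom_def)
  have "functorial_factorization C ?\<gamma> \<delta>"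
    unfolding functorial_factorization_def
    using \<gamma> \<delta> cA cD(2) by (simp add: right_part_def)
  then show ?thesis
    using cD(2) c_cell inj right_partD(1)[OF \<delta>]
    by (intro exI[of _ ?\<gamma>] exI[of _ \<delta>]) (simp add: inj_maps_def)
qed

end
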